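(* Let $m\in\mathbb{N}$ and let $b_0,\dots,b_m\in\mathbb{R}[x]$ with $b_m\neq 0$. Assume: (1) for each $0\le l\le m$, either $\inf_{x\in\mathbb{R}} b_l(x)>0$ or $b_l\equiv 0$; and (2) $\deg(b_l)\le\max\{\deg(b_0),0\}$ whenever $1\le l\le m$. Let $L=\sum_{l=0}^m(-1)^l\partial^l b_l(x)\partial^l$, regarded as an unbounded operator on $L^2(\mathbb{R})$ with domain $\mathcal{D}(L)=\mathcal{S}$. Then for every $n\in\mathbb{N}$ the operator $L^n$ (with domain $\mathcal{D}(L^n)=\mathcal{S}$) is essentially self-adjoint.
   Context: $L^2(\mathbb{R})=L^2(\mathbb{R},dx)$ is the complex Hilbert space of square integrable functions with respect to Lebesgue measure, $\mathcal{S}=\mathcal{S}(\mathbb{R})$ is the space of complex valued Schwartz test functions, $\partial=d/dx$, and $\partial^l b\,\partial^l$ denotes the operator $f\mapsto \partial^l(b\cdot\partial^l f)$. Since the coefficients are polynomials, $L$ maps $\mathcal{S}$ into $\mathcal{S}$, so $L^n$ is defined on $\mathcal{S}$. The zero polynomial has degree $-\infty$. *)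

theory Defs
  imports "HOL-Analysis.Analysis" "HOL-Computational_Algebra.Polynomial"
begin

section \<open>The complex Hilbert space of square integrable functions on the real line\<close>

definition square_integrable :: "(real \<Rightarrow> complex) \<Rightarrow> bool" where
  "square_integrable f \<longleftrightarrow>
     f \<in> borel_measurable lborel \<and> integrable lborel (\<lambda>x. (cmod (f x))\<^sup>2)"

definition L2_rel :: "(real \<Rightarrow> complex) \<Rightarrow> (real \<Rightarrow> complex) \<Rightarrow> bool" where
  "L2_rel f g \<longleftrightarrow> square_integrable f \<and> square_integrable g \<and> (AE x in lborel. f x = g x)"

lemma square_integrable_0: "square_integrable (\<lambda>x. 0)"
  by (simp add: square_integrable_def)

lemma square_integrable_scaleR:
  assumes "square_integrable f"
  shows "square_integrable (\<lambda>x. c *\<^sub>R f x)"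
  using assms by (auto simp: square_integrable_def power_mult_distrib)

lemma square_integrable_add:
  assumes "square_integrable f" "square_integrable g"
  shows "square_integrable (\<lambda>x. f x + g x)"
proof -
  have [measurable]: "f \<in> borel_measurable lborel" "g \<in> borel_measurable lborel"
    using assms by (auto simp: square_integrable_def)
  have "integrable lborel (\<lambda>x. 2 * (cmod (f x))\<^sup>2 + 2 * (cmod (g x))\<^sup>2)"
    using assms by (auto simp: square_integrable_def)
  moreover have "(cmod (f x + g x))\<^sup>2 \<le> 2 * (cmod (f x))\<^sup>2 + 2 * (cmod (g x))\<^sup>2" for x
  proof -
    have "(cmod (f x + g x))\<^sup>2 \<le> (cmod (f x) + cmod (g x))\<^sup>2"
      by (intro power_mono norm_triangle_ineq) auto
    also have "\<dots> \<le> 2 * (cmod (f x))\<^sup>2 + 2 * (cmod (g x))\<^sup>2"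
      using sum_squares_bound[of "cmod (f x)" "cmod (g x)"] by (simp add: power2_sum)
    finally show ?thesis .
  qed
  ultimately have "integrable lborel (\<lambda>x. (cmod (f x + g x))\<^sup>2)"
    by - (rule Bochner_Integration.integrable_bound, auto)
  then show ?thesis
    by (simp add: square_integrable_def)
qed

lemma square_integrable_diff:
  assumes "square_integrable f" "square_integrable g"
  shows "square_integrable (\<lambda>x. f x - g x)"
  using square_integrable_add[OF assms(1) square_integrable_scaleR[OF assms(2), of "-1"]]
  by simp

lemma square_integrable_imp_integrable_mult:
  assumes "square_integrable f" "square_integrable g"
  shows "integrable lborel (\<lambda>x. f x * cnj (g x))"
proof -
  have [measurable]: "f \<in> borel_measurable lborel" "g \<in> borel_measurable lborel"
    using assms by (auto simp: square_integrable_def)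
  have [measurable]: "cnj \<in> borel_measurable borel"
    by (intro borel_measurable_continuous_onI continuous_intros)
  have "integrable lborel (\<lambda>x. (cmod (f x))\<^sup>2 + (cmod (g x))\<^sup>2)"
    using assms by (auto simp: square_integrable_def)
  moreover have "cmod (f x * cnj (g x)) \<le> (cmod (f x))\<^sup>2 + (cmod (g x))\<^sup>2" for x
  proof -
    have "0 \<le> cmod (f x) * cmod (g x)" by simp
    moreover have "2 * (cmod (f x) * cmod (g x)) \<le> (cmod (f x))\<^sup>2 + (cmod (g x))\<^sup>2"
      using sum_squares_bound[of "cmod (f x)" "cmod (g x)"] by (simp add: mult.assoc)
    ultimately show ?thesis
      unfolding norm_mult complex_mod_cnj by linarith
  qed
  ultimately show ?thesis
    by - (rule Bochner_Integration.integrable_bound, auto)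
qed

quotient_type L2 = "real \<Rightarrow> complex" / partial: L2_rel
  morphisms rep_L2 abs_L2
proof (rule part_equivpI)
  show "\<exists>f. L2_rel f f"
    using square_integrable_0 by (auto simp: L2_rel_def)
  show "symp L2_rel"
    by (rule sympI) (auto simp: L2_rel_def elim: eventually_mono)
  show "transp L2_rel"
  proof (rule transpI)
    fix f g h
    assume fg: "L2_rel f g" and gh: "L2_rel g h"
    have "AE x in lborel. f x = g x" "AE x in lborel. g x = h x"
      using fg gh unfolding L2_rel_def by blast+
    then have "AE x in lborel. f x = h x"
      by eventually_elim simp
    then show "L2_rel f h"
      using fg gh unfolding L2_rel_def by blast
  qed
qed

text \<open>The inner product is linear in the first and antilinear in the second argument.\<close>

lift_definition cinner_L2 :: "L2 \<Rightarrow> L2 \<Rightarrow> complex"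
  is "\<lambda>f g. LINT x|lborel. f x * cnj (g x)"
proof -
  fix f f' g g'
  assume rel: "L2_rel f f'" "L2_rel g g'"
  then have int: "integrable lborel (\<lambda>x. f x * cnj (g x))" "integrable lborel (\<lambda>x. f' x * cnj (g' x))"
    unfolding L2_rel_def by (blast intro: square_integrable_imp_integrable_mult)+
  have "AE x in lborel. f x = f' x" "AE x in lborel. g x = g' x"
    using rel unfolding L2_rel_def by blast+
  then have "AE x in lborel. f x * cnj (g x) = f' x * cnj (g' x)"
    by eventually_elim simp
  then show "(LINT x|lborel. f x * cnj (g x)) = (LINT x|lborel. f' x * cnj (g' x))"
    using int by (intro integral_cong_AE borel_measurable_integrable)
qed

text \<open>
  The real part of the inner product makes the space a real inner product space with the
  same norm; this provides the usual topology, in particular on pairs.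
\<close>

instantiation L2 :: real_inner
begin

lift_definition zero_L2 :: L2 is "\<lambda>x. 0"
  by (simp add: L2_rel_def square_integrable_0)

lift_definition plus_L2 :: "L2 \<Rightarrow> L2 \<Rightarrow> L2" is "\<lambda>f g x. f x + g x"
  by (auto simp: L2_rel_def intro: square_integrable_add)

lift_definition minus_L2 :: "L2 \<Rightarrow> L2 \<Rightarrow> L2" is "\<lambda>f g x. f x - g x"
  by (auto simp: L2_rel_def intro: square_integrable_diff)

lift_definition scaleR_L2 :: "real \<Rightarrow> L2 \<Rightarrow> L2" is "\<lambda>c f x. c *\<^sub>R f x"
  by (auto simp: L2_rel_def intro!: square_integrable_scaleR)

lift_definition uminus_L2 :: "L2 \<Rightarrow> L2" is "\<lambda>f x. - f x"
proof -
  fix f g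
  assume "L2_rel f g"
  then show "L2_rel (\<lambda>x. - f x) (\<lambda>x. - g x)"
    using square_integrable_scaleR[of f "-1"] square_integrable_scaleR[of g "-1"]
    by (auto simp: L2_rel_def)
qed

definition inner_L2 :: "L2 \<Rightarrow> L2 \<Rightarrow> real" where
  "inner_L2 f g = Re (cinner_L2 f g)"

definition norm_L2 :: "L2 \<Rightarrow> real" where
  "norm_L2 f = sqrt (inner f f)"

definition sgn_L2 :: "L2 \<Rightarrow> L2" where
  "sgn_L2 f = inverse (norm f) *\<^sub>R f"

definition dist_L2 :: "L2 \<Rightarrow> L2 \<Rightarrow> real" where
  "dist_L2 f g = norm (f - g)"

definition uniformity_L2 :: "(L2 \<times> L2) filter" where
  "uniformity_L2 = (INF e\<in>{0<..}. principal {(f, g). dist f g < e})"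

definition open_L2 :: "L2 set \<Rightarrow> bool" where
  "open_L2 U \<longleftrightarrow> (\<forall>f\<in>U. \<forall>\<^sub>F (f', g) in uniformity. f' = f \<longrightarrow> g \<in> U)"

lemma inner_L2_self_abs:
  "(LINT x|lborel. f x * cnj (f x)) = complex_of_real (LINT x|lborel. (cmod (f x))\<^sup>2)"
  unfolding complex_norm_square[symmetric] by (rule integral_complex_of_real)

instance
proof
  fix a b c :: L2 and r s :: real and U :: "L2 set"
  show "a + b + c = a + (b + c)"
    by transfer (auto simp: L2_rel_def add.assoc intro!: square_integrable_add)
  show "a + b = b + a"
    by transfer (auto simp: L2_rel_def add.commute intro!: square_integrable_add)
  show "0 + a = a"
    by transfer (auto simp: L2_rel_def)
  show "- a + a = 0"
    by transfer (auto simp: L2_rel_def square_integrable_0)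
  show "a - b = a + - b"
    by transfer (auto simp: L2_rel_def intro!: square_integrable_diff)
  show "r *\<^sub>R (a + b) = r *\<^sub>R a + r *\<^sub>R b"
    by transfer (auto simp: L2_rel_def scaleR_add_right
          intro!: square_integrable_add square_integrable_scaleR)
  show "(r + s) *\<^sub>R a = r *\<^sub>R a + s *\<^sub>R a"
    by transfer (auto simp: L2_rel_def scaleR_add_left
          intro!: square_integrable_add square_integrable_scaleR)
  show "r *\<^sub>R s *\<^sub>R a = (r * s) *\<^sub>R a"
    by transfer (auto simp: L2_rel_def intro!: square_integrable_scaleR)
  show "1 *\<^sub>R a = a"
    by transfer (auto simp: L2_rel_def)
  show "sgn a = inverse (norm a) *\<^sub>R a"
    by (rule sgn_L2_def)
  show "dist a b = norm (a - b)"
    by (rule dist_L2_def)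
  show "(uniformity :: (L2 \<times> L2) filter) = (INF e\<in>{0<..}. principal {(f, g). dist f g < e})"
    by (rule uniformity_L2_def)
  show "open U \<longleftrightarrow> (\<forall>f\<in>U. \<forall>\<^sub>F (f', g) in uniformity. f' = f \<longrightarrow> g \<in> U)"
    by (rule open_L2_def)
  show "norm a = sqrt (inner a a)"
    by (rule norm_L2_def)
  have "cinner_L2 a b = cnj (cinner_L2 b a)"
    by transfer (simp add: mult.commute flip: Bochner_Integration.integral_cnj)
  then show "inner a b = inner b a"
    by (simp add: inner_L2_def)
  have "cinner_L2 (a + b) c = cinner_L2 a c + cinner_L2 b c"
    by transfer
      (auto simp: L2_rel_def distrib_right square_integrable_imp_integrable_mult
        intro!: Bochner_Integration.integral_add)
  then show "inner (a + b) c = inner a c + inner b c"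
    by (simp add: inner_L2_def)
  have "cinner_L2 (r *\<^sub>R a) b = r *\<^sub>R cinner_L2 a b"
    by transfer (simp add: scaleR_conv_of_real mult.assoc)
  then show "inner (r *\<^sub>R a) b = r * inner a b"
    by (simp add: inner_L2_def)
  show "0 \<le> inner a a"
    unfolding inner_L2_def by transfer (simp add: inner_L2_self_abs)
  show "inner a a = 0 \<longleftrightarrow> a = 0"
    unfolding inner_L2_def
  proof transfer
    fix f
    assume "L2_rel f f"
    then have f: "square_integrable f" by (simp add: L2_rel_def)
    have "Re (LINT x|lborel. f x * cnj (f x)) = (LINT x|lborel. (cmod (f x))\<^sup>2)"
      by (simp add: inner_L2_self_abs)
    also have "\<dots> = 0 \<longleftrightarrow> (AE x in lborel. (cmod (f x))\<^sup>2 = 0)"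
      using f by (intro integral_nonneg_eq_0_iff_AE) (auto simp: square_integrable_def)
    finally show "Re (LINT x|lborel. f x * cnj (f x)) = 0 \<longleftrightarrow> L2_rel f (\<lambda>x. 0)"
      using f by (simp add: L2_rel_def square_integrable_0)
  qed
qed

end

section \<open>Unbounded operators, represented by their graphs\<close>

type_synonym L2_operator = "(L2 \<times> L2) set"

definition densely_defined :: "L2_operator \<Rightarrow> bool" where
  "densely_defined T \<longleftrightarrow> closure (Domain T) = UNIV"

definition adjoint_op :: "L2_operator \<Rightarrow> L2_operator" where
  "adjoint_op T = {(u, v). \<forall>(f, g)\<in>T. cinner_L2 g u = cinner_L2 f v}"

definition symmetric_op :: "L2_operator \<Rightarrow> bool" where
  "symmetric_op T \<longleftrightarrow> densely_defined T \<and> T \<subseteq> adjoint_op T"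

definition self_adjoint_op :: "L2_operator \<Rightarrow> bool" where
  "self_adjoint_op T \<longleftrightarrow> densely_defined T \<and> T = adjoint_op T"

text \<open>
  A symmetric operator is closable, and the graph of its closure is the topological closure
  of its graph.
\<close>

definition essentially_self_adjoint :: "L2_operator \<Rightarrow> bool" where
  "essentially_self_adjoint T \<longleftrightarrow> symmetric_op T \<and> self_adjoint_op (closure T)"

section \<open>Schwartz functions and the differential operator\<close>

definition deriv_op :: "(real \<Rightarrow> complex) \<Rightarrow> real \<Rightarrow> complex" where
  "deriv_op f = (\<lambda>x. vector_derivative f (at x))"

definition schwartz_space :: "(real \<Rightarrow> complex) set" where
  "schwartz_space =
     {f. (\<forall>k x. (deriv_op ^^ k) f differentiable (at x)) \<and>
         (\<forall>j k. bounded (range (\<lambda>x. x ^ j *\<^sub>R (deriv_op ^^ k) f x)))}"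

definition diff_op :: "nat \<Rightarrow> (nat \<Rightarrow> real poly) \<Rightarrow> (real \<Rightarrow> complex) \<Rightarrow> real \<Rightarrow> complex" where
  "diff_op m b f =
     (\<lambda>x. \<Sum>l\<le>m. (-1) ^ l * (deriv_op ^^ l) (\<lambda>y. of_real (poly (b l) y) * (deriv_op ^^ l) f y) x)"

text \<open>
  The operator in the Hilbert space induced by a map of functions, with the Schwartz space as
  its domain; it is meaningful for maps that send Schwartz functions to Schwartz functions.
\<close>

definition schwartz_operator :: "((real \<Rightarrow> complex) \<Rightarrow> real \<Rightarrow> complex) \<Rightarrow> L2_operator" where
  "schwartz_operator A = {(abs_L2 f, abs_L2 (A f)) | f. f \<in> schwartz_space}"

text \<open>The degree with the convention that the zero polynomial has degree minus infinity.\<close>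

definition ext_degree :: "real poly \<Rightarrow> ereal" where
  "ext_degree p = (if p = 0 then -\<infinity> else ereal (real (degree p)))"

end

theory Submission
  imports Defs "HOL-Probability.Sinc_Integral"
begin

text \<open>
  Why the theorem holds. Suppose first that \<open>b 0\<close> is not the zero polynomial, so that it is
  bounded below by some \<open>\<epsilon> > 0\<close>. Integration by parts shows that \<open>L\<close> is symmetric on Schwartz
  functions and that \<open>\<langle>L f, f\<rangle> \<ge> \<epsilon> \<langle>f, f\<rangle>\<close>; hence the norm of \<open>L ^ n f\<close> is at least
  \<open>\<epsilon> ^ n\<close> times that of \<open>f\<close>. The closure of a symmetric operator that is bounded below in norm
  has closed range, and it is self-adjoint as soon as this range is the whole space. So everything
  reduces to uniqueness: a square integrable \<open>u\<close> that is orthogonal to \<open>L ^ n f\<close> for all Schwartz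
  functions \<open>f\<close> vanishes.

  Such a \<open>u\<close> is a weak solution of an ordinary differential equation with polynomial coefficients
  whose leading coefficient \<open>\<plusminus> b m ^ n\<close> is bounded away from zero. Collecting all terms at the
  derivative of highest order, the lemma of du Bois-Reymond turns the equation into one that
  expresses \<open>u\<close> through primitives of itself (\<open>weak_solution_slow\<close>). A primitive of a function of
  polynomial growth is again of polynomial growth and has one derivative more, so \<open>u\<close> is smooth and
  all of its derivatives have polynomial growth. On this class, which \<open>L\<close> preserves, it suffices to
  treat one factor of \<open>L\<close> at a time.

  If \<open>v\<close> is smooth with derivatives of polynomial growth and \<open>L v = 0\<close> weakly, test with
  \<open>W\<close> times the conjugate of \<open>v\<close>, where \<open>W x = 1 / cosh (\<delta> * x)\<close>. The main part of the
  result is the sum of the energies \<open>\<integral> b l * W * \<bar>Der l v\<bar>\<^sup>2\<close>. All other terms contain a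
  derivative of \<open>W\<close> and therefore a factor \<open>\<delta>\<close>; by interpolation between derivatives, and because
  \<open>b l\<close> is at most a multiple of \<open>b 0\<close> by the degree condition, they are bounded by \<open>\<delta>\<close> times a
  constant times the same sum (\<open>energy_term_estimate\<close>). For small \<open>\<delta>\<close> the sum must vanish, and
  with it \<open>v\<close> (\<open>slow_weak_solution_zero\<close>).

  If \<open>b 0 = 0\<close>, all coefficients are constants, so \<open>L ^ n\<close> is a combination of powers of the negative
  second derivative with nonnegative coefficients. Then \<open>L ^ n + 1\<close> is an operator of the first kind,
  and adding a constant does not affect essential self-adjointness.
\<close>

section \<open>Smooth functions whose derivatives share a bound\<close>

text \<open>
  Regularity of finite order is needed besides smoothness because the regularity of weak solutions is
  obtained one derivative at a time. The bound \<open>P\<close> is a parameter so that the calculus of products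
  serves both polynomial growth and rapid decay.
\<close>

primrec reg :: "((real \<Rightarrow> complex) \<Rightarrow> bool) \<Rightarrow> nat \<Rightarrow> (real \<Rightarrow> complex) \<Rightarrow> bool" where
  "reg P 0 f \<longleftrightarrow> continuous_on UNIV f \<and> P f"
| "reg P (Suc j) f \<longleftrightarrow> P f \<and> (\<forall>x. f differentiable (at x)) \<and> reg P j (deriv_op f)"

abbreviation Der :: "nat \<Rightarrow> (real \<Rightarrow> complex) \<Rightarrow> real \<Rightarrow> complex" where
  "Der k \<equiv> deriv_op ^^ k"

lemma deriv_op_eq:
  assumes "\<And>x. (f has_vector_derivative f' x) (at x)"
  shows "deriv_op f = f'"
  unfolding deriv_op_def using assms by (auto intro: vector_derivative_at)

lemma deriv_op_works:
  "f differentiable (at x) \<Longrightarrow> (f has_vector_derivative deriv_op f x) (at x)"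
  unfolding deriv_op_def by (simp add: vector_derivative_works)

lemma reg_bound: "reg P j f \<Longrightarrow> P f"
  by (cases j) auto

lemma reg_continuous: "reg P j f \<Longrightarrow> continuous_on UNIV f"
  by (cases j)
    (auto simp: continuous_on_eq_continuous_at differentiable_imp_continuous_within)

lemma reg_SucD: "reg P (Suc j) f \<Longrightarrow> reg P j f"
proof (induction j arbitrary: f)
  case 0
  then show ?case using reg_continuous[of P "Suc 0" f] by auto
qed auto

lemma reg_Suc_iff:
  assumes "\<And>x. (f has_vector_derivative f' x) (at x)"
  shows "reg P (Suc j) f \<longleftrightarrow> P f \<and> reg P j f'"
  using deriv_op_eq[of f f'] assms by (auto intro: differentiableI_vector)

lemma reg_mono: "(\<And>f. P f \<Longrightarrow> Q f) \<Longrightarrow> reg P j f \<Longrightarrow> reg Q j f"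
  by (induction j arbitrary: f) auto

text \<open>
  Functions given by explicit formulas lie in families that are closed under differentiation; for
  these it is enough to bound the members of the family.
\<close>

lemma reg_coinduct:
  assumes "X f"
    and step: "\<And>f. X f \<Longrightarrow> P f \<and> (\<exists>f'. (\<forall>x. (f has_vector_derivative f' x) (at x)) \<and> X f')"
  shows "reg P j f"
  using \<open>X f\<close>
proof (induction j arbitrary: f)
  case 0
  then obtain f' where "P f" "\<And>x. (f has_vector_derivative f' x) (at x)"
    using step by blast
  then show ?case
    by (auto simp: continuous_on_eq_continuous_at intro: has_vector_derivative_continuous)
next
  case (Suc j)
  then obtain f' where "P f" "\<And>x. (f has_vector_derivative f' x) (at x)" "X f'"
    using step by blast
  then show ?case using Suc.IH reg_Suc_iff[of f f'] by blast
qed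

lemma deriv_op_add:
  assumes "\<And>x. f differentiable (at x)" "\<And>x. g differentiable (at x)"
  shows "deriv_op (\<lambda>x. f x + g x) = (\<lambda>x. deriv_op f x + deriv_op g x)"
  using assms by (intro deriv_op_eq has_vector_derivative_add deriv_op_works)

lemma deriv_op_mult:
  assumes "\<And>x. f differentiable (at x)" "\<And>x. g differentiable (at x)"
  shows "deriv_op (\<lambda>x. f x * g x) = (\<lambda>x. f x * deriv_op g x + deriv_op f x * g x)"
  using assms by (intro deriv_op_eq has_vector_derivative_mult deriv_op_works)

lemma deriv_op_cmult:
  assumes "\<And>x. f differentiable (at x)"
  shows "deriv_op (\<lambda>x. c * f x) = (\<lambda>x. c * deriv_op f x)"
  using assms by (intro deriv_op_eq has_vector_derivative_mult_right deriv_op_works)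

lemma deriv_op_cnj:
  assumes "\<And>x. f differentiable (at x)"
  shows "deriv_op (\<lambda>x. cnj (f x)) = (\<lambda>x. cnj (deriv_op f x))"
  using assms by (intro deriv_op_eq has_vector_derivative_cnj deriv_op_works)

lemma reg_add:
  assumes P: "\<And>f g. P f \<Longrightarrow> P g \<Longrightarrow> P (\<lambda>x. f x + g x)"
  shows "reg P j f \<Longrightarrow> reg P j g \<Longrightarrow> reg P j (\<lambda>x. f x + g x)"
proof (induction j arbitrary: f g)
  case 0 then show ?case using P by (auto intro: continuous_intros)
next
  case (Suc j) then show ?case using P by (auto simp: deriv_op_add)
qed

lemma reg_mult:
  assumes R: "\<And>f g. R f \<Longrightarrow> R g \<Longrightarrow> R (\<lambda>x. f x + g x)"
    and PQR: "\<And>f g. P f \<Longrightarrow> Q g \<Longrightarrow> R (\<lambda>x. f x * g x)"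
  shows "reg P j f \<Longrightarrow> reg Q j g \<Longrightarrow> reg R j (\<lambda>x. f x * g x)"
proof (induction j arbitrary: f g)
  case 0 then show ?case using PQR by (auto intro: continuous_intros)
next
  case (Suc j)
  from Suc.prems have "reg P j f" "reg Q j g" by (blast intro: reg_SucD)+
  moreover have "\<forall>x. f differentiable (at x)" "\<forall>x. g differentiable (at x)"
    "reg P j (deriv_op f)" "reg Q j (deriv_op g)"
    using Suc.prems by auto
  ultimately show ?case
    using PQR[of f g] Suc.prems Suc.IH by (auto simp: deriv_op_mult intro!: reg_add R)
qed

lemma reg_cnj:
  assumes P: "\<And>f. P f \<Longrightarrow> P (\<lambda>x. cnj (f x))"
  shows "reg P j f \<Longrightarrow> reg P j (\<lambda>x. cnj (f x))"
proof (induction j arbitrary: f)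
  case 0 then show ?case using P by (auto intro: continuous_intros)
next
  case (Suc j)
  then have d: "\<And>x. f differentiable (at x)" by auto
  have "(\<lambda>x. cnj (f x)) differentiable (at x)" for x
    using has_vector_derivative_cnj[OF deriv_op_works[OF d]] by (rule differentiableI_vector)
  then show ?case using P Suc by (auto simp: deriv_op_cnj)
qed

definition cls :: "((real \<Rightarrow> complex) \<Rightarrow> bool) \<Rightarrow> (real \<Rightarrow> complex) \<Rightarrow> bool" where
  "cls P f \<longleftrightarrow> (\<forall>j. reg P j f)"

lemma cls_differentiable: "cls P f \<Longrightarrow> f differentiable (at x)"
  unfolding cls_def by (drule spec[of _ "Suc 0"]) auto

lemma cls_bound: "cls P f \<Longrightarrow> P f"
  unfolding cls_def using reg_bound by blast

lemma cls_continuous: "cls P f \<Longrightarrow> continuous_on UNIV f"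
  unfolding cls_def using reg_continuous by blast

lemma cls_deriv: "cls P f \<Longrightarrow> cls P (deriv_op f)"
  unfolding cls_def
proof
  fix j assume "\<forall>j. reg P j f"
  then have "reg P (Suc j) f" by blast
  then show "reg P j (deriv_op f)" by simp
qed

lemma cls_funpow_deriv: "cls P f \<Longrightarrow> cls P (Der k f)"
  by (induction k) (auto intro: cls_deriv)

lemma cls_has_deriv: "cls P f \<Longrightarrow> (f has_vector_derivative deriv_op f x) (at x)"
  by (intro deriv_op_works cls_differentiable)

lemma cls_add:
  "cls P f \<Longrightarrow> cls P g \<Longrightarrow> (\<And>f g. P f \<Longrightarrow> P g \<Longrightarrow> P (\<lambda>x. f x + g x)) \<Longrightarrow> cls P (\<lambda>x. f x + g x)"
  unfolding cls_def by (blast intro: reg_add)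

lemma cls_mult:
  "cls P f \<Longrightarrow> cls Q g \<Longrightarrow> (\<And>f g. R f \<Longrightarrow> R g \<Longrightarrow> R (\<lambda>x. f x + g x)) \<Longrightarrow>
   (\<And>f g. P f \<Longrightarrow> Q g \<Longrightarrow> R (\<lambda>x. f x * g x)) \<Longrightarrow> cls R (\<lambda>x. f x * g x)"
  unfolding cls_def by (blast intro: reg_mult[of R P Q])

lemma cls_coinduct:
  assumes "X f"
    and "\<And>f. X f \<Longrightarrow> P f \<and> (\<exists>f'. (\<forall>x. (f has_vector_derivative f' x) (at x)) \<and> X f')"
  shows "cls P f"
  unfolding cls_def using reg_coinduct[of X, OF assms] by blast

text \<open>
  This form of the class matches the definition of the Schwartz space.
\<close>

lemma cls_iff_funpow:
  "cls P f \<longleftrightarrow> (\<forall>k. P (Der k f) \<and> (\<forall>x. Der k f differentiable (at x)))"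
proof
  assume "cls P f"
  then show "\<forall>k. P (Der k f) \<and> (\<forall>x. Der k f differentiable (at x))"
    by (auto intro: cls_bound cls_differentiable cls_funpow_deriv)
next
  assume *: "\<forall>k. P (Der k f) \<and> (\<forall>x. Der k f differentiable (at x))"
  have "\<exists>k. f = Der k f" by (rule exI[of _ 0]) simp
  then show "cls P f"
  proof (rule cls_coinduct[of "\<lambda>g. \<exists>k. g = Der k f"])
    fix g assume "\<exists>k. g = Der k f"
    then obtain k where "g = Der k f" by blast
    then have "P g \<and> (\<forall>x. (g has_vector_derivative deriv_op g x) (at x)) \<and>
        (deriv_op g = Der (Suc k) f)"
      using * by (auto intro: deriv_op_works)
    then show "P g \<and> (\<exists>f'. (\<forall>x. (g has_vector_derivative f' x) (at x)) \<and>
        (\<exists>k. f' = Der k f))" by blast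
  qed
qed

subsection \<open>Slowly increasing and rapidly decreasing functions\<close>

abbreviation bra :: "real \<Rightarrow> real" where "bra x \<equiv> 1 + x\<^sup>2"

lemma bra_ge_1: "1 \<le> bra x ^ N"
  by (intro one_le_power) simp

lemma bra_pos: "0 < bra x ^ N"
  by (intro zero_less_power) (simp add: add_pos_nonneg)

lemma bra_neq_0 [simp]: "1 + (x::real)\<^sup>2 \<noteq> 0"
  using bra_pos[of x 1] by simp

lemma bra_mono: "M \<le> N \<Longrightarrow> bra x ^ M \<le> bra x ^ N"
  by (intro power_increasing) auto

definition poly_bounded :: "(real \<Rightarrow> complex) \<Rightarrow> bool" where
  "poly_bounded f \<longleftrightarrow> (\<exists>N C. \<forall>x. cmod (f x) \<le> C * bra x ^ N)"

definition rapidly_decr :: "(real \<Rightarrow> complex) \<Rightarrow> bool" where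
  "rapidly_decr f \<longleftrightarrow> (\<forall>N. \<exists>C. \<forall>x. bra x ^ N * cmod (f x) \<le> C)"

abbreviation "slow \<equiv> cls poly_bounded"
abbreviation "schwartz \<equiv> cls rapidly_decr"

lemma poly_boundedD:
  assumes "poly_bounded f"
  shows "\<exists>C N. C \<ge> 0 \<and> (\<forall>x. cmod (f x) \<le> C * bra x ^ N)"
proof -
  obtain N C where *: "\<And>x. cmod (f x) \<le> C * bra x ^ N"
    using assms unfolding poly_bounded_def by blast
  have "0 \<le> C" using order_trans[OF norm_ge_zero *[of 0]] by simp
  with * show ?thesis by blast
qed

lemma rapidly_decrE:
  assumes "rapidly_decr f"
  obtains C where "C \<ge> 0" "\<And>x. bra x ^ N * cmod (f x) \<le> C"
proof -
  obtain C where *: "\<And>x. bra x ^ N * cmod (f x) \<le> C"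
    using assms unfolding rapidly_decr_def by blast
  have "0 \<le> bra 0 ^ N * cmod (f 0)" by simp
  also have "\<dots> \<le> C" by (rule *)
  finally show ?thesis using * that by blast
qed

lemma poly_bounded_add:
  assumes "poly_bounded f" "poly_bounded g"
  shows "poly_bounded (\<lambda>x. f x + g x)"
proof -
  obtain C M where f: "C \<ge> 0" "\<And>x. cmod (f x) \<le> C * bra x ^ M" using poly_boundedD[OF assms(1)] by blast
  obtain D N where g: "D \<ge> 0" "\<And>x. cmod (g x) \<le> D * bra x ^ N" using poly_boundedD[OF assms(2)] by blast
  have "cmod (f x + g x) \<le> (C + D) * bra x ^ max M N" for x
  proof -
    have "cmod (f x + g x) \<le> C * bra x ^ M + D * bra x ^ N"
      using f(2)[of x] g(2)[of x] by (intro norm_triangle_mono)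
    also have "\<dots> \<le> C * bra x ^ max M N + D * bra x ^ max M N"
      using f(1) g(1) by (intro add_mono mult_left_mono bra_mono) auto
    finally show ?thesis by (simp add: algebra_simps)
  qed
  then show ?thesis unfolding poly_bounded_def by blast
qed

lemma poly_bounded_mult:
  assumes "poly_bounded f" "poly_bounded g"
  shows "poly_bounded (\<lambda>x. f x * g x)"
proof -
  obtain C M where f: "C \<ge> 0" "\<And>x. cmod (f x) \<le> C * bra x ^ M" using poly_boundedD[OF assms(1)] by blast
  obtain D N where g: "D \<ge> 0" "\<And>x. cmod (g x) \<le> D * bra x ^ N" using poly_boundedD[OF assms(2)] by blast
  have "cmod (f x * g x) \<le> (C * D) * bra x ^ (M + N)" for x
  proof -
    have "cmod (f x * g x) \<le> (C * bra x ^ M) * (D * bra x ^ N)"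
      unfolding norm_mult using f g by (intro mult_mono) auto
    then show ?thesis by (simp add: algebra_simps power_add)
  qed
  then show ?thesis unfolding poly_bounded_def by blast
qed

lemma rapidly_decr_add:
  assumes "rapidly_decr f" "rapidly_decr g"
  shows "rapidly_decr (\<lambda>x. f x + g x)"
  unfolding rapidly_decr_def
proof
  fix N
  obtain C where f: "C \<ge> 0" "\<And>x. bra x ^ N * cmod (f x) \<le> C" using rapidly_decrE[OF assms(1)] by blast
  obtain D where g: "D \<ge> 0" "\<And>x. bra x ^ N * cmod (g x) \<le> D" using rapidly_decrE[OF assms(2)] by blast
  have "bra x ^ N * cmod (f x + g x) \<le> C + D" for x
  proof -
    have "bra x ^ N * cmod (f x + g x) \<le> bra x ^ N * (cmod (f x) + cmod (g x))"
      by (intro mult_left_mono norm_triangle_ineq) auto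
    then show ?thesis using f(2)[of x] g(2)[of x] by (simp add: distrib_left)
  qed
  then show "\<exists>C. \<forall>x. bra x ^ N * cmod (f x + g x) \<le> C" by blast
qed

lemma rapidly_decr_mult:
  assumes "rapidly_decr f" "poly_bounded g"
  shows "rapidly_decr (\<lambda>x. f x * g x)"
  unfolding rapidly_decr_def
proof
  fix N
  obtain D M where g: "D \<ge> 0" "\<And>x. cmod (g x) \<le> D * bra x ^ M" using poly_boundedD[OF assms(2)] by blast
  obtain C where f: "C \<ge> 0" "\<And>x. bra x ^ (N + M) * cmod (f x) \<le> C"
    using rapidly_decrE[OF assms(1)] by blast
  have "bra x ^ N * cmod (f x * g x) \<le> D * C" for x
  proof -
    have "bra x ^ N * cmod (f x * g x) \<le> bra x ^ N * (cmod (f x) * (D * bra x ^ M))"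
      unfolding norm_mult using g by (intro mult_left_mono) auto
    also have "\<dots> = D * (bra x ^ (N + M) * cmod (f x))"
      by (simp add: power_add algebra_simps)
    also have "\<dots> \<le> D * C" using f g(1) by (intro mult_left_mono) auto
    finally show ?thesis .
  qed
  then show "\<exists>C. \<forall>x. bra x ^ N * cmod (f x * g x) \<le> C" by blast
qed

lemma rapidly_decr_imp_poly_bounded: "rapidly_decr f \<Longrightarrow> poly_bounded f"
  unfolding rapidly_decr_def poly_bounded_def
  by (drule spec[of _ 0], elim exE, rule exI[of _ 0]) auto

lemma schwartz_slow: "schwartz f \<Longrightarrow> slow f"
  unfolding cls_def by (blast intro: reg_mono rapidly_decr_imp_poly_bounded)

lemma slow_add: "slow f \<Longrightarrow> slow g \<Longrightarrow> slow (\<lambda>x. f x + g x)"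
  by (rule cls_add) (auto intro: poly_bounded_add)

lemma slow_mult: "slow f \<Longrightarrow> slow g \<Longrightarrow> slow (\<lambda>x. f x * g x)"
  by (rule cls_mult[of poly_bounded _ poly_bounded]) (auto intro: poly_bounded_add poly_bounded_mult)

lemma schwartz_add: "schwartz f \<Longrightarrow> schwartz g \<Longrightarrow> schwartz (\<lambda>x. f x + g x)"
  by (rule cls_add) (auto intro: rapidly_decr_add)

lemma schwartz_mult_slow: "schwartz f \<Longrightarrow> slow g \<Longrightarrow> schwartz (\<lambda>x. f x * g x)"
  by (rule cls_mult[of rapidly_decr _ poly_bounded]) (auto intro: rapidly_decr_add rapidly_decr_mult)

lemma slow_mult_schwartz: "slow f \<Longrightarrow> schwartz g \<Longrightarrow> schwartz (\<lambda>x. f x * g x)"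
  using schwartz_mult_slow[of g f] by (simp add: mult.commute)

lemma slow_cnj: "slow f \<Longrightarrow> slow (\<lambda>x. cnj (f x))"
  unfolding cls_def by (auto intro!: reg_cnj simp: poly_bounded_def)

lemma poly_bounded_const: "poly_bounded (\<lambda>x. c)"
proof -
  have "cmod c \<le> cmod c * bra x ^ 0" for x by simp
  then show ?thesis unfolding poly_bounded_def by blast
qed

lemma poly_bounded_poly: "poly_bounded (\<lambda>x. of_real (poly p x))"
proof (induction p)
  case 0
  show ?case using poly_bounded_const[of 0] by simp
next
  case (pCons a p)
  have "poly_bounded (\<lambda>x. of_real a)"
    by (rule poly_bounded_const)
  moreover have "poly_bounded (\<lambda>x. of_real x)"
  proof -
    have "cmod (of_real x) \<le> 1 * bra x ^ 1" for x
      using sum_squares_bound[of 1 "\<bar>x\<bar>"] by simp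
    then show ?thesis unfolding poly_bounded_def by blast
  qed
  ultimately show ?case
    using pCons by (simp add: poly_bounded_add poly_bounded_mult)
qed

lemma has_vector_derivative_of_real_poly:
  "((\<lambda>x. of_real (poly p x) :: complex) has_vector_derivative of_real (poly (pderiv p) x)) (at x)"
  using poly_DERIV[of p x]
  by (simp add: has_real_derivative_iff_has_vector_derivative has_vector_derivative_of_real)

lemma slow_poly: "slow (\<lambda>x. of_real (poly p x))"
proof (rule cls_coinduct[of "\<lambda>f. \<exists>p. f = (\<lambda>x. of_real (poly p x))"])
  fix f :: "real \<Rightarrow> complex" assume "\<exists>p. f = (\<lambda>x. of_real (poly p x))"
  then obtain p where f: "f = (\<lambda>x. of_real (poly p x))" by blast
  show "poly_bounded f \<and> (\<exists>f'. (\<forall>x. (f has_vector_derivative f' x) (at x)) \<and>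
      (\<exists>p. f' = (\<lambda>x. of_real (poly p x))))"
    unfolding f using has_vector_derivative_of_real_poly[of p] poly_bounded_poly[of p]
    by (auto intro!: exI[of _ "\<lambda>x. complex_of_real (poly (pderiv p) x)"])
qed blast

lemma slow_const: "slow (\<lambda>x. c)"
proof (rule cls_coinduct[of "\<lambda>f. \<exists>c. f = (\<lambda>x. c)"])
  fix f :: "real \<Rightarrow> complex" assume "\<exists>c. f = (\<lambda>x. c)"
  then obtain c where f: "f = (\<lambda>x. c)" by blast
  then have "poly_bounded f" by (simp add: poly_bounded_const)
  moreover have "(f has_vector_derivative 0) (at x)" for x using f by auto
  ultimately show "poly_bounded f \<and> (\<exists>f'. (\<forall>x. (f has_vector_derivative f' x) (at x)) \<and>
      (\<exists>c. f' = (\<lambda>x. c)))" by (intro conjI exI[of _ "\<lambda>x. 0"]) auto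
qed blast

text \<open>
  The family of all quotients of a polynomial by a power of \<open>poly a\<close> is closed under differentiation,
  and the lower bound keeps its members of polynomial growth.
\<close>

lemma slow_inverse_poly:
  assumes "\<epsilon> > 0" "\<And>x. \<epsilon> \<le> poly a x"
  shows "slow (\<lambda>x. of_real (1 / poly a x))"
proof (rule cls_coinduct[of "\<lambda>f. \<exists>q k. f = (\<lambda>x. of_real (poly q x / poly a x ^ k))"])
  show "\<exists>q k. (\<lambda>x. complex_of_real (1 / poly a x)) = (\<lambda>x. of_real (poly q x / poly a x ^ k))"
    by (rule exI[of _ 1], rule exI[of _ 1]) simp
next
  fix f :: "real \<Rightarrow> complex" assume "\<exists>q k. f = (\<lambda>x. of_real (poly q x / poly a x ^ k))"
  then obtain q k where f: "f = (\<lambda>x. of_real (poly q x / poly a x ^ k))" by blast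
  have pos: "poly a x > 0" for x using assms(1) assms(2)[of x] by linarith
  have "poly_bounded f"
  proof -
    obtain C N where q: "C \<ge> 0" "\<And>x. cmod (of_real (poly q x)) \<le> C * bra x ^ N"
      using poly_boundedD[OF poly_bounded_poly[of q]] by blast
    have "cmod (f x) \<le> C / \<epsilon> ^ k * bra x ^ N" for x
    proof -
      have "cmod (f x) = \<bar>poly q x\<bar> / poly a x ^ k"
        unfolding f norm_of_real using pos[of x] by simp
      also have "\<dots> \<le> (C * bra x ^ N) / \<epsilon> ^ k"
        using q(2)[of x] assms pos[of x] by (intro frac_le power_mono) auto
      finally show ?thesis by simp
    qed
    then show ?thesis unfolding poly_bounded_def by blast
  qed
  moreover define q' where "q' = pderiv q * a - smult (of_nat k) (q * pderiv a)"
  have "(f has_vector_derivative of_real (poly q' x / poly a x ^ Suc k)) (at x)" for x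
  proof -
    have "((\<lambda>x. poly q x / poly a x ^ k) has_real_derivative
      (poly (pderiv q) x * poly a x ^ k - poly q x * (of_nat k * poly (pderiv a) x * poly a x ^ (k - Suc 0))) /
      (poly a x ^ k * poly a x ^ k)) (at x)"
      using pos[of x] by (auto intro!: derivative_eq_intros poly_DERIV)
    moreover have "(poly (pderiv q) x * poly a x ^ k - poly q x * (of_nat k * poly (pderiv a) x * poly a x ^ (k - Suc 0))) /
      (poly a x ^ k * poly a x ^ k) = poly q' x / poly a x ^ Suc k"
      using pos[of x] unfolding q'_def by (cases k) (auto simp: field_simps)
    ultimately show ?thesis
      unfolding f has_real_derivative_iff_has_vector_derivative
      by (intro has_vector_derivative_of_real)
        (simp add: has_real_derivative_iff_has_vector_derivative)
  qed
  ultimately show "poly_bounded f \<and> (\<exists>f'. (\<forall>x. (f has_vector_derivative f' x) (at x)) \<and>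
      (\<exists>q k. f' = (\<lambda>x. of_real (poly q x / poly a x ^ k))))"
    by (intro conjI exI[of _ "\<lambda>x. complex_of_real (poly q' x / poly a x ^ Suc k)"]
        exI[of _ q'] exI[of _ "Suc k"]) auto
qed

text \<open>
  Powers of \<open>1 + x\<^sup>2\<close> and monomials dominate each other up to constants.
\<close>

lemma rapidly_decr_iff_bounded:
  "rapidly_decr f \<longleftrightarrow> (\<forall>j. bounded (range (\<lambda>x. x ^ j *\<^sub>R f x)))"
proof
  assume f: "rapidly_decr f"
  show "\<forall>j. bounded (range (\<lambda>x. x ^ j *\<^sub>R f x))"
  proof
    fix j
    obtain C where C: "\<And>x. bra x ^ j * cmod (f x) \<le> C" using rapidly_decrE[OF f] by blast
    have "norm (x ^ j *\<^sub>R f x) \<le> C" for x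
    proof -
      have "\<bar>x\<bar> \<le> bra x" using sum_squares_bound[of 1 "\<bar>x\<bar>"] by simp
      then have "\<bar>x\<bar> ^ j * cmod (f x) \<le> bra x ^ j * cmod (f x)"
        by (intro mult_right_mono power_mono) auto
      with C[of x] show ?thesis by (simp add: power_abs)
    qed
    then show "bounded (range (\<lambda>x. x ^ j *\<^sub>R f x))" unfolding bounded_iff by blast
  qed
next
  assume b: "\<forall>j. bounded (range (\<lambda>x. x ^ j *\<^sub>R f x))"
  show "rapidly_decr f" unfolding rapidly_decr_def
  proof
    fix N
    obtain A where A: "\<And>x. norm (x ^ 0 *\<^sub>R f x) \<le> A"
      using b[rule_format, of 0] unfolding bounded_iff by auto
    obtain B where B: "\<And>x. norm (x ^ (2 * N) *\<^sub>R f x) \<le> B"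
      using b[rule_format, of "2 * N"] unfolding bounded_iff by blast
    have "bra x ^ N * cmod (f x) \<le> 2 ^ N * (A + B)" for x
    proof -
      have "bra x ^ N \<le> (2 * max 1 (x\<^sup>2)) ^ N" by (intro power_mono) auto
      also have "\<dots> = 2 ^ N * max 1 (x\<^sup>2) ^ N" by (simp add: power_mult_distrib)
      also have "max 1 (x\<^sup>2) ^ N \<le> 1 + x ^ (2 * N)"
        by (auto simp: max_def power_mult)
      finally have "bra x ^ N * cmod (f x) \<le> 2 ^ N * (1 + x ^ (2 * N)) * cmod (f x)"
        by (intro mult_right_mono) auto
      also have "\<dots> \<le> 2 ^ N * (A + B)"
      proof -
        have "2 ^ N * (1 + x ^ (2 * N)) * cmod (f x) =
            2 ^ N * (norm (x ^ 0 *\<^sub>R f x) + norm (x ^ (2 * N) *\<^sub>R f x))"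
          by (simp add: algebra_simps power_mult)
        also have "\<dots> \<le> 2 ^ N * (A + B)"
          using A[of x] B[of x] by (intro mult_left_mono add_mono) auto
        finally show ?thesis .
      qed
      finally show ?thesis .
    qed
    then show "\<exists>C. \<forall>x. bra x ^ N * cmod (f x) \<le> C" by blast
  qed
qed

lemma schwartz_space_eq: "f \<in> schwartz_space \<longleftrightarrow> schwartz f"
  unfolding schwartz_space_def cls_iff_funpow rapidly_decr_iff_bounded by blast

section \<open>Completeness of the Hilbert space and orthogonal complements\<close>

lemma square_integrable_rep_L2: "square_integrable (rep_L2 u)"
  using Quotient_rep_reflp[OF Quotient_L2, of u] by (simp add: L2_rel_def)

lemma abs_rep_L2 [simp]: "abs_L2 (rep_L2 u) = u"
  by (rule Quotient_abs_rep[OF Quotient_L2])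

lemma L2_rel_refl: "square_integrable f \<Longrightarrow> L2_rel f f"
  by (simp add: L2_rel_def)

lemma abs_L2_eqI:
  "square_integrable f \<Longrightarrow> square_integrable g \<Longrightarrow> (AE x in lborel. f x = g x) \<Longrightarrow> abs_L2 f = abs_L2 g"
  using Quotient_rel_abs[OF Quotient_L2] by (auto simp: L2_rel_def)

lemma abs_L2_minus:
  "square_integrable f \<Longrightarrow> square_integrable g \<Longrightarrow> abs_L2 f - abs_L2 g = abs_L2 (\<lambda>x. f x - g x)"
  by (simp add: minus_L2.abs_eq L2_rel_refl)

lemma abs_L2_plus:
  "square_integrable f \<Longrightarrow> square_integrable g \<Longrightarrow> abs_L2 f + abs_L2 g = abs_L2 (\<lambda>x. f x + g x)"
  by (simp add: plus_L2.abs_eq L2_rel_refl)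

lemma abs_L2_scaleR: "square_integrable f \<Longrightarrow> c *\<^sub>R abs_L2 f = abs_L2 (\<lambda>x. c *\<^sub>R f x)"
  by (simp add: scaleR_L2.abs_eq L2_rel_refl)

lemma cinner_abs_L2:
  "square_integrable f \<Longrightarrow> square_integrable g \<Longrightarrow>
    cinner_L2 (abs_L2 f) (abs_L2 g) = (LINT x|lborel. f x * cnj (g x))"
  by (simp add: cinner_L2.abs_eq L2_rel_refl)

lemma norm_abs_L2:
  assumes "square_integrable f"
  shows "(norm (abs_L2 f))\<^sup>2 = (LINT x|lborel. (cmod (f x))\<^sup>2)"
  using assms
  by (simp add: power2_norm_eq_inner inner_L2_def cinner_abs_L2 inner_L2_self_abs)

lemma nn_integral_norm_abs_L2:
  assumes "square_integrable f"
  shows "(\<integral>\<^sup>+x. ennreal ((cmod (f x))\<^sup>2) \<partial>lborel) = ennreal ((norm (abs_L2 f))\<^sup>2)"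
  using assms unfolding norm_abs_L2[OF assms]
  by (intro nn_integral_eq_integral) (auto simp: square_integrable_def)

lemma square_integrableI_nn_integral:
  assumes "f \<in> borel_measurable lborel" "(\<integral>\<^sup>+x. ennreal ((cmod (f x))\<^sup>2) \<partial>lborel) < \<infinity>"
  shows "square_integrable f"
  using assms unfolding square_integrable_def
  by (auto intro!: integrableI_nonneg)

text \<open>
  Towards completeness: a subsequence with geometrically decreasing increments converges almost
  everywhere.
\<close>

lemma Cauchy_fast_subseq:
  fixes X :: "nat \<Rightarrow> 'a::metric_space"
  assumes "Cauchy X"
  shows "\<exists>r. \<forall>k. k \<le> r k \<and> dist (X (r (Suc k))) (X (r k)) < (1/2) ^ k"
proof -
  have "\<forall>k. \<exists>N. \<forall>m\<ge>N. \<forall>n\<ge>N. dist (X m) (X n) < (1/2::real) ^ k"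
    using metric_CauchyD[OF assms] by auto
  then obtain N where N: "\<And>k m n. N k \<le> m \<Longrightarrow> N k \<le> n \<Longrightarrow> dist (X m) (X n) < (1/2) ^ k"
    by metis
  \<comment> \<open>the sum makes \<open>r\<close> monotone, the summand \<open>k\<close> makes it unbounded\<close>
  define r where "r k = (\<Sum>i\<le>k. N i) + k" for k
  have "N k \<le> (\<Sum>i\<le>k. N i)" for k by (rule member_le_sum) auto
  then have Nr: "N k \<le> r k" for k unfolding r_def by (simp add: trans_le_add1)
  have "r k \<le> r (Suc k)" for k unfolding r_def by simp
  then have "dist (X (r (Suc k))) (X (r k)) < (1/2) ^ k" for k
    using Nr[of k] order_trans N by blast
  moreover have "k \<le> r k" for k unfolding r_def by simp
  ultimately show ?thesis by blast
qed

text \<open>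
  By the inequality between arithmetic and geometric means each increment \<open>d k x\<close> is at most
  \<open>(1/2) ^ k + 2 ^ k * \<bar>d k x\<bar>\<^sup>2\<close>. The integrals of the second terms are summable, so the increments
  are summable at almost every point.
\<close>

lemma L2_fast_Cauchy_converges_AE:
  assumes f: "\<And>k. square_integrable (f k)"
    and fast: "\<And>k. norm (abs_L2 (f (Suc k)) - abs_L2 (f k)) < (1/2) ^ k"
  shows "AE x in lborel. convergent (\<lambda>k. f k x)"
proof -
  define d where "d k x = f (Suc k) x - f k x" for k x
  have d: "square_integrable (d k)" for k
    unfolding d_def by (intro square_integrable_diff f)
  have [measurable]: "d k \<in> borel_measurable lborel" for k
    using d[of k] by (simp add: square_integrable_def)
  have bound: "(\<integral>\<^sup>+x. ennreal (2 ^ k * (cmod (d k x))\<^sup>2) \<partial>lborel) \<le> ennreal ((1/2) ^ k)" for k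
  proof -
    have "(norm (abs_L2 (d k)))\<^sup>2 \<le> ((1/2) ^ k)\<^sup>2"
      using fast[of k] unfolding d_def abs_L2_minus[OF f f] by (intro power_mono) auto
    then have "2 ^ k * (norm (abs_L2 (d k)))\<^sup>2 \<le> 2 ^ k * ((1/2) ^ k)\<^sup>2"
      by (intro mult_left_mono) auto
    also have "\<dots> = (1/2) ^ k" by (simp add: power2_eq_square power_divide)
    finally have "2 ^ k * (norm (abs_L2 (d k)))\<^sup>2 \<le> (1/2) ^ k" .
    have "(\<integral>\<^sup>+x. ennreal (2 ^ k * (cmod (d k x))\<^sup>2) \<partial>lborel) =
        (\<integral>\<^sup>+x. ennreal (2 ^ k) * ennreal ((cmod (d k x))\<^sup>2) \<partial>lborel)"
      by (intro nn_integral_cong ennreal_mult) auto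
    also have "\<dots> = ennreal (2 ^ k) * ennreal ((norm (abs_L2 (d k)))\<^sup>2)"
      by (simp add: nn_integral_cmult nn_integral_norm_abs_L2[OF d])
    also have "\<dots> = ennreal (2 ^ k * (norm (abs_L2 (d k)))\<^sup>2)"
      by (rule ennreal_mult[symmetric]) auto
    also have "\<dots> \<le> ennreal ((1/2) ^ k)" by (intro ennreal_leI) fact
    finally show ?thesis .
  qed
  have "(\<integral>\<^sup>+x. (\<Sum>k. ennreal (2 ^ k * (cmod (d k x))\<^sup>2)) \<partial>lborel) =
      (\<Sum>k. \<integral>\<^sup>+x. ennreal (2 ^ k * (cmod (d k x))\<^sup>2) \<partial>lborel)"
    by (intro nn_integral_suminf) measurable
  also have "\<dots> \<le> (\<Sum>k. ennreal ((1/2) ^ k))"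
    by (intro suminf_le bound) auto
  also have "\<dots> < \<infinity>"
    by (simp add: suminf_ennreal2[OF _ summable_geometric])
  finally have "AE x in lborel. (\<Sum>k. ennreal (2 ^ k * (cmod (d k x))\<^sup>2)) \<noteq> \<infinity>"
    by (intro nn_integral_noteq_infinite) auto
  then show ?thesis
  proof eventually_elim
    case (elim x)
    then have "summable (\<lambda>k. 2 ^ k * (cmod (d k x))\<^sup>2)"
      by (intro summable_suminf_not_top) auto
    then have "summable (\<lambda>k. (1/2) ^ k + 2 ^ k * (cmod (d k x))\<^sup>2)"
      by (intro summable_add summable_geometric) auto
    moreover have "norm (d k x) \<le> (1/2) ^ k + 2 ^ k * (cmod (d k x))\<^sup>2" for k
    proof -
      have "0 \<le> (1 - 2 ^ k * cmod (d k x))\<^sup>2 + 1 + (2 ^ k * cmod (d k x))\<^sup>2" by simp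
      then have "2 ^ k * cmod (d k x) \<le> 1 + (2 ^ k * cmod (d k x))\<^sup>2"
        by (simp add: power2_eq_square algebra_simps)
      then have "(1/2) ^ k * (2 ^ k * cmod (d k x)) \<le> (1/2) ^ k * (1 + (2 ^ k * cmod (d k x))\<^sup>2)"
        by (intro mult_left_mono) auto
      then show ?thesis by (simp add: power_divide power2_eq_square field_simps)
    qed
    ultimately have "summable (\<lambda>k. d k x)"
      by (rule summable_comparison_test'[of _ 0])
    then have "convergent (\<lambda>n. (\<Sum>k<n. d k x) + f 0 x)"
      unfolding summable_iff_convergent by (intro convergent_add convergent_const)
    moreover have "(\<Sum>k<n. d k x) + f 0 x = f n x" for n
      unfolding d_def by (simp add: sum_lessThan_telescope[of "\<lambda>k. f k x"])
    ultimately show ?case by (simp only:)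
  qed
qed

text \<open>
  The pointwise limit of the fast subsequence is the limit of the whole sequence by the lemma of
  Fatou.
\<close>

instance L2 :: complete_space
proof
  fix X :: "nat \<Rightarrow> L2" assume "Cauchy X"
  then obtain r where r: "\<And>k. k \<le> r k" "\<And>k. dist (X (r (Suc k))) (X (r k)) < (1/2) ^ k"
    using Cauchy_fast_subseq by blast
  define f where "f n = rep_L2 (X n)" for n
  have f: "square_integrable (f n)" "abs_L2 (f n) = X n" for n
    unfolding f_def by (simp_all add: square_integrable_rep_L2)
  have [measurable]: "f n \<in> borel_measurable lborel" for n
    using f(1)[of n] by (simp add: square_integrable_def)
  define g where "g x = lim (\<lambda>k. f (r k) x)" for x
  have [measurable]: "g \<in> borel_measurable lborel"
    unfolding g_def by measurable
  have "AE x in lborel. convergent (\<lambda>k. f (r k) x)"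
    using f r by (intro L2_fast_Cauchy_converges_AE[of "\<lambda>k. f (r k)"]) (auto simp: dist_norm)
  then have lim: "AE x in lborel. (\<lambda>k. f (r k) x) \<longlonglongrightarrow> g x"
    unfolding g_def by eventually_elim (simp add: convergent_LIMSEQ_iff)
  have close: "(\<integral>\<^sup>+x. ennreal ((cmod (g x - f n x))\<^sup>2) \<partial>lborel) \<le> ennreal (e\<^sup>2)"
    if N: "\<And>m n. m \<ge> N \<Longrightarrow> n \<ge> N \<Longrightarrow> dist (X m) (X n) < e" and "n \<ge> N" for e N n
  proof -
    have "(\<integral>\<^sup>+x. ennreal ((cmod (g x - f n x))\<^sup>2) \<partial>lborel) =
        (\<integral>\<^sup>+x. liminf (\<lambda>k. ennreal ((cmod (f (r k) x - f n x))\<^sup>2)) \<partial>lborel)"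
      using lim
    proof (intro nn_integral_cong_AE, eventually_elim)
      case (elim x)
      then have "(\<lambda>k. ennreal ((cmod (f (r k) x - f n x))\<^sup>2)) \<longlonglongrightarrow> ennreal ((cmod (g x - f n x))\<^sup>2)"
        by (intro tendsto_intros)
      then show ?case by (intro lim_imp_Liminf[symmetric]) auto
    qed
    also have "\<dots> \<le> liminf (\<lambda>k. \<integral>\<^sup>+x. ennreal ((cmod (f (r k) x - f n x))\<^sup>2) \<partial>lborel)"
      by (intro nn_integral_liminf) measurable
    also have "\<dots> \<le> liminf (\<lambda>k. ennreal (e\<^sup>2))"
    proof (rule Liminf_mono)
      have "(\<integral>\<^sup>+x. ennreal ((cmod (f (r k) x - f n x))\<^sup>2) \<partial>lborel) \<le> ennreal (e\<^sup>2)"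
        if "k \<ge> N" for k
      proof -
        have "dist (X (r k)) (X n) < e" using N \<open>n \<ge> N\<close> order_trans[OF \<open>k \<ge> N\<close> r(1)] by blast
        then have "(norm (X (r k) - X n))\<^sup>2 \<le> e\<^sup>2" by (intro power_mono) (auto simp: dist_norm)
        then show ?thesis
          using f by (subst nn_integral_norm_abs_L2)
            (auto intro!: square_integrable_diff ennreal_leI simp flip: abs_L2_minus)
      qed
      then show "\<forall>\<^sub>F k in sequentially.
          (\<integral>\<^sup>+x. ennreal ((cmod (f (r k) x - f n x))\<^sup>2) \<partial>lborel) \<le> ennreal (e\<^sup>2)"
        unfolding eventually_sequentially by blast
    qed
    also have "\<dots> = ennreal (e\<^sup>2)" by (simp add: Liminf_const)
    finally show ?thesis .
  qed
  obtain N0 where N0: "\<And>m n. m \<ge> N0 \<Longrightarrow> n \<ge> N0 \<Longrightarrow> dist (X m) (X n) < 1"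
    using metric_CauchyD[OF \<open>Cauchy X\<close>, of 1] by auto
  have "square_integrable (\<lambda>x. g x - f N0 x)"
    using le_less_trans[OF close[of N0 1 N0, OF N0 order_refl]]
    by (intro square_integrableI_nn_integral) auto
  from square_integrable_add[OF this f(1)[of N0]] have g: "square_integrable g" by simp
  have "X \<longlonglongrightarrow> abs_L2 g"
  proof (rule metric_LIMSEQ_I)
    fix e :: real assume "e > 0"
    then obtain N where N: "\<And>m n. m \<ge> N \<Longrightarrow> n \<ge> N \<Longrightarrow> dist (X m) (X n) < e / 2"
      using metric_CauchyD[OF \<open>Cauchy X\<close>, of "e / 2"] by auto
    have "dist (X n) (abs_L2 g) < e" if "n \<ge> N" for n
    proof -
      have "ennreal ((norm (abs_L2 g - X n))\<^sup>2) =
          (\<integral>\<^sup>+x. ennreal ((cmod (g x - f n x))\<^sup>2) \<partial>lborel)"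
        using f g by (subst nn_integral_norm_abs_L2)
            (auto intro!: square_integrable_diff simp flip: abs_L2_minus)
      also have "\<dots> \<le> ennreal ((e / 2)\<^sup>2)" by (rule close[OF N that])
      finally have "norm (abs_L2 g - X n) \<le> e / 2"
        using \<open>e > 0\<close> by (simp add: abs_le_square_iff[symmetric])
      then show ?thesis using \<open>e > 0\<close> by (simp add: dist_norm norm_minus_commute)
    qed
    then show "\<exists>N. \<forall>n\<ge>N. dist (X n) (abs_L2 g) < e" by blast
  qed
  then show "convergent X" by (rule convergentI)
qed

lemma parallelogram_law:
  fixes x y z :: "'a::real_inner"
  shows "(norm (y - z))\<^sup>2 = 2 * (norm (x - y))\<^sup>2 + 2 * (norm (x - z))\<^sup>2
    - 4 * (norm (x - (1/2) *\<^sub>R (y + z)))\<^sup>2"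
  by (simp add: power2_norm_eq_inner inner_diff_left inner_diff_right inner_add_left
      inner_add_right inner_commute algebra_simps)

text \<open>
  The projection theorem: a sequence in the subspace whose distances to \<open>x\<close> approach the infimum is
  Cauchy by the parallelogram law, and the difference of \<open>x\<close> and its limit is orthogonal to the
  subspace.
\<close>

lemma closed_subspace_eq_UNIV:
  fixes S :: "'a::{real_inner,complete_space} set"
  assumes S: "subspace S" "closed S"
    and orth: "\<And>u. (\<And>s. s \<in> S \<Longrightarrow> inner s u = 0) \<Longrightarrow> u = 0"
  shows "S = UNIV"
proof -
  have "x \<in> S" for x
  proof -
    define d where "d = infdist x S"
    have ne: "S \<noteq> {}" using subspace_0[OF S(1)] by blast
    have d0: "0 \<le> d" unfolding d_def by (rule infdist_nonneg)
    have dle: "d \<le> norm (x - s)" if "s \<in> S" for s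
      unfolding d_def using infdist_le[OF that, of x] by (simp add: dist_norm)
    have "\<exists>s\<in>S. norm (x - s) < d + inverse (real (Suc n))" for n
    proof (rule ccontr)
      assume "\<not> ?thesis"
      then have "d + inverse (real (Suc n)) \<le> infdist x S"
        unfolding infdist_notempty[OF ne] dist_norm
        by (intro cINF_greatest[OF ne]) (auto simp: not_less)
      then show False unfolding d_def by (simp add: field_simps)
    qed
    then obtain s where s: "\<And>n. s n \<in> S" "\<And>n. norm (x - s n) < d + inverse (real (Suc n))"
      by metis
    have bnd: "(norm (s m - s n))\<^sup>2 \<le> (8 * d + 4) * inverse (real (Suc N))" if "m \<ge> N" "n \<ge> N" for m n N
    proof -
      define i where "i = inverse (real (Suc N))"
      have i: "0 < i" "i \<le> 1" unfolding i_def by (auto simp: field_simps)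
      have *: "(norm (x - s k))\<^sup>2 \<le> (d + i)\<^sup>2" if "k \<ge> N" for k
      proof -
        have "inverse (real (Suc k)) \<le> i" unfolding i_def using that by (simp add: field_simps)
        with s(2)[of k] show ?thesis by (intro power_mono) auto
      qed
      have "(1/2) *\<^sub>R (s m + s n) \<in> S" using S(1) s(1) by (simp add: subspace_add subspace_scale)
      then have "d\<^sup>2 \<le> (norm (x - (1/2) *\<^sub>R (s m + s n)))\<^sup>2"
        using d0 by (intro power_mono dle)
      then have "(norm (s m - s n))\<^sup>2 \<le> 4 * (d + i)\<^sup>2 - 4 * d\<^sup>2"
        using *[OF that(1)] *[OF that(2)] unfolding parallelogram_law[of "s m" "s n" x] by linarith
      also have "\<dots> = 8 * d * i + 4 * (i * i)" by (simp add: power2_eq_square algebra_simps)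
      also have "\<dots> \<le> 8 * d * i + 4 * (i * 1)" using i d0 by (intro add_mono mult_left_mono) auto
      finally show ?thesis unfolding i_def by (simp add: algebra_simps)
    qed
    have "Cauchy s"
    proof (rule metric_CauchyI)
      fix e :: real assume "e > 0"
      define K where "K = 8 * d + 4"
      have "K > 0" unfolding K_def using d0 by simp
      obtain N where N: "inverse (real (Suc N)) < e\<^sup>2 / K"
        using reals_Archimedean[of "e\<^sup>2 / K"] \<open>e > 0\<close> \<open>K > 0\<close> by auto
      then have "K * inverse (real (Suc N)) < e\<^sup>2"
        using \<open>K > 0\<close> by (simp add: field_simps)
      then have "dist (s m) (s n) < e" if "m \<ge> N" "n \<ge> N" for m n
        using bnd[OF that] \<open>e > 0\<close> unfolding K_def dist_norm
        by (intro power2_less_imp_less[of _ e]) auto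
      then show "\<exists>N. \<forall>m\<ge>N. \<forall>n\<ge>N. dist (s m) (s n) < e" by blast
    qed
    then obtain p where p: "s \<longlonglongrightarrow> p" using Cauchy_convergent convergent_def by blast
    have "p \<in> S" using closed_sequentially[OF S(2) s(1) p] .
    have "norm (x - p) \<le> d + 0"
    proof (rule LIMSEQ_le)
      show "(\<lambda>n. norm (x - s n)) \<longlonglongrightarrow> norm (x - p)" by (intro tendsto_intros p)
      show "(\<lambda>n. d + inverse (real (Suc n))) \<longlonglongrightarrow> d + 0"
        by (intro tendsto_intros LIMSEQ_inverse_real_of_nat)
    qed (use s(2) less_imp_le in blast)
    have "inner t (x - p) = 0" if "t \<in> S" for t
    proof (cases "t = 0")
      case False
      \<comment> \<open>the multiple of \<open>t\<close> that minimises the distance of \<open>p + c t\<close> to \<open>x\<close>\<close>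
      define c where "c = inner t (x - p) / inner t t"
      have "p + c *\<^sub>R t \<in> S" using S(1) \<open>p \<in> S\<close> that by (simp add: subspace_add subspace_scale)
      then have "norm (x - p) \<le> norm (x - (p + c *\<^sub>R t))"
        using dle[of "p + c *\<^sub>R t"] \<open>norm (x - p) \<le> d + 0\<close> by linarith
      then have "(norm (x - p))\<^sup>2 \<le> (norm ((x - p) - c *\<^sub>R t))\<^sup>2"
        by (intro power_mono) (auto simp: algebra_simps)
      also have "\<dots> = (norm (x - p))\<^sup>2 - 2 * c * inner t (x - p) + c * (c * inner t t)"
        unfolding power2_norm_eq_inner
        by (simp add: inner_diff_left inner_diff_right inner_commute algebra_simps)
      also have "c * inner t t = inner t (x - p)" unfolding c_def using False by simp
      finally have "c * inner t (x - p) \<le> 0" by simp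
      then have "(inner t (x - p))\<^sup>2 \<le> 0"
        unfolding c_def power2_eq_square using False
        by (simp add: divide_le_0_iff mult_le_0_iff not_le inner_gt_zero_iff)
          (use False inner_gt_zero_iff[of t] in linarith)
      then show ?thesis by simp
    qed simp
    then have "x - p = 0" by (rule orth)
    then show ?thesis using \<open>p \<in> S\<close> by simp
  qed
  then show ?thesis by blast
qed

lemma subspace_dense_if_trivial_complement:
  fixes S :: "'a::{real_inner,complete_space} set"
  assumes "subspace S" and "\<And>u. (\<And>s. s \<in> S \<Longrightarrow> inner s u = 0) \<Longrightarrow> u = 0"
  shows "closure S = UNIV"
proof (rule closed_subspace_eq_UNIV)
  show "subspace (closure S)"
  proof (rule subspaceI)
    show "0 \<in> closure S" using subspace_0[OF assms(1)] closure_subset by blast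
    show "x + y \<in> closure S" if xy: "x \<in> closure S" "y \<in> closure S" for x y
    proof -
      obtain a where "\<And>n. a n \<in> S" "a \<longlonglongrightarrow> x"
        using xy(1) unfolding closure_sequential by blast
      moreover obtain b where "\<And>n. b n \<in> S" "b \<longlonglongrightarrow> y"
        using xy(2) unfolding closure_sequential by blast
      ultimately show ?thesis unfolding closure_sequential
        using assms(1) by (intro exI[of _ "\<lambda>n. a n + b n"]) (auto intro: tendsto_add subspace_add)
    qed
    show "c *\<^sub>R x \<in> closure S" if x: "x \<in> closure S" for c x
    proof -
      obtain a where "\<And>n. a n \<in> S" "a \<longlonglongrightarrow> x"
        using x unfolding closure_sequential by blast
      then show ?thesis unfolding closure_sequential
        using assms(1) by (intro exI[of _ "\<lambda>n. c *\<^sub>R a n"])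
          (auto intro: tendsto_intros subspace_scale)
    qed
  qed
  show "closed (closure S)" by simp
  show "u = 0" if "\<And>s. s \<in> closure S \<Longrightarrow> inner s u = 0" for u
    using assms(2) that closure_subset by blast
qed

section \<open>A criterion for essential self-adjointness\<close>

text \<open>
  Multiplication by the imaginary unit recovers the complex inner product from its real part.
\<close>

lift_definition imult :: "L2 \<Rightarrow> L2" is "\<lambda>f x. \<i> * f x"
proof -
  fix f g assume "L2_rel f g"
  then show "L2_rel (\<lambda>x. \<i> * f x) (\<lambda>x. \<i> * g x)"
    by (auto simp: L2_rel_def square_integrable_def norm_mult)
qed

lemma cinner_eq_inner: "cinner_L2 u v = Complex (inner u v) (inner u (imult v))"
proof -
  have "cinner_L2 u (imult v) = - \<i> * cinner_L2 u v"
    by transfer (simp add: mult.left_commute flip: integral_mult_right_zero)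
  then have "Re (cinner_L2 u (imult v)) = Im (cinner_L2 u v)" by simp
  then show ?thesis by (simp add: inner_L2_def complex_eq_iff)
qed

lemma bounded_linear_imult: "bounded_linear imult"
proof (rule bounded_linear_intro[where K = 1])
  show "imult (u + v) = imult u + imult v" for u v
  proof transfer
    fix u v assume "L2_rel u u" "L2_rel v v"
    then have "square_integrable (\<lambda>x. u x + v x)"
      by (intro square_integrable_add) (auto simp: L2_rel_def)
    then have "square_integrable (\<lambda>x. \<i> * (u x + v x))"
      by (auto simp: square_integrable_def norm_mult intro: borel_measurable_times)
    then show "L2_rel (\<lambda>x. \<i> * (u x + v x)) (\<lambda>x. \<i> * u x + \<i> * v x)"
      by (simp add: L2_rel_def distrib_left)
  qed
  show "imult (c *\<^sub>R u) = c *\<^sub>R imult u" for c u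
    by transfer (auto simp: L2_rel_def square_integrable_def norm_mult power_mult_distrib)
  have unit: "(\<i> * z) * cnj (\<i> * z) = z * cnj z" for z
    by (simp add: complex_eq_iff)
  have "(norm (imult u))\<^sup>2 = (norm u)\<^sup>2" for u
    unfolding power2_norm_eq_inner inner_L2_def by transfer (simp only: unit)
  then show "norm (imult u) \<le> norm u * 1" for u by simp
qed

lemma continuous_on_cinner:
  assumes "continuous_on A f" "continuous_on A g"
  shows "continuous_on A (\<lambda>x. cinner_L2 (f x) (g x))"
  unfolding cinner_eq_inner
  by (intro continuous_on_Complex continuous_on_inner assms
      bounded_linear.continuous_on[OF bounded_linear_imult])

lemma closed_adjoint_op: "closed (adjoint_op T)"
proof -
  have "adjoint_op T = (\<Inter>p\<in>T. {q. cinner_L2 (snd p) (fst q) = cinner_L2 (fst p) (snd q)})"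
    unfolding adjoint_op_def by fastforce
  then show ?thesis
    by (auto intro!: closed_Collect_eq continuous_on_cinner continuous_intros)
qed

lemma adjoint_op_closure: "adjoint_op (closure T) = adjoint_op T"
proof
  show "adjoint_op (closure T) \<subseteq> adjoint_op T"
    unfolding adjoint_op_def using closure_subset by blast
  show "adjoint_op T \<subseteq> adjoint_op (closure T)"
  proof (clarsimp simp: adjoint_op_def[of "closure T"])
    fix u v f g assume uv: "(u, v) \<in> adjoint_op T" and fg: "(f, g) \<in> closure T"
    define C where "C = {p. cinner_L2 (snd p) u = cinner_L2 (fst p) v}"
    have "closed C" unfolding C_def
      by (intro closed_Collect_eq continuous_on_cinner continuous_intros)
    moreover have "T \<subseteq> C" using uv unfolding C_def adjoint_op_def by auto
    ultimately have "closure T \<subseteq> C" by (simp add: closure_minimal)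
    with fg show "cinner_L2 g u = cinner_L2 f v" unfolding C_def by auto
  qed
qed

lemma subspace_adjoint_op: "subspace (adjoint_op T)"
proof (rule subspaceI)
  interpret I: bounded_linear imult by (rule bounded_linear_imult)
  show "0 \<in> adjoint_op T"
    by (auto simp: adjoint_op_def zero_prod_def cinner_eq_inner I.zero)
  show "x + y \<in> adjoint_op T" if "x \<in> adjoint_op T" "y \<in> adjoint_op T" for x y
    using that by (auto simp: adjoint_op_def cinner_eq_inner I.add inner_add_right split: prod.splits)
  show "c *\<^sub>R x \<in> adjoint_op T" if "x \<in> adjoint_op T" for c x
    using that by (auto simp: adjoint_op_def cinner_eq_inner I.scaleR scaleR_prod_def split: prod.splits)
qed

text \<open>
  Let \<open>(u, v)\<close> belong to the adjoint. The range of \<open>T + c\<close> is dense, so some values of it converge to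
  \<open>v + c u\<close>; by the lower bound their arguments converge as well, to \<open>w\<close> say, and the limit pair
  belongs to the closure of \<open>T\<close>. The difference of the two pairs lies in the adjoint, so \<open>u - w\<close> is
  orthogonal to the range of \<open>T + c\<close> and hence zero.
\<close>

theorem essentially_self_adjoint_if_shift_bounded_below:
  assumes T: "subspace T" and dense: "densely_defined T" and sym: "T \<subseteq> adjoint_op T"
    and k: "k > 0" and below: "\<And>f g. (f, g) \<in> T \<Longrightarrow> k * norm f \<le> norm (g + c *\<^sub>R f)"
    and orth: "\<And>u. (\<And>f g. (f, g) \<in> T \<Longrightarrow> inner (g + c *\<^sub>R f) u = 0) \<Longrightarrow> u = 0"
  shows "essentially_self_adjoint T"
proof -
  have cl_sub: "closure T \<subseteq> adjoint_op T"
    using sym closed_adjoint_op by (rule closure_minimal)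
  define R where "R = (\<lambda>p. snd p + c *\<^sub>R fst p) ` T"
  have "linear (\<lambda>p :: L2 \<times> L2. snd p + c *\<^sub>R fst p)"
    by (rule linearI) (auto simp: algebra_simps)
  then have "subspace R" unfolding R_def by (intro linear_subspace_image T)
  then have R: "closure R = UNIV"
  proof (rule subspace_dense_if_trivial_complement)
    fix u assume *: "\<And>s. s \<in> R \<Longrightarrow> inner s u = 0"
    show "u = 0"
    proof (rule orth)
      fix f g assume "(f, g) \<in> T"
      then have "g + c *\<^sub>R f \<in> R" unfolding R_def by force
      then show "inner (g + c *\<^sub>R f) u = 0" by (rule *)
    qed
  qed
  have "(u, v) \<in> closure T" if uv: "(u, v) \<in> adjoint_op T" for u v
  proof -
    have "v + c *\<^sub>R u \<in> closure R" using R by simp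
    then obtain y where y: "\<And>n. y n \<in> R" "y \<longlonglongrightarrow> v + c *\<^sub>R u"
      unfolding closure_sequential by blast
    have "\<forall>n. \<exists>p. p \<in> T \<and> y n = snd p + c *\<^sub>R fst p" using y(1) unfolding R_def by blast
    then obtain p where p: "\<And>n. p n \<in> T" "\<And>n. y n = snd (p n) + c *\<^sub>R fst (p n)" by metis
    have "Cauchy (\<lambda>n. fst (p n))"
    proof (rule metric_CauchyI)
      fix e :: real assume "e > 0"
      then have "k * e > 0" using k by simp
      moreover have "Cauchy y" using y(2) by (rule LIMSEQ_imp_Cauchy)
      ultimately obtain N where N: "\<And>m n. m \<ge> N \<Longrightarrow> n \<ge> N \<Longrightarrow> dist (y m) (y n) < k * e"
        unfolding Cauchy_def by blast
      have "dist (fst (p m)) (fst (p n)) < e" if "m \<ge> N" "n \<ge> N" for m n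
      proof -
        have "p m - p n \<in> T" using T p(1) by (simp add: subspace_diff)
        then have "k * norm (fst (p m) - fst (p n)) \<le> norm (y m - y n)"
          using below[of "fst (p m) - fst (p n)" "snd (p m) - snd (p n)"]
          by (simp add: p(2) minus_prod_def algebra_simps)
        with N[OF that] have "k * norm (fst (p m) - fst (p n)) < k * e"
          by (simp add: dist_norm)
        then show ?thesis using k by (simp add: dist_norm)
      qed
      then show "\<exists>N. \<forall>m\<ge>N. \<forall>n\<ge>N. dist (fst (p m)) (fst (p n)) < e" by blast
    qed
    then obtain w where w: "(\<lambda>n. fst (p n)) \<longlonglongrightarrow> w"
      using Cauchy_convergent convergent_def by blast
    have "(\<lambda>n. (fst (p n), y n - c *\<^sub>R fst (p n))) \<longlonglongrightarrow> (w, v + c *\<^sub>R u - c *\<^sub>R w)"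
      by (intro tendsto_intros w y(2))
    then have "p \<longlonglongrightarrow> (w, v + c *\<^sub>R u - c *\<^sub>R w)" by (simp add: p(2))
    then have wT: "(w, v + c *\<^sub>R u - c *\<^sub>R w) \<in> closure T"
      unfolding closure_sequential using p(1) by blast
    then have "(u, v) - (w, v + c *\<^sub>R u - c *\<^sub>R w) \<in> adjoint_op T"
      using uv cl_sub by (intro subspace_diff subspace_adjoint_op) auto
    then have d: "(u - w, - (c *\<^sub>R (u - w))) \<in> adjoint_op T"
      by (simp add: algebra_simps)
    have "u - w = 0"
    proof (rule orth)
      fix f g assume "(f, g) \<in> T"
      then have "cinner_L2 g (u - w) = cinner_L2 f (- (c *\<^sub>R (u - w)))"
        using d unfolding adjoint_op_def by auto
      then have "inner g (u - w) = inner f (- (c *\<^sub>R (u - w)))"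
        by (simp add: inner_L2_def)
      then show "inner (g + c *\<^sub>R f) (u - w) = 0" by (simp add: inner_add_left)
    qed
    then show ?thesis using wT by simp
  qed
  then have "adjoint_op T \<subseteq> closure T" by auto
  moreover have "densely_defined (closure T)"
  proof -
    have "Domain T \<subseteq> Domain (closure T)" using closure_subset by blast
    then show ?thesis using dense closure_mono unfolding densely_defined_def by blast
  qed
  ultimately show ?thesis
    unfolding essentially_self_adjoint_def symmetric_op_def self_adjoint_op_def adjoint_op_closure
    using dense sym cl_sub by blast
qed

section \<open>Tempered functions and integration by parts\<close>

lemma integrable_if_norm_le:
  fixes F :: "real \<Rightarrow> 'a::{banach, second_countable_topology}"
  assumes "integrable lborel G" "F \<in> borel_measurable lborel" "\<And>x. norm (F x) \<le> G x"
  shows "integrable lborel F"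
  by (rule Bochner_Integration.integrable_bound[OF assms(1,2)])
    (use assms(3) in \<open>auto intro: order_trans[OF _ abs_ge_self]\<close>)

lemma integrable_inverse_bra: "integrable lborel (\<lambda>x::real. inverse (bra x))"
  using integrable_inverse_1_plus_square by (simp add: set_integrable_def)

text \<open>
  Enough integrability to pair a function with every Schwartz function; this covers both square integrable functions and functions of polynomial growth.
\<close>

definition tempered :: "(real \<Rightarrow> complex) \<Rightarrow> bool" where
  "tempered h \<longleftrightarrow> h \<in> borel_measurable lborel \<and> (\<exists>N. integrable lborel (\<lambda>x. cmod (h x) / bra x ^ N))"

lemma continuous_measurable: "continuous_on UNIV f \<Longrightarrow> f \<in> borel_measurable lborel"
  for f :: "real \<Rightarrow> complex"
  by (simp add: borel_measurable_continuous_onI)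

lemma slow_bound: "slow f \<Longrightarrow> poly_bounded f"
  by (rule cls_bound)

lemma schwartz_bound: "schwartz f \<Longrightarrow> rapidly_decr f"
  by (rule cls_bound)

lemma cls_measurable: "cls P f \<Longrightarrow> f \<in> borel_measurable lborel"
  by (intro continuous_measurable cls_continuous)

lemma integrable_tempered_mult:
  assumes h: "tempered h" and f: "rapidly_decr f" "f \<in> borel_measurable lborel"
  shows "integrable lborel (\<lambda>x. h x * f x)"
proof -
  obtain N where N: "integrable lborel (\<lambda>x. cmod (h x) / bra x ^ N)"
    using h unfolding tempered_def by blast
  obtain C where C0: "C \<ge> 0" and C: "\<And>x. bra x ^ N * cmod (f x) \<le> C"
    using rapidly_decrE[OF f(1)] by blast
  show ?thesis
  proof (rule integrable_if_norm_le)
    show "integrable lborel (\<lambda>x. C * (cmod (h x) / bra x ^ N))" by (intro integrable_mult_right N)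
    show "(\<lambda>x. h x * f x) \<in> borel_measurable lborel"
      using h f unfolding tempered_def by auto
    show "norm (h x * f x) \<le> C * (cmod (h x) / bra x ^ N)" for x
    proof -
      have "norm (h x * f x) = (bra x ^ N * cmod (f x)) * (cmod (h x) / bra x ^ N)"
        using bra_pos[of x N] by (simp add: norm_mult)
      also have "\<dots> \<le> C * (cmod (h x) / bra x ^ N)"
        using C[of x] bra_pos[of x N] by (intro mult_right_mono) auto
      finally show ?thesis using C0 by (simp add: abs_mult)
    qed
  qed
qed

lemma tempered_mult_poly_bounded:
  assumes h: "tempered h" and f: "poly_bounded f" "f \<in> borel_measurable lborel"
  shows "tempered (\<lambda>x. h x * f x)"
proof -
  obtain N where N: "integrable lborel (\<lambda>x. cmod (h x) / bra x ^ N)"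
    using h unfolding tempered_def by blast
  obtain C M where C: "C \<ge> 0" "\<And>x. cmod (f x) \<le> C * bra x ^ M" using poly_boundedD[OF f(1)] by blast
  have [measurable]: "h \<in> borel_measurable lborel" "f \<in> borel_measurable lborel"
    using h f unfolding tempered_def by auto
  have "integrable lborel (\<lambda>x. cmod (h x * f x) / bra x ^ (N + M))"
  proof (rule integrable_if_norm_le)
    show "integrable lborel (\<lambda>x. C * (cmod (h x) / bra x ^ N))" by (intro integrable_mult_right N)
    show "norm (cmod (h x * f x) / bra x ^ (N + M)) \<le> C * (cmod (h x) / bra x ^ N)" for x
    proof -
      have "cmod (h x * f x) / bra x ^ (N + M) \<le> cmod (h x) * (C * bra x ^ M) / bra x ^ (N + M)"
        unfolding norm_mult using C bra_pos[of x "N + M"]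
        by (intro divide_right_mono mult_left_mono) auto
      also have "\<dots> = C * (cmod (h x) / bra x ^ N)"
        using bra_pos[of x N] bra_pos[of x M] by (simp add: power_add)
      finally show ?thesis using C(1) by (simp add: abs_mult)
    qed
  qed measurable
  then show ?thesis unfolding tempered_def by auto
qed

lemma poly_bounded_imp_tempered:
  assumes f: "poly_bounded f" "f \<in> borel_measurable lborel"
  shows "tempered f"
proof -
  have "integrable lborel (\<lambda>x::real. cmod 1 / bra x ^ 1)"
    using integrable_inverse_bra by (simp add: inverse_eq_divide)
  then have "tempered (\<lambda>x. 1)" unfolding tempered_def by (blast intro: borel_measurable_const)
  from tempered_mult_poly_bounded[OF this f] show ?thesis by simp
qed

lemma slow_imp_tempered: "slow f \<Longrightarrow> tempered f"
  by (intro poly_bounded_imp_tempered slow_bound cls_measurable)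

lemma tempered_mult_slow: "tempered h \<Longrightarrow> slow f \<Longrightarrow> tempered (\<lambda>x. h x * f x)"
  by (intro tempered_mult_poly_bounded slow_bound cls_measurable)

lemma tempered_add:
  assumes "tempered f" "tempered g"
  shows "tempered (\<lambda>x. f x + g x)"
proof -
  obtain M where M: "integrable lborel (\<lambda>x. cmod (f x) / bra x ^ M)"
    using assms(1) unfolding tempered_def by blast
  obtain N where N: "integrable lborel (\<lambda>x. cmod (g x) / bra x ^ N)"
    using assms(2) unfolding tempered_def by blast
  have [measurable]: "f \<in> borel_measurable lborel" "g \<in> borel_measurable lborel"
    using assms unfolding tempered_def by auto
  have "integrable lborel (\<lambda>x. cmod (f x + g x) / bra x ^ (M + N))"
  proof (rule integrable_if_norm_le)
    show "integrable lborel (\<lambda>x. cmod (f x) / bra x ^ M + cmod (g x) / bra x ^ N)"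
      by (intro Bochner_Integration.integrable_add M N)
    show "norm (cmod (f x + g x) / bra x ^ (M + N)) \<le>
        cmod (f x) / bra x ^ M + cmod (g x) / bra x ^ N" for x
    proof -
      have "cmod (f x + g x) / bra x ^ (M + N) \<le> (cmod (f x) + cmod (g x)) / bra x ^ (M + N)"
        using bra_pos[of x "M + N"] by (intro divide_right_mono norm_triangle_ineq) auto
      also have "\<dots> \<le> cmod (f x) / bra x ^ M + cmod (g x) / bra x ^ N"
        unfolding add_divide_distrib
        using bra_pos[of x] by (intro add_mono divide_left_mono bra_mono mult_pos_pos) auto
      finally show ?thesis by simp
    qed
  qed measurable
  then show ?thesis unfolding tempered_def by auto
qed

lemma tempered_diff:
  assumes "tempered f" "tempered g"
  shows "tempered (\<lambda>x. f x - g x)"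
  using tempered_add[OF assms(1) tempered_mult_slow[OF assms(2) slow_const[of "-1"]]] by simp

lemma tempered_imp_locally_integrable:
  assumes h: "tempered h" and A: "A \<in> sets borel" "\<And>x. x \<in> A \<Longrightarrow> \<bar>x\<bar> \<le> r"
  shows "integrable lborel (\<lambda>x. indicator A x * h x)"
proof -
  obtain N where N: "integrable lborel (\<lambda>x. cmod (h x) / bra x ^ N)"
    using h unfolding tempered_def by blast
  have [measurable]: "h \<in> borel_measurable lborel" "A \<in> sets borel"
    using h A unfolding tempered_def by auto
  show ?thesis
  proof (rule integrable_if_norm_le)
    show "integrable lborel (\<lambda>x. bra r ^ N * (cmod (h x) / bra x ^ N))" by (intro integrable_mult_right N)
    show "norm (indicator A x * h x) \<le> bra r ^ N * (cmod (h x) / bra x ^ N)" for x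
    proof (cases "x \<in> A")
      case True
      have "x\<^sup>2 \<le> r\<^sup>2" using A(2)[OF True] by (simp add: abs_le_square_iff[symmetric])
      then have "bra x ^ N \<le> bra r ^ N" by (intro power_mono) auto
      then have "1 * cmod (h x) \<le> bra r ^ N / bra x ^ N * cmod (h x)"
        using bra_pos[of x N] by (intro mult_right_mono) auto
      then show ?thesis using True by (simp add: abs_mult)
    qed simp
  qed measurable
qed

lemma schwartz_integrable: "schwartz f \<Longrightarrow> integrable lborel f"
  using integrable_tempered_mult[OF slow_imp_tempered[OF slow_const[of 1]] schwartz_bound cls_measurable, of f]
  by simp

lemma integrable_tempered_schwartz: "tempered h \<Longrightarrow> schwartz f \<Longrightarrow> integrable lborel (\<lambda>x. h x * f x)"
  by (intro integrable_tempered_mult schwartz_bound cls_measurable)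

lemma schwartz_square_integrable: "schwartz f \<Longrightarrow> square_integrable f"
proof -
  assume f: "schwartz f"
  then have "integrable lborel (\<lambda>x. f x * cnj (f x))"
    by (intro schwartz_integrable schwartz_mult_slow schwartz_slow slow_cnj)
  then have "integrable lborel (\<lambda>x. cmod (f x * cnj (f x)))" by (rule integrable_norm)
  then show ?thesis
    using cls_measurable[OF f] unfolding square_integrable_def
    by (simp add: norm_mult power2_eq_square)
qed

lemma square_integrable_imp_tempered:
  assumes "square_integrable u"
  shows "tempered u"
proof -
  have [measurable]: "u \<in> borel_measurable lborel" and u: "integrable lborel (\<lambda>x. (cmod (u x))\<^sup>2)"
    using assms by (auto simp: square_integrable_def)
  have "integrable lborel (\<lambda>x. cmod (u x) / bra x ^ 1)"
  proof (rule integrable_if_norm_le)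
    show "integrable lborel (\<lambda>x. (cmod (u x))\<^sup>2 + inverse (bra x))"
      by (intro Bochner_Integration.integrable_add u integrable_inverse_bra)
    show "norm (cmod (u x) / bra x ^ 1) \<le> (cmod (u x))\<^sup>2 + inverse (bra x)" for x
    proof -
      define a where "a = cmod (u x)"
      define c where "c = inverse (bra x)"
      have c: "0 \<le> c" "c \<le> 1" using bra_ge_1[of x 1] unfolding c_def
        by (auto intro: inverse_le_1_iff[THEN iffD2] simp: add_nonneg_nonneg)
      have "2 * a * c \<le> a\<^sup>2 + c\<^sup>2" by (rule sum_squares_bound)
      moreover have "c\<^sup>2 \<le> c" using c by (simp add: power2_eq_square mult_left_le)
      moreover have "0 \<le> a * c" using c unfolding a_def by simp
      ultimately have "a * c \<le> a\<^sup>2 + c" by linarith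
      then show ?thesis using c unfolding a_def c_def by (simp add: divide_inverse add_nonneg_nonneg)
    qed
  qed measurable
  then show ?thesis unfolding tempered_def by (auto simp del: power_one_right intro!: exI[of _ 1])
qed

lemma rapidly_decr_tendsto_0:
  assumes "rapidly_decr f"
  shows "(f \<longlongrightarrow> 0) at_top" "(f \<longlongrightarrow> 0) at_bot"
proof -
  obtain C where C: "\<And>x. bra x ^ 1 * cmod (f x) \<le> C" using rapidly_decrE[OF assms, of 1] by blast
  have *: "norm (f x) \<le> C * inverse (bra x)" for x
    using C[of x] bra_pos[of x 1] by (simp add: field_simps)
  have "((\<lambda>x::real. C * inverse (bra x)) \<longlongrightarrow> C * 0) at_top"
    by (intro tendsto_intros tendsto_inverse_0_at_top filterlim_tendsto_add_at_top[OF tendsto_const]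
        filterlim_pow_at_top filterlim_ident) auto
  then show "(f \<longlongrightarrow> 0) at_top" using * by (intro Lim_null_comparison[of f]) auto
  have "((\<lambda>x::real. C * inverse (bra x)) \<longlongrightarrow> C * 0) at_bot"
    by (intro tendsto_intros tendsto_inverse_0_at_top filterlim_tendsto_add_at_top[OF tendsto_const]
        filterlim_pow_at_bot_even filterlim_ident) auto
  then show "(f \<longlongrightarrow> 0) at_bot" using * by (intro Lim_null_comparison[of f]) auto
qed

text \<open>
  The fundamental theorem of calculus on the line and on half-lines, where the function vanishes at
  infinity.
\<close>

lemma integral_deriv_schwartz:
  assumes f: "schwartz f"
  shows "(LINT x|lborel. deriv_op f x) = 0"
    and "(LINT x|lborel. indicator {y<..} x * deriv_op f x) = - f y"
    and "(LINT x|lborel. indicator {..<y} x * deriv_op f x) = f y"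
proof -
  have i: "integrable lborel (deriv_op f)" by (intro schwartz_integrable cls_deriv f)
  have c: "isCont (deriv_op f) x" for x
    using cls_continuous[OF cls_deriv[OF f]] by (simp add: continuous_on_eq_continuous_at)
  have fy: "(f \<longlongrightarrow> f y) (at y)"
    using cls_continuous[OF f] by (simp add: continuous_on_eq_continuous_at isCont_def)
  have si: "set_integrable lborel (einterval a b) (deriv_op f)" for a b
    unfolding set_integrable_def using i by (intro integrable_mult_indicator) auto
  note lims = rapidly_decr_tendsto_0[OF schwartz_bound[OF f]]
  have "(LBINT x=-\<infinity>..\<infinity>. deriv_op f x) = 0 - 0"
    by (rule interval_integral_FTC_integrable[where F = f])
      (use c si[of "-\<infinity>" \<infinity>] cls_has_deriv[OF f] lims in \<open>auto simp: ereal_tendsto_simps\<close>)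
  then show "(LINT x|lborel. deriv_op f x) = 0"
    by (simp add: interval_lebesgue_integral_def set_lebesgue_integral_def)
  have "(LBINT x=y..\<infinity>. deriv_op f x) = 0 - f y"
    by (rule interval_integral_FTC_integrable[where F = f])
      (use c si[of y \<infinity>] si[of "-\<infinity>" y] cls_has_deriv[OF f] lims fy in \<open>auto simp: ereal_tendsto_simps intro: filterlim_at_split[THEN iffD1, THEN conjunct2]\<close>)
  then show "(LINT x|lborel. indicator {y<..} x * deriv_op f x) = - f y"
    by (simp add: interval_lebesgue_integral_def set_lebesgue_integral_def scaleR_conv_of_real of_real_indicator)
  have "(LBINT x=-\<infinity>..y. deriv_op f x) = f y - 0"
    by (rule interval_integral_FTC_integrable[where F = f])
      (use c si[of y \<infinity>] si[of "-\<infinity>" y] cls_has_deriv[OF f] lims fy in \<open>auto simp: ereal_tendsto_simps intro: filterlim_at_split[THEN iffD1, THEN conjunct1]\<close>)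
  then show "(LINT x|lborel. indicator {..<y} x * deriv_op f x) = f y"
    by (simp add: interval_lebesgue_integral_def set_lebesgue_integral_def scaleR_conv_of_real of_real_indicator)
qed

lemma integral_by_parts:
  assumes f: "schwartz f" and g: "slow g"
  shows "(LINT x|lborel. deriv_op f x * g x) = - (LINT x|lborel. f x * deriv_op g x)"
proof -
  have "deriv_op (\<lambda>x. f x * g x) = (\<lambda>x. f x * deriv_op g x + deriv_op f x * g x)"
    by (intro deriv_op_mult cls_differentiable[OF f] cls_differentiable[OF g])
  then have "0 = (LINT x|lborel. f x * deriv_op g x + deriv_op f x * g x)"
    using integral_deriv_schwartz(1)[OF schwartz_mult_slow[OF f g]] by simp
  also have "\<dots> = (LINT x|lborel. f x * deriv_op g x) + (LINT x|lborel. deriv_op f x * g x)"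
    by (intro Bochner_Integration.integral_add schwartz_integrable schwartz_mult_slow cls_deriv f g)
  finally show ?thesis by (simp add: eq_neg_iff_add_eq_0 add.commute)
qed

lemma integral_by_parts_funpow:
  assumes "schwartz f" "slow g"
  shows "(LINT x|lborel. Der k f x * g x) = (-1) ^ k * (LINT x|lborel. f x * Der k g x)"
  using assms
proof (induction k arbitrary: g)
  case (Suc k)
  have "(LINT x|lborel. Der (Suc k) f x * g x) =
      - (LINT x|lborel. Der k f x * deriv_op g x)"
    using Suc.prems by (simp add: integral_by_parts cls_funpow_deriv)
  also have "\<dots> = (-1) ^ Suc k * (LINT x|lborel. f x * Der k (deriv_op g) x)"
    using Suc.IH[of "deriv_op g"] Suc.prems by (simp add: cls_deriv)
  finally show ?case by (simp add: funpow_swap1)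
qed simp

subsection \<open>Primitives\<close>

text \<open>
  Writing the integral from the origin to \<open>x\<close> with a signed kernel puts both signs of \<open>x\<close> into one
  formula, to which the theorem of Fubini applies directly.
\<close>

definition prim_kernel :: "real \<Rightarrow> real \<Rightarrow> complex" where
  "prim_kernel x y = indicator {0<..<x} y - indicator {x<..<0} y"

definition prim :: "(real \<Rightarrow> complex) \<Rightarrow> real \<Rightarrow> complex" where
  "prim h x = (LINT y|lborel. prim_kernel x y * h y)"

lemma prim_kernel_measurable [measurable]:
  "(\<lambda>p. prim_kernel (fst p) (snd p)) \<in> borel_measurable (lborel \<Otimes>\<^sub>M lborel)"
proof -
  have *: "prim_kernel (fst p) (snd p) = (if 0 < snd p \<and> snd p < fst p then 1 else 0)
     - (if fst p < snd p \<and> snd p < 0 then 1 else 0)" for p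
    by (auto simp: prim_kernel_def indicator_def)
  show ?thesis unfolding * by measurable
qed

lemma prim_kernel_measurable2 [measurable]: "prim_kernel x \<in> borel_measurable lborel"
  unfolding prim_kernel_def[abs_def] by measurable

lemma norm_prim_kernel_le: "cmod (prim_kernel x y) \<le> indicator {y. \<bar>y\<bar> \<le> \<bar>x\<bar>} y"
  by (auto simp: prim_kernel_def indicator_def)

lemma integrable_prim_kernel:
  assumes h: "tempered h"
  shows "integrable lborel (\<lambda>y. prim_kernel x y * h y)"
proof -
  have [measurable]: "h \<in> borel_measurable lborel" using h unfolding tempered_def by auto
  have "integrable lborel (\<lambda>y. indicator {-\<bar>x\<bar>..\<bar>x\<bar>} y * h y)"
    by (rule tempered_imp_locally_integrable[OF h, of _ "\<bar>x\<bar>"]) auto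
  then show ?thesis
    by (rule Bochner_Integration.integrable_bound)
      (auto simp: prim_kernel_def indicator_def)
qed

lemma prim_cong_AE:
  assumes "tempered h" "tempered g" "AE x in lborel. h x = g x"
  shows "prim h = prim g"
proof
  fix x
  have [measurable]: "h \<in> borel_measurable lborel" "g \<in> borel_measurable lborel"
    using assms unfolding tempered_def by auto
  have "AE y in lborel. prim_kernel x y * h y = prim_kernel x y * g y"
    using assms(3) by eventually_elim simp
  then show "prim h x = prim g x" unfolding prim_def by (intro integral_cong_AE) measurable
qed

text \<open>
  On the support of the kernel \<open>bra y \<le> bra x\<close>, so the weight that makes \<open>h\<close> integrable can be moved
  out of the integral. Integrating a tempered function thus costs only a polynomial factor.
\<close>

lemma norm_prim_le:
  assumes N: "integrable lborel (\<lambda>x. cmod (h x) / bra x ^ N)" and h: "tempered h"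
  shows "(LINT y|lborel. cmod (prim_kernel x y * h y)) \<le> (LINT y|lborel. cmod (h y) / bra y ^ N) * bra x ^ N"
proof -
  have "(LINT y|lborel. cmod (prim_kernel x y * h y)) \<le> (LINT y|lborel. (cmod (h y) / bra y ^ N) * bra x ^ N)"
  proof (rule integral_mono)
    show "integrable lborel (\<lambda>y. cmod (prim_kernel x y * h y))"
      using integrable_prim_kernel[OF h] by (rule integrable_norm)
    show "integrable lborel (\<lambda>y. (cmod (h y) / bra y ^ N) * bra x ^ N)" by (intro integrable_mult_left N)
    show "cmod (prim_kernel x y * h y) \<le> (cmod (h y) / bra y ^ N) * bra x ^ N" for y
    proof (cases "\<bar>y\<bar> \<le> \<bar>x\<bar>")
      case True
      then have "bra y ^ N \<le> bra x ^ N" by (intro power_mono) (auto simp: abs_le_square_iff)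
      then have "1 * cmod (h y) \<le> bra x ^ N / bra y ^ N * cmod (h y)"
        using bra_pos[of y N] by (intro mult_right_mono) auto
      moreover have "cmod (prim_kernel x y) * cmod (h y) \<le> 1 * cmod (h y)"
        by (intro mult_right_mono) (auto simp: prim_kernel_def indicator_def)
      ultimately show ?thesis by (simp add: norm_mult mult.commute)
    next
      case False
      then show ?thesis using norm_prim_kernel_le[of x y] bra_pos[of y N] by simp
    qed
  qed
  then show ?thesis by (simp only: integral_mult_left_zero)
qed

lemma poly_bounded_prim: "tempered h \<Longrightarrow> poly_bounded (prim h)"
proof -
  assume h: "tempered h"
  then obtain N where N: "integrable lborel (\<lambda>x. cmod (h x) / bra x ^ N)"
    unfolding tempered_def by blast
  have "cmod (prim h x) \<le> (LINT y|lborel. cmod (h y) / bra y ^ N) * bra x ^ N" for x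
    unfolding prim_def by (rule order_trans[OF integral_norm_bound norm_prim_le[OF N h]])
  then show ?thesis unfolding poly_bounded_def by blast
qed

lemma continuous_on_prim:
  assumes h: "tempered h"
  shows "continuous_on UNIV (prim h)"
proof -
  have [measurable]: "h \<in> borel_measurable lborel" using h unfolding tempered_def by auto
  have "isCont (prim h) x" for x
  proof (unfold continuous_at_sequentially, intro allI impI)
    fix X assume X: "X \<longlonglongrightarrow> x"
    then obtain r where r: "\<And>n. \<bar>X n\<bar> \<le> r"
      using convergent_imp_bounded[OF X] unfolding bounded_iff by auto
    show "(prim h \<circ> X) \<longlonglongrightarrow> prim h x" unfolding comp_def prim_def
    proof (rule integral_dominated_convergence[where w = "\<lambda>y. cmod (indicator {-r..r} y * h y)"])
      show "integrable lborel (\<lambda>y. cmod (indicator {-r..r} y * h y))"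
        by (intro integrable_norm tempered_imp_locally_integrable[OF h, of _ r]) auto
      have "AE y in lborel. y \<noteq> x" by (rule AE_lborel_singleton)
      then show "AE y in lborel. (\<lambda>n. prim_kernel (X n) y * h y) \<longlonglongrightarrow> prim_kernel x y * h y"
      proof eventually_elim
        case (elim y)
        have "\<forall>\<^sub>F n in sequentially. prim_kernel (X n) y = prim_kernel x y"
        proof (cases "y < x")
          case True
          have "\<forall>\<^sub>F n in sequentially. y < X n" by (rule order_tendstoD(1)[OF X True])
          then show ?thesis
            by eventually_elim (use True in \<open>auto simp: prim_kernel_def indicator_def\<close>)
        next
          case False
          then have "x < y" using elim by simp
          have "\<forall>\<^sub>F n in sequentially. X n < y" by (rule order_tendstoD(2)[OF X \<open>x < y\<close>])
          then show ?thesis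
            by eventually_elim (use \<open>x < y\<close> in \<open>auto simp: prim_kernel_def indicator_def\<close>)
        qed
        then have "(\<lambda>n. prim_kernel (X n) y) \<longlonglongrightarrow> prim_kernel x y" by (rule tendsto_eventually)
        then show ?case by (intro tendsto_intros)
      qed
      have "norm (prim_kernel (X n) y * h y) \<le> cmod (indicator {-r..r} y * h y)" for n y
        using r[of n] by (auto simp: prim_kernel_def indicator_def)
      then show "AE y in lborel. norm (prim_kernel (X n) y * h y) \<le> cmod (indicator {-r..r} y * h y)" for n
        by simp
    qed measurable
  qed
  then show ?thesis by (simp add: continuous_on_eq_continuous_at)
qed

lemma prim_eq_interval_integral: "prim h x = (LBINT y=0..x. h y)"
proof (cases "0 \<le> x")
  case True
  then have "prim_kernel x y = indicator (einterval 0 x) y" for y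
    by (auto simp: prim_kernel_def indicator_def einterval_def zero_ereal_def)
  then show ?thesis using True
    by (simp add: prim_def interval_lebesgue_integral_def set_lebesgue_integral_def
        scaleR_conv_of_real of_real_indicator)
next
  case False
  then have "prim_kernel x y = - indicator (einterval x 0) y" for y
    by (auto simp: prim_kernel_def indicator_def einterval_def zero_ereal_def)
  then show ?thesis using False
    by (simp add: prim_def interval_lebesgue_integral_def set_lebesgue_integral_def
        scaleR_conv_of_real of_real_indicator)
qed

lemma has_vector_derivative_prim:
  assumes h: "continuous_on UNIV h"
  shows "(prim h has_vector_derivative h x) (at x)"
proof -
  have "((\<lambda>u. LBINT y=0..u. h y) has_vector_derivative h x) (at x within {min 0 x - 1..max 0 x + 1})"
    unfolding zero_ereal_def
    by (intro interval_integral_FTC2) (auto intro: continuous_on_subset[OF h])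
  then have "((\<lambda>u. LBINT y=0..u. h y) has_vector_derivative h x) (at x within {min 0 x - 1<..<max 0 x + 1})"
    by (rule has_vector_derivative_within_subset) auto
  then show ?thesis
    unfolding prim_eq_interval_integral[abs_def]
    by (subst (asm) has_vector_derivative_within_open) auto
qed

text \<open>
  Integration by parts when \<open>h\<close> is only measurable: exchange the order of integration and evaluate the
  inner integral of the derivative over a half-line.
\<close>

lemma integral_prim:
  assumes h: "tempered h" and f: "schwartz f"
  shows "(LINT x|lborel. prim h x * deriv_op f x) = - (LINT x|lborel. h x * f x)"
proof -
  have [measurable]: "h \<in> borel_measurable lborel" "deriv_op f \<in> borel_measurable lborel" "f \<in> borel_measurable lborel"
    using h cls_measurable[OF f] cls_measurable[OF cls_deriv[OF f]] unfolding tempered_def by auto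
  obtain N where N: "integrable lborel (\<lambda>x. cmod (h x) / bra x ^ N)"
    using h unfolding tempered_def by blast
  define A where "A = (LINT y|lborel. cmod (h y) / bra y ^ N)"
  define F where "F = (\<lambda>x y. prim_kernel x y * h y * deriv_op f x)"
  have F_inner: "(\<lambda>y. F x y) = (\<lambda>y. (prim_kernel x y * h y) * deriv_op f x)" for x
    unfolding F_def by simp
  have "integrable (lborel \<Otimes>\<^sub>M lborel) (case_prod F)"
  proof (rule lborel_pair.Fubini_integrable)
    show [measurable]: "case_prod F \<in> borel_measurable (lborel \<Otimes>\<^sub>M lborel)"
      unfolding F_def case_prod_beta' by measurable
    show "AE x in lborel. integrable lborel (\<lambda>y. case_prod F (x, y))"
      using integrable_prim_kernel[OF h] by (simp add: F_inner)
    show "integrable lborel (\<lambda>x. LINT y|lborel. norm (case_prod F (x, y)))"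
    proof (rule integrable_if_norm_le)
      have "schwartz (\<lambda>x. deriv_op f x * of_real (poly ([:1, 0, 1:] ^ N) x))"
        by (intro schwartz_mult_slow cls_deriv f slow_poly)
      then have "integrable lborel (\<lambda>x. A * cmod (deriv_op f x * of_real (poly ([:1, 0, 1:] ^ N) x)))"
        by (intro integrable_mult_right integrable_norm schwartz_integrable)
      moreover have "cmod (deriv_op f x * of_real (poly ([:1, 0, 1:] ^ N) x)) = bra x ^ N * cmod (deriv_op f x)" for x
        unfolding norm_mult norm_of_real using bra_pos[of x N]
        by (simp add: poly_power power2_eq_square)
      ultimately show "integrable lborel (\<lambda>x. A * (bra x ^ N * cmod (deriv_op f x)))" by simp
      show "norm (LINT y|lborel. norm (case_prod F (x, y))) \<le> A * (bra x ^ N * cmod (deriv_op f x))" for x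
      proof -
        have "norm (LINT y|lborel. norm (case_prod F (x, y))) =
            (LINT y|lborel. cmod (prim_kernel x y * h y)) * cmod (deriv_op f x)"
          by (simp add: F_def norm_mult)
        also have "\<dots> \<le> (A * bra x ^ N) * cmod (deriv_op f x)"
          unfolding A_def by (intro mult_right_mono norm_prim_le[OF N h]) auto
        also have "\<dots> = A * (bra x ^ N * cmod (deriv_op f x))" by (simp add: mult.assoc)
        finally show ?thesis .
      qed
    qed measurable
  qed
  then have "(LINT y|lborel. LINT x|lborel. F x y) = (LINT x|lborel. LINT y|lborel. F x y)"
    by (rule lborel_pair.Fubini_integral)
  also have "\<dots> = (LINT x|lborel. prim h x * deriv_op f x)"
    unfolding F_inner prim_def by simp
  also have "(LINT y|lborel. LINT x|lborel. F x y) = (LINT y|lborel. - (h y * f y))"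
  proof (rule integral_cong_AE)
    have *: "(LINT x|lborel. F x y) = - (h y * f y)" if "y \<noteq> 0" for y
    proof -
      have "(LINT x|lborel. F x y) = h y * (LINT x|lborel. prim_kernel x y * deriv_op f x)"
        unfolding F_def by (simp add: mult.commute mult.left_commute mult.assoc flip: integral_mult_right_zero)
      also have "(LINT x|lborel. prim_kernel x y * deriv_op f x) = - f y"
      proof (cases "0 < y")
        case True
        then have "prim_kernel x y = indicator {y<..} x" for x
          by (auto simp: prim_kernel_def indicator_def)
        then show ?thesis using integral_deriv_schwartz(2)[OF f] by simp
      next
        case False
        then have "prim_kernel x y = - indicator {..<y} x" for x
          using that by (auto simp: prim_kernel_def indicator_def)
        then show ?thesis using integral_deriv_schwartz(3)[OF f] by simp
      qed
      finally show ?thesis by simp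
    qed
    show "AE y in lborel. (LINT x|lborel. F x y) = - (h y * f y)"
      using AE_lborel_singleton[of 0] by (rule eventually_mono) (rule *)
    have "case_prod (\<lambda>y x. F x y) \<in> borel_measurable (lborel \<Otimes>\<^sub>M lborel)"
    proof -
      have "prim_kernel (snd p) (fst p) = (if 0 < fst p \<and> fst p < snd p then 1 else 0)
          - (if snd p < fst p \<and> fst p < 0 then 1 else 0)" for p
        by (auto simp: prim_kernel_def indicator_def)
      then show ?thesis unfolding F_def case_prod_beta' by simp
    qed
    then show "(\<lambda>y. LINT x|lborel. F x y) \<in> borel_measurable lborel"
      by (rule lborel.borel_measurable_lebesgue_integral)
  qed measurable
  finally show ?thesis by simp
qed

text \<open>
  Mean zero allows the primitive to be written as an integral from either end of the line, so it decays
  rapidly in both directions.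
\<close>

lemma schwartz_primitive:
  assumes f: "schwartz f" and mean: "(LINT x|lborel. f x) = 0"
  obtains F where "schwartz F" "deriv_op F = f"
proof -
  define F where "F x = (LINT y|lborel. indicator {..<x} y * f y)" for x
  have i: "integrable lborel (\<lambda>y. g y * f y)" if "g \<in> borel_measurable lborel" "\<And>y. cmod (g y) \<le> 1" for g
  proof (rule integrable_if_norm_le[OF integrable_norm[OF schwartz_integrable[OF f]]])
    show "(\<lambda>y. g y * f y) \<in> borel_measurable lborel" using that cls_measurable[OF f] by auto
    show "norm (g y * f y) \<le> norm (f y)" for y
      unfolding norm_mult using that(2)[of y] by (simp add: mult_left_le_one_le)
  qed
  have F_prim: "F x = prim f x + F 0" for x
  proof -
    have "F x = (LINT y|lborel. prim_kernel x y * f y + indicator {..<0} y * f y)"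
      unfolding F_def
    proof (rule integral_cong_AE)
      show "AE y in lborel. indicator {..<x} y * f y = prim_kernel x y * f y + indicator {..<0} y * f y"
        using AE_lborel_singleton[of 0] AE_lborel_singleton[of x]
        by eventually_elim (auto simp: prim_kernel_def indicator_def)
    qed (use cls_measurable[OF f] in measurable)
    also have "\<dots> = prim f x + F 0" unfolding prim_def F_def
      by (intro Bochner_Integration.integral_add i integrable_prim_kernel slow_imp_tempered schwartz_slow f)
        (auto simp: indicator_def)
    finally show ?thesis .
  qed
  have d: "(F has_vector_derivative f x) (at x)" for x
  proof -
    have "((\<lambda>x. prim f x + F 0) has_vector_derivative f x + 0) (at x)"
      by (intro has_vector_derivative_add has_vector_derivative_prim cls_continuous[OF f]
          has_vector_derivative_const)
    moreover have "(\<lambda>x. prim f x + F 0) = F" by (rule ext, rule F_prim[symmetric])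
    ultimately show ?thesis by simp
  qed
  have neg: "F x = - (LINT y|lborel. indicator {x<..} y * f y)" for x
  proof -
    have "0 = (LINT y|lborel. indicator {..<x} y * f y + indicator {x<..} y * f y)"
      unfolding mean[symmetric]
    proof (rule integral_cong_AE)
      show "AE y in lborel. f y = indicator {..<x} y * f y + indicator {x<..} y * f y"
        using AE_lborel_singleton[of x] by eventually_elim (auto simp: indicator_def)
    qed (use cls_measurable[OF f] in measurable)
    also have "\<dots> = F x + (LINT y|lborel. indicator {x<..} y * f y)"
      unfolding F_def by (intro Bochner_Integration.integral_add i) (auto simp: indicator_def)
    finally show ?thesis by (simp add: eq_neg_iff_add_eq_0)
  qed
  have "rapidly_decr F" unfolding rapidly_decr_def
  proof
    fix N
    have sch: "schwartz (\<lambda>x. of_real (poly ([:1, 0, 1:] ^ N) x) * f x)"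
      by (intro slow_mult_schwartz slow_poly f)
    have bra_poly: "complex_of_real (poly ([:1, 0, 1:] ^ N) x) = of_real (bra x ^ N)" for x
      by (simp add: poly_power power2_eq_square)
    define C where "C = (LINT y|lborel. cmod (of_real (bra y ^ N) * f y))"
    have iC: "integrable lborel (\<lambda>y. cmod (of_real (bra y ^ N) * f y))"
      using schwartz_integrable[OF sch] unfolding bra_poly by (rule integrable_norm)
    have key: "bra x ^ N * cmod (LINT y|lborel. indicator S y * f y) \<le> C"
      if S: "S \<in> sets borel" "\<And>y. y \<in> S \<Longrightarrow> \<bar>x\<bar> \<le> \<bar>y\<bar>" for x S
    proof -
      have "bra x ^ N * cmod (LINT y|lborel. indicator S y * f y) \<le>
          bra x ^ N * (LINT y|lborel. cmod (indicator S y * f y))"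
        using bra_pos[of x N] by (intro mult_left_mono integral_norm_bound) auto
      also have "\<dots> = (LINT y|lborel. bra x ^ N * cmod (indicator S y * f y))" by simp
      also have "\<dots> \<le> C" unfolding C_def
      proof (rule integral_mono)
        show "integrable lborel (\<lambda>y. bra x ^ N * cmod (indicator S y * f y))"
          using S by (intro integrable_mult_right integrable_norm i) (auto simp: indicator_def)
        show "bra x ^ N * cmod (indicator S y * f y) \<le> cmod (of_real (bra y ^ N) * f y)" for y
        proof (cases "y \<in> S")
          case True
          have "bra x ^ N \<le> bra y ^ N" using S(2)[OF True]
            by (intro power_mono) (auto simp: abs_le_square_iff)
          then show ?thesis using True bra_pos[of y N]
            by (simp add: norm_mult mult_right_mono del: of_real_power)
        qed simp
      qed (rule iC)
      finally show ?thesis .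
    qed
    have "bra x ^ N * cmod (F x) \<le> C" for x
    proof (cases "0 \<le> x")
      case True
      then show ?thesis using key[of "{x<..}" x] unfolding neg by simp
    next
      case False
      then show ?thesis using key[of "{..<x}" x] unfolding F_def by simp
    qed
    then show "\<exists>C. \<forall>x. bra x ^ N * cmod (F x) \<le> C" by blast
  qed
  moreover have "schwartz F" unfolding cls_def
  proof
    fix j
    have "reg rapidly_decr (Suc j) F"
      unfolding reg_Suc_iff[OF d] using \<open>rapidly_decr F\<close> f by (simp add: cls_def)
    then show "reg rapidly_decr j F" by (rule reg_SucD)
  qed
  ultimately show ?thesis using that deriv_op_eq[OF d] by blast
qed

section \<open>Hyperbolic weights\<close>

lemma cosh_real_neq_0: "cosh (z::real) \<noteq> 0"
  using cosh_real_ge_1[of z] by linarith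

text \<open>
  The weights \<open>1 / cosh\<close> decay exponentially and are stable under differentiation: up to the factor \<open>\<delta>\<close>,
  a derivative only changes the polynomial in the bounded function \<open>tanh\<close>.
\<close>

definition sech_weight :: "real \<Rightarrow> real \<Rightarrow> real poly \<Rightarrow> real \<Rightarrow> complex" where
  "sech_weight \<delta> a P = (\<lambda>x. of_real (poly P (tanh (\<delta> * (x - a))) / cosh (\<delta> * (x - a))))"

text \<open>
  The effect of one derivative on that polynomial, from \<open>tanh' = 1 - tanh\<^sup>2\<close> and
  \<open>(1 / cosh)' = - tanh / cosh\<close>.
\<close>

definition sech_step :: "real poly \<Rightarrow> real poly" where
  "sech_step P = pderiv P * [:1, 0, -1:] - [:0, 1:] * P"

lemma has_vector_derivative_sech_weight:
  "(sech_weight \<delta> a P has_vector_derivative of_real \<delta> * sech_weight \<delta> a (sech_step P) x) (at x)"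
proof -
  let ?z = "\<delta> * (x - a)"
  have ne: "cosh ?z \<noteq> 0" using cosh_real_ge_1[of ?z] by linarith
  have "((\<lambda>x. poly P (tanh (\<delta> * (x - a))) / cosh (\<delta> * (x - a))) has_real_derivative
      (poly (pderiv P) (tanh ?z) * ((1 - (tanh ?z)\<^sup>2) * \<delta>) * cosh ?z
        - poly P (tanh ?z) * (sinh ?z * \<delta>)) / (cosh ?z * cosh ?z)) (at x)"
    using ne by (auto intro!: derivative_eq_intros DERIV_chain2[OF poly_DERIV])
  moreover have "(poly (pderiv P) (tanh ?z) * ((1 - (tanh ?z)\<^sup>2) * \<delta>) * cosh ?z
        - poly P (tanh ?z) * (sinh ?z * \<delta>)) / (cosh ?z * cosh ?z)
      = \<delta> * (poly (sech_step P) (tanh ?z) / cosh ?z)"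
    using ne unfolding sech_step_def tanh_def by (simp add: field_simps power2_eq_square)
  ultimately have "((\<lambda>x. poly P (tanh (\<delta> * (x - a))) / cosh (\<delta> * (x - a))) has_real_derivative
      \<delta> * (poly (sech_step P) (tanh ?z) / cosh ?z)) (at x)" by simp
  then have "((\<lambda>x. complex_of_real (poly P (tanh (\<delta> * (x - a))) / cosh (\<delta> * (x - a)))) has_vector_derivative
      of_real (\<delta> * (poly (sech_step P) (tanh ?z) / cosh ?z))) (at x)"
    by (intro has_vector_derivative_of_real) (simp add: has_real_derivative_iff_has_vector_derivative)
  then show ?thesis unfolding sech_weight_def by simp
qed

lemma sech_weight_smult: "sech_weight \<delta> a (smult c P) x = of_real c * sech_weight \<delta> a P x"
  by (simp add: sech_weight_def)

lemma poly_tanh_bounded: "\<exists>C\<ge>0. \<forall>z::real. \<bar>poly P (tanh z)\<bar> \<le> C"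
proof -
  have "compact (poly P ` {-1..1})"
    by (intro compact_continuous_image continuous_intros) auto
  then obtain C where C: "\<And>t. t \<in> {-1..1} \<Longrightarrow> \<bar>poly P t\<bar> \<le> C"
    using compact_imp_bounded[of "poly P ` {-1..1}"] unfolding bounded_iff real_norm_def by blast
  have "\<bar>poly P (tanh z)\<bar> \<le> C" for z
    using tanh_real_bounds[of z] by (intro C) auto
  moreover have "0 \<le> C" using C[of 0] by auto
  ultimately show ?thesis by blast
qed

lemma power_le_fact_exp:
  assumes "0 \<le> z"
  shows "z ^ n \<le> fact n * exp (z::real)"
proof -
  have "(\<Sum>k\<in>{n}. z ^ k /\<^sub>R fact k) \<le> (\<Sum>k. z ^ k /\<^sub>R fact k)"
    using assms by (intro sum_le_suminf summable_exp_generic) auto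
  then have "z ^ n /\<^sub>R fact n \<le> exp z" by (simp add: exp_def)
  then show ?thesis by (simp add: field_simps)
qed

lemma exp_abs_le_cosh: "exp \<bar>z\<bar> \<le> 2 * cosh (z::real)"
  unfolding cosh_def by (cases "0 \<le> z") auto

lemma bra_power_le_cosh:
  assumes "\<delta> \<noteq> 0"
  obtains C where "C \<ge> 0" "\<And>x. bra x ^ N \<le> C * cosh (\<delta> * (x - a))"
proof -
  define K where "K = (2 + 2 * a\<^sup>2) * (1 + 1 / \<delta>\<^sup>2)"
  define C where "C = K ^ N * (2 ^ N * (1 + 2 * fact (2 * N)))"
  have K: "K \<ge> 0" unfolding K_def by simp
  have "bra x ^ N \<le> C * cosh (\<delta> * (x - a))" for x
  proof -
    define z where "z = \<delta> * (x - a)"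
    have xz: "x = a + z / \<delta>" unfolding z_def using assms by simp
    have "x\<^sup>2 \<le> 2 * a\<^sup>2 + 2 * (z / \<delta>)\<^sup>2"
      unfolding xz using sum_squares_bound[of a "z / \<delta>"] by (simp add: power2_sum)
    then have "bra x \<le> (2 + 2 * a\<^sup>2) * (1 + (z / \<delta>)\<^sup>2)"
    proof -
      have "0 \<le> a\<^sup>2 * (z / \<delta>)\<^sup>2" by simp
      moreover have "(2 + 2 * a\<^sup>2) * (1 + (z / \<delta>)\<^sup>2) =
          2 + 2 * a\<^sup>2 + 2 * (z / \<delta>)\<^sup>2 + 2 * (a\<^sup>2 * (z / \<delta>)\<^sup>2)"
        by (simp add: algebra_simps)
      ultimately show ?thesis using \<open>x\<^sup>2 \<le> _\<close> by linarith
    qed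
    also have "\<dots> \<le> (2 + 2 * a\<^sup>2) * ((1 + 1 / \<delta>\<^sup>2) * (1 + z\<^sup>2))"
      by (intro mult_left_mono) (auto simp: power_divide distrib_left distrib_right add_nonneg_nonneg)
    finally have "bra x ^ N \<le> (K * (1 + z\<^sup>2)) ^ N"
      unfolding K_def by (intro power_mono) (auto simp: mult.assoc)
    also have "\<dots> = K ^ N * (1 + z\<^sup>2) ^ N" by (simp add: power_mult_distrib)
    also have "(1 + z\<^sup>2) ^ N \<le> 2 ^ N * (1 + 2 * fact (2 * N)) * cosh z"
    proof -
      have "(1 + z\<^sup>2) ^ N \<le> (2 * max 1 (z\<^sup>2)) ^ N" by (intro power_mono) auto
      also have "\<dots> = 2 ^ N * max 1 (z\<^sup>2) ^ N" by (simp add: power_mult_distrib)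
      also have "max 1 (z\<^sup>2) ^ N \<le> 1 + \<bar>z\<bar> ^ (2 * N)"
        by (auto simp: max_def power_mult)
      also have "\<bar>z\<bar> ^ (2 * N) \<le> fact (2 * N) * exp \<bar>z\<bar>" by (rule power_le_fact_exp) simp
      also have "\<dots> \<le> fact (2 * N) * (2 * cosh z)" by (intro mult_left_mono exp_abs_le_cosh) simp
      also have "1 + fact (2 * N) * (2 * cosh z) \<le> cosh z + fact (2 * N) * (2 * cosh z)"
        using cosh_real_ge_1 by simp
      finally show ?thesis by (simp add: algebra_simps)
    qed
    finally show ?thesis unfolding C_def z_def using K by (simp add: mult.assoc mult_left_mono)
  qed
  moreover have "C \<ge> 0" unfolding C_def using K by simp
  ultimately show ?thesis using that by blast
qed

lemma schwartz_sech_weight: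
  assumes \<delta>: "\<delta> \<noteq> 0"
  shows "schwartz (sech_weight \<delta> a P)"
proof (rule cls_coinduct[of "\<lambda>f. \<exists>P. f = sech_weight \<delta> a P"])
  fix f assume "\<exists>P. f = sech_weight \<delta> a P"
  then obtain P where f: "f = sech_weight \<delta> a P" by blast
  have "rapidly_decr f" unfolding rapidly_decr_def
  proof
    fix N
    obtain C where C: "C \<ge> 0" "\<And>x. bra x ^ N \<le> C * cosh (\<delta> * (x - a))"
      using bra_power_le_cosh[OF \<delta>] by metis
    obtain D where D: "D \<ge> 0" "\<And>z. \<bar>poly P (tanh z)\<bar> \<le> D" using poly_tanh_bounded by blast
    have "bra x ^ N * cmod (f x) \<le> C * D" for x
    proof -
      have pos: "cosh (\<delta> * (x - a)) > 0" using cosh_real_ge_1[of "\<delta> * (x - a)"] by linarith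
      have "bra x ^ N * cmod (f x) = bra x ^ N / cosh (\<delta> * (x - a)) * \<bar>poly P (tanh (\<delta> * (x - a)))\<bar>"
        unfolding f sech_weight_def norm_of_real using pos by simp
      also have "\<dots> \<le> C * D"
        using C D pos by (intro mult_mono) (auto simp: pos_divide_le_eq)
      finally show ?thesis .
    qed
    then show "\<exists>C. \<forall>x. bra x ^ N * cmod (f x) \<le> C" by blast
  qed
  moreover have "\<forall>x. (f has_vector_derivative sech_weight \<delta> a (smult \<delta> (sech_step P)) x) (at x)"
    unfolding f sech_weight_smult using has_vector_derivative_sech_weight by blast
  ultimately show "rapidly_decr f \<and> (\<exists>f'. (\<forall>x. (f has_vector_derivative f' x) (at x)) \<and>
      (\<exists>P. f' = sech_weight \<delta> a P))" by blast
qed blast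

section \<open>The fundamental lemma of the calculus of variations\<close>

lemma tanh_diff: "tanh u - tanh v = sinh (u - v) / (cosh u * cosh (v::real))"
proof -
  have "cosh u \<noteq> 0" "cosh v \<noteq> 0" using cosh_real_ge_1[of u] cosh_real_ge_1[of v] by linarith+
  then show ?thesis unfolding tanh_def sinh_diff by (simp add: field_simps)
qed

lemma one_minus_tanh_le:
  assumes "0 \<le> z"
  shows "1 - tanh z \<le> 2 * exp (- z :: real)"
proof -
  have "1 - tanh z = exp (- z) / cosh z"
    using cosh_real_ge_1[of z] cosh_minus_sinh[of z] unfolding tanh_def by (simp add: field_simps)
  also have "\<dots> \<le> exp (- z) / 1" using cosh_real_ge_1[of z] by (intro divide_left_mono) auto
  finally have "1 - tanh z \<le> exp (- z)" by simp
  then show ?thesis using exp_gt_zero[of "- z"] by linarith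
qed

text \<open>
  The differences of two translates of a rescaled hyperbolic tangent are Schwartz functions
  and approximate the indicator function of an interval.
\<close>

definition plateau :: "real \<Rightarrow> real \<Rightarrow> nat \<Rightarrow> real \<Rightarrow> real" where
  "plateau a b n x = tanh (real (Suc n) * (x - a)) - tanh (real (Suc n) * (x - b))"

lemma schwartz_plateau: "schwartz (\<lambda>x. of_real (plateau a b n x))"
proof -
  let ?k = "real (Suc n)"
  have "of_real (plateau a b n x) =
      of_real (sinh (?k * (b - a))) * (sech_weight ?k a 1 x * sech_weight ?k b 1 x)" for x
    unfolding plateau_def tanh_diff sech_weight_def by (simp add: algebra_simps)
  then show ?thesis
    by (simp only:)
      (intro slow_mult_schwartz slow_const schwartz_mult_slow schwartz_slow schwartz_sech_weight, auto)
qed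

text \<open>
  The bound does not depend on \<open>n\<close> and decays exponentially; it serves as the majorant in the passage
  to the limit.
\<close>

lemma plateau_le:
  assumes "a < b"
  shows "\<bar>plateau a b n x\<bar> \<le> 2 * exp (\<bar>a\<bar> + \<bar>b\<bar>) * (1 / cosh x)"
proof -
  let ?k = "real (Suc n)"
  have "?k * (x - b) \<le> ?k * (x - a)" using assms by (intro mult_left_mono) auto
  then have "0 \<le> plateau a b n x" unfolding plateau_def by simp
  have "plateau a b n x \<le> 2 * exp (\<bar>a\<bar> + \<bar>b\<bar> - \<bar>x\<bar>)"
  proof -
    have l: "plateau a b n x \<le> 1 - tanh (?k * (x - b))" "plateau a b n x \<le> 1 - tanh (- (?k * (x - a)))"
      unfolding plateau_def
      using tanh_real_bounds[of "?k * (x - a)"] tanh_real_bounds[of "?k * (x - b)"] by auto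
    consider "x \<ge> b" | "x \<le> a" | "a < x" "x < b" by linarith
    then show ?thesis
    proof cases
      case 1
      then have z: "x - b \<le> ?k * (x - b)" using mult_right_mono[of 1 ?k "x - b"] by simp
      have "1 - tanh (?k * (x - b)) \<le> 2 * exp (- (?k * (x - b)))" using 1 by (intro one_minus_tanh_le) auto
      also have "\<dots> \<le> 2 * exp (- (x - b))" using z by simp
      also have "\<dots> \<le> 2 * exp (\<bar>a\<bar> + \<bar>b\<bar> - \<bar>x\<bar>)" using 1 by simp
      finally show ?thesis using l(1) by linarith
    next
      case 2
      then have z: "a - x \<le> - (?k * (x - a))"
        using mult_right_mono[of 1 ?k "a - x"] by (simp add: algebra_simps)
      have "1 - tanh (- (?k * (x - a))) \<le> 2 * exp (- (- (?k * (x - a))))"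
        using 2 by (intro one_minus_tanh_le) (auto simp: mult_nonneg_nonpos)
      also have "\<dots> \<le> 2 * exp (- (a - x))" using z by simp
      also have "\<dots> \<le> 2 * exp (\<bar>a\<bar> + \<bar>b\<bar> - \<bar>x\<bar>)" using 2 by simp
      finally show ?thesis using l(2) by linarith
    next
      case 3
      have "plateau a b n x \<le> 2" unfolding plateau_def
        using tanh_real_bounds[of "?k * (x - a)"] tanh_real_bounds[of "?k * (x - b)"] by auto
      also have "2 \<le> 2 * exp (\<bar>a\<bar> + \<bar>b\<bar> - \<bar>x\<bar>)" using 3 by simp
      finally show ?thesis .
    qed
  qed
  also have "exp (\<bar>a\<bar> + \<bar>b\<bar> - \<bar>x\<bar>) = exp (\<bar>a\<bar> + \<bar>b\<bar>) * exp (- \<bar>x\<bar>)"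
    by (simp add: exp_diff exp_minus divide_inverse)
  also have "exp (- \<bar>x\<bar>) \<le> 1 / cosh x"
  proof -
    have "cosh x \<le> exp \<bar>x\<bar>" unfolding cosh_def by (cases "0 \<le> x") auto
    then have "1 / exp \<bar>x\<bar> \<le> 1 / cosh x" using cosh_real_ge_1[of x] by (intro divide_left_mono) auto
    then show ?thesis by (simp add: exp_minus inverse_eq_divide)
  qed
  finally show ?thesis using \<open>0 \<le> plateau a b n x\<close> by simp
qed

lemma plateau_tendsto:
  assumes "a < b" "x \<noteq> a" "x \<noteq> b"
  shows "(\<lambda>n. plateau a b n x) \<longlonglongrightarrow> 2 * indicator {a<..<b} x"
proof -
  have lim: "filterlim (\<lambda>n. real (Suc n)) at_top sequentially"
    by (rule filterlim_compose[OF filterlim_real_sequentially filterlim_Suc])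
  have *: "(\<lambda>n. tanh (real (Suc n) * z)) \<longlonglongrightarrow> sgn z" if "z \<noteq> 0" for z :: real
  proof (cases "z > 0")
    case True
    have "filterlim (\<lambda>n. real (Suc n) * z) at_top sequentially"
      using True by (intro filterlim_at_top_mult_tendsto_pos[OF tendsto_const])
        (simp_all add: lim del: of_nat_Suc)
    then show ?thesis using True by (auto intro: filterlim_compose[OF tanh_real_at_top])
  next
    case False
    then have "-z > 0" using that by simp
    then have "filterlim (\<lambda>n. real (Suc n) * (- z)) at_top sequentially"
      by (intro filterlim_at_top_mult_tendsto_pos[OF tendsto_const])
        (simp_all add: lim del: of_nat_Suc)
    then have "(\<lambda>n. tanh (real (Suc n) * (- z))) \<longlonglongrightarrow> 1"
      by (rule filterlim_compose[OF tanh_real_at_top])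
    from tendsto_minus[OF this] show ?thesis using \<open>-z > 0\<close> by simp
  qed
  have "(\<lambda>n. plateau a b n x) \<longlonglongrightarrow> sgn (x - a) - sgn (x - b)"
    unfolding plateau_def using assms by (intro tendsto_diff *) auto
  also have "sgn (x - a) - sgn (x - b) = 2 * indicator {a<..<b} x"
    using assms by (auto simp: indicator_def)
  finally show ?thesis .
qed

lemma interval_integral_zero_if_orthogonal:
  assumes h: "tempered h" and orth: "\<And>f. schwartz f \<Longrightarrow> (LINT x|lborel. h x * f x) = 0" and "a < b"
  shows "(LINT x|lborel. indicator {a<..<b} x * h x) = 0"
proof -
  have [measurable]: "h \<in> borel_measurable lborel" using h unfolding tempered_def by auto
  have pm [measurable]: "plateau a b n \<in> borel_measurable borel" for n
    unfolding plateau_def[abs_def]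
    by (intro borel_measurable_continuous_onI continuous_intros) (rule cosh_real_neq_0)+
  have "(\<lambda>n. LINT x|lborel. h x * of_real (plateau a b n x)) \<longlonglongrightarrow>
      (LINT x|lborel. 2 * (indicator {a<..<b} x * h x))"
  proof (rule integral_dominated_convergence[where
        w = "\<lambda>x. cmod (h x * (of_real (2 * exp (\<bar>a\<bar> + \<bar>b\<bar>)) * sech_weight 1 0 1 x))"])
    show "integrable lborel (\<lambda>x. cmod (h x * (of_real (2 * exp (\<bar>a\<bar> + \<bar>b\<bar>)) * sech_weight 1 0 1 x)))"
      by (intro integrable_norm integrable_tempered_schwartz h slow_mult_schwartz slow_const
          schwartz_sech_weight) auto
    show "AE x in lborel. (\<lambda>n. h x * of_real (plateau a b n x)) \<longlonglongrightarrow> 2 * (indicator {a<..<b} x * h x)"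
      using AE_lborel_singleton[of a] AE_lborel_singleton[of b]
    proof eventually_elim
      case (elim x)
      have "(\<lambda>n. h x * of_real (plateau a b n x)) \<longlonglongrightarrow> h x * of_real (2 * indicator {a<..<b} x)"
        using plateau_tendsto[OF \<open>a < b\<close>] elim by (intro tendsto_mult tendsto_const tendsto_of_real) auto
      then show ?case by (simp add: of_real_indicator mult.commute mult.left_commute mult.assoc)
    qed
    have "norm (h x * of_real (plateau a b n x)) \<le>
      cmod (h x * (of_real (2 * exp (\<bar>a\<bar> + \<bar>b\<bar>)) * sech_weight 1 0 1 x))" for n x
      unfolding norm_mult norm_of_real
      using plateau_le[OF \<open>a < b\<close>, of n x] by (intro mult_left_mono) (auto simp: sech_weight_def norm_divide)
    then show "AE x in lborel. norm (h x * of_real (plateau a b n x)) \<le>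
      cmod (h x * (of_real (2 * exp (\<bar>a\<bar> + \<bar>b\<bar>)) * sech_weight 1 0 1 x))" for n by simp
  qed measurable
  then have "(\<lambda>n. 0) \<longlonglongrightarrow> (LINT x|lborel. 2 * (indicator {a<..<b} x * h x))"
    using orth[OF schwartz_plateau] by simp
  then have "(LINT x|lborel. 2 * (indicator {a<..<b} x * h x)) = 0"
    using LIMSEQ_unique tendsto_const by blast
  then show ?thesis by simp
qed

text \<open>
  The open intervals are stable under intersection and generate the Borel sets.
\<close>

lemma AE_zero_if_interval_integrals_zero:
  fixes h :: "real \<Rightarrow> real"
  assumes h: "integrable lborel h" and zero: "\<And>a b. a < b \<Longrightarrow> (LINT x:{a<..<b}|lborel. h x) = 0"
  shows "AE x in lborel. h x = 0"
proof -
  have si: "set_integrable lborel A h" if "A \<in> sets borel" for A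
    unfolding set_integrable_def using that h by (intro integrable_mult_indicator) auto
  have "(LINT x:UNIV|lborel. h x) = 0"
  proof -
    have "(\<lambda>n. LINT x:{- real n<..<real n}|lborel. h x) \<longlonglongrightarrow> (LINT x:(\<Union>n. {- real n<..<real n})|lborel. h x)"
      by (rule set_integral_cont_up) (auto simp: incseq_def intro!: si)
    moreover have "(\<Union>n. {- real n<..<real n}) = UNIV"
    proof -
      have "\<exists>n. - real n < x \<and> x < real n" for x
      proof -
        obtain n where "\<bar>x\<bar> < real n" using reals_Archimedean2 by blast
        then show ?thesis by (intro exI[of _ n]) auto
      qed
      then show ?thesis by auto
    qed
    moreover have "(LINT x:{- real n<..<real n}|lborel. h x) = 0" for n
      using zero[of "- real n" "real n"] by (cases n) (auto simp: set_lebesgue_integral_def)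
    ultimately have "(\<lambda>n. 0) \<longlonglongrightarrow> (LINT x:UNIV|lborel. h x)" by simp
    then show ?thesis by (simp add: LIMSEQ_const_iff)
  qed
  have gen: "sets borel = sigma_sets UNIV (range (\<lambda>(a, b). {a<..<b::real}))"
    unfolding borel_eq_box by (simp add: case_prod_unfold)
  have "(LINT x:A|lborel. h x) = 0" if "A \<in> sets borel" for A
  proof -
    have "Int_stable (range (\<lambda>(a, b). {a<..<b::real}))"
      by (auto simp: Int_stable_def)
    moreover have "range (\<lambda>(a, b). {a<..<b::real}) \<subseteq> Pow UNIV" by simp
    moreover have "A \<in> sigma_sets UNIV (range (\<lambda>(a, b). {a<..<b::real}))"
      using that unfolding gen .
    ultimately show ?thesis
    proof (induction rule: sigma_sets_induct_disjoint)
      case (basic A)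
      then obtain a b where "A = {a<..<b}" by auto
      then show ?case
        using zero[of a b] by (cases "a < b") (auto simp: set_lebesgue_integral_def)
    next
      case empty
      show ?case by (simp add: set_lebesgue_integral_def)
    next
      case A: (compl A)
      then have [measurable]: "A \<in> sets borel" unfolding gen by simp
      have "(LINT x:A \<union> (UNIV - A)|lborel. h x) = (LINT x:A|lborel. h x) + (LINT x:UNIV - A|lborel. h x)"
        by (intro set_integral_Un si) auto
      then show ?case
        using A(2) \<open>(LINT x:UNIV|lborel. h x) = 0\<close> by simp
    next
      case A: (union A)
      then have [measurable]: "A i \<in> sets borel" for i unfolding gen by auto
      have "(LINT x:(\<Union>i. A i)|lborel. h x) = (\<Sum>i. LINT x:A i|lborel. h x)"
        using A(1) by (intro lebesgue_integral_countable_add si) (auto simp: disjoint_family_on_def)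
      then show ?case using A(3) by simp
    qed
  qed
  then show ?thesis
    using density_unique_real[of lborel h "\<lambda>x. 0"] h by (simp add: set_lebesgue_integral_def)
qed

text \<open>
  Smooth plateaus approximate the indicators of intervals, so the integral of \<open>h\<close> over every interval
  vanishes.
\<close>

lemma tempered_AE_zero:
  assumes h: "tempered h" and orth: "\<And>f. schwartz f \<Longrightarrow> (LINT x|lborel. h x * f x) = 0"
  shows "AE x in lborel. h x = 0"
proof -
  \<comment> \<open>multiplying by a positive Schwartz function makes the function integrable\<close>
  let ?w = "sech_weight 1 0 1"
  have w: "schwartz ?w" by (rule schwartz_sech_weight) simp
  define g where "g = (\<lambda>x. h x * ?w x)"
  have g: "integrable lborel g" unfolding g_def by (intro integrable_tempered_schwartz h w)
  have tg: "tempered g" unfolding g_def by (intro tempered_mult_slow h schwartz_slow w)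
  have "(LINT x|lborel. g x * f x) = 0" if "schwartz f" for f
    using orth[of "\<lambda>x. ?w x * f x"] that w unfolding g_def
    by (simp add: mult.assoc schwartz_mult_slow schwartz_slow)
  then have z: "(LINT x|lborel. indicator {a<..<b} x * g x) = 0" if "a < b" for a b
    using that by (intro interval_integral_zero_if_orthogonal tg)
  have gi: "integrable lborel (\<lambda>x. indicator {a<..<b} x * g x)" for a b
    by (rule tempered_imp_locally_integrable[OF tg, of _ "\<bar>a\<bar> + \<bar>b\<bar>"]) auto
  have "AE x in lborel. Re (g x) = 0"
  proof (rule AE_zero_if_interval_integrals_zero)
    fix a b :: real assume "a < b"
    have "(LINT x:{a<..<b}|lborel. Re (g x)) = (LINT x|lborel. Re (indicator {a<..<b} x * g x))"
      unfolding set_lebesgue_integral_def by (intro Bochner_Integration.integral_cong) (auto simp: indicator_def)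
    also have "\<dots> = 0" using z[OF \<open>a < b\<close>] integral_Re[OF gi[of a b]] by simp
    finally show "(LINT x:{a<..<b}|lborel. Re (g x)) = 0" .
  qed (intro integrable_Re g)
  moreover have "AE x in lborel. Im (g x) = 0"
  proof (rule AE_zero_if_interval_integrals_zero)
    fix a b :: real assume "a < b"
    have "(LINT x:{a<..<b}|lborel. Im (g x)) = (LINT x|lborel. Im (indicator {a<..<b} x * g x))"
      unfolding set_lebesgue_integral_def by (intro Bochner_Integration.integral_cong) (auto simp: indicator_def)
    also have "\<dots> = 0" using z[OF \<open>a < b\<close>] integral_Im[OF gi[of a b]] by simp
    finally show "(LINT x:{a<..<b}|lborel. Im (g x)) = 0" .
  qed (intro integrable_Im g)
  ultimately show ?thesis
  proof eventually_elim
    case (elim x)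
    then have "g x = 0" by (simp add: complex_eq_iff)
    moreover have "?w x \<noteq> 0" using cosh_real_ge_1[of x] by (auto simp: sech_weight_def)
    ultimately show ?case unfolding g_def by simp
  qed
qed

section \<open>Regularity of weak solutions\<close>

lemma cls_funpow_add:
  assumes "cls P f" "cls Q g"
  shows "Der k (\<lambda>x. f x + g x) = (\<lambda>x. Der k f x + Der k g x)"
proof (induction k)
  case (Suc k)
  have "Der k f differentiable (at x)" "Der k g differentiable (at x)" for x
    using assms by (blast intro: cls_differentiable cls_funpow_deriv)+
  then show ?case by (simp add: Suc.IH deriv_op_add)
qed simp

lemma cls_funpow_cmult:
  assumes "cls P f"
  shows "Der k (\<lambda>x. c * f x) = (\<lambda>x. c * Der k f x)"
proof (induction k)
  case (Suc k)
  have "Der k f differentiable (at x)" for x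
    using assms by (blast intro: cls_differentiable cls_funpow_deriv)
  then show ?case by (simp add: Suc.IH deriv_op_cmult)
qed simp

lemma reg_prim:
  assumes "reg poly_bounded j h"
  shows "reg poly_bounded (Suc j) (prim h)"
proof -
  have c: "continuous_on UNIV h" "poly_bounded h" using assms by (rule reg_continuous reg_bound)+
  have "tempered h" by (intro poly_bounded_imp_tempered c continuous_measurable)
  then have "poly_bounded (prim h)" by (rule poly_bounded_prim)
  then show ?thesis using assms reg_Suc_iff[of "prim h" h] has_vector_derivative_prim[OF c(1)] by blast
qed

lemma slow_prim: "slow h \<Longrightarrow> slow (prim h)"
  unfolding cls_def using reg_prim reg_SucD by blast

lemma deriv_op_prim: "continuous_on UNIV h \<Longrightarrow> deriv_op (prim h) = h"
  by (intro deriv_op_eq has_vector_derivative_prim)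

lemma tempered_prim: "tempered h \<Longrightarrow> tempered (prim h)"
  by (rule poly_bounded_imp_tempered[OF poly_bounded_prim continuous_measurable[OF continuous_on_prim]])

text \<open>
  A constant has iterated primitives of polynomial growth; they stand in for the monomials in the lemma
  of du Bois-Reymond.
\<close>

lemma slow_iterated_primitive: "\<exists>g. slow g \<and> Der k g = (\<lambda>x. c)"
proof (induction k)
  case 0
  show ?case using slow_const by auto
next
  case (Suc k)
  then obtain g where g: "slow g" "Der k g = (\<lambda>x. c)" by blast
  then have "slow (prim g)" "Der (Suc k) (prim g) = (\<lambda>x. c)"
    by (auto intro: slow_prim simp: funpow_swap1 deriv_op_prim cls_continuous)
  then show ?case by blast
qed

lemma schwartz_nonzero_mean:   "\<exists>f. schwartz f \<and> (LINT x|lborel. f x) \<noteq> 0"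
proof (rule ccontr)
  assume "\<not> ?thesis"
  then have "AE x in lborel. (\<lambda>x::real. 1::complex) x = 0"
    using tempered_AE_zero[OF slow_imp_tempered[OF slow_const[of 1]]] by auto
  then have "AE x in (lborel :: real measure). False" by simp
  then show False by (simp add: eventually_False ae_filter_eq_bot_iff)
qed

text \<open>
  The lemma of du Bois-Reymond. Every Schwartz function differs from the derivative of a Schwartz
  function by a multiple of one fixed \<open>\<psi>\<close> with nonzero mean. Hence \<open>f \<mapsto> \<integral> h * Der M f\<close> is a multiple
  of the integral of \<open>f\<close>, and so is the same functional for an \<open>M\<close>-fold primitive of a constant;
  subtracting this primitive lowers the order. Only the growth of the resulting function matters
  later, which is why it is not identified as a polynomial.
\<close>

lemma orthogonal_to_derivatives_imp_slow:
  assumes "tempered h" and "\<And>f. schwartz f \<Longrightarrow> (LINT x|lborel. h x * Der M f x) = 0"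
  shows "\<exists>q. slow q \<and> (AE x in lborel. h x = q x)"
  using assms
proof (induction M arbitrary: h)
  case 0
  then have "AE x in lborel. h x = 0" by (intro tempered_AE_zero) auto
  then show ?case using slow_const by blast
next
  case (Suc M)
  obtain \<psi> where \<psi>: "schwartz \<psi>" "(LINT x|lborel. \<psi> x) \<noteq> 0"
    using schwartz_nonzero_mean by blast
  define c where "c = (LINT x|lborel. h x * Der M \<psi> x) / (LINT x|lborel. \<psi> x)"
  have hf: "(LINT x|lborel. h x * Der M f x) = c * (LINT x|lborel. f x)" if f: "schwartz f" for f
  proof -
    \<comment> \<open>the multiple of \<open>\<psi>\<close> that cancels the mean of \<open>f\<close>\<close>
    define k where "k = - (LINT x|lborel. f x) / (LINT x|lborel. \<psi> x)"
    have k\<psi>: "schwartz (\<lambda>x. k * \<psi> x)" by (intro slow_mult_schwartz slow_const \<psi>)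
    have "(LINT x|lborel. f x + k * \<psi> x) = (LINT x|lborel. f x) + k * (LINT x|lborel. \<psi> x)"
      using f k\<psi> by (subst Bochner_Integration.integral_add) (auto intro: schwartz_integrable)
    also have "\<dots> = 0" unfolding k_def using \<psi>(2) by simp
    finally obtain F where F: "schwartz F" "deriv_op F = (\<lambda>x. f x + k * \<psi> x)"
      using schwartz_primitive[OF schwartz_add[OF f k\<psi>]] by blast
    have D: "Der (Suc M) F = (\<lambda>x. Der M f x + k * Der M \<psi> x)"
      by (simp add: funpow_swap1 F(2) cls_funpow_add[OF f k\<psi>] cls_funpow_cmult[OF \<psi>(1)])
    have "0 = (LINT x|lborel. h x * Der (Suc M) F x)" using Suc.prems(2)[OF F(1)] by simp
    also have "\<dots> = (LINT x|lborel. h x * Der M f x + k * (h x * Der M \<psi> x))"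
      unfolding D by (simp add: algebra_simps)
    also have "\<dots> = (LINT x|lborel. h x * Der M f x) + k * (LINT x|lborel. h x * Der M \<psi> x)"
      using Suc.prems(1) f \<psi>(1)
      by (subst Bochner_Integration.integral_add)
        (auto intro!: integrable_mult_right integrable_tempered_schwartz cls_funpow_deriv
          simp del: integrable_mult_right_iff)
    finally show ?thesis unfolding c_def k_def using \<psi>(2) by (simp add: field_simps eq_neg_iff_add_eq_0)
  qed
  obtain g where g: "slow g" "Der M g = (\<lambda>x. (-1) ^ M * c)"
    using slow_iterated_primitive by blast
  have "(LINT x|lborel. (h x - g x) * Der M f x) = 0" if f: "schwartz f" for f
  proof -
    have "(LINT x|lborel. g x * Der M f x) = (-1) ^ M * (LINT x|lborel. f x * ((-1) ^ M * c))"
      using integral_by_parts_funpow[OF f g(1), of M] g(2) by (simp add: mult.commute)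
    also have "\<dots> = ((-1) ^ M * (-1) ^ M) * (c * (LINT x|lborel. f x))"
      by (simp only: integral_mult_left_zero) (simp add: algebra_simps)
    also have "(-1) ^ M * (-1) ^ M = (1::complex)" by (simp flip: power_mult_distrib)
    finally have gf: "(LINT x|lborel. g x * Der M f x) = c * (LINT x|lborel. f x)" by simp
    have "(LINT x|lborel. (h x - g x) * Der M f x) =
        (LINT x|lborel. h x * Der M f x) - (LINT x|lborel. g x * Der M f x)"
      unfolding left_diff_distrib
      by (intro Bochner_Integration.integral_diff integrable_tempered_schwartz cls_funpow_deriv f
          Suc.prems(1) slow_imp_tempered[OF g(1)])
    then show ?thesis using hf[OF f] gf by simp
  qed
  then obtain q where q: "slow q" "AE x in lborel. h x - g x = q x"
    using Suc.IH[of "\<lambda>x. h x - g x"] tempered_diff[OF Suc.prems(1) slow_imp_tempered[OF g(1)]] by blast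
  from q(2) have "AE x in lborel. h x = q x + g x" by eventually_elim (simp add: algebra_simps)
  then show ?case using slow_add[OF q(1) g(1)] by blast
qed

text \<open>
  Moving the lower order terms up, one derivative at a time, gathers a whole differential expression
  at its derivative of highest order. This function is the factor that ends up there.
\<close>

primrec collect :: "(nat \<Rightarrow> real poly) \<Rightarrow> (real \<Rightarrow> complex) \<Rightarrow> nat \<Rightarrow> real \<Rightarrow> complex" where
  "collect a u 0 = (\<lambda>x. of_real (poly (a 0) x) * u x)"
| "collect a u (Suc k) = (\<lambda>x. of_real (poly (a (Suc k)) x) * u x - prim (collect a u k) x)"

lemma tempered_poly_mult: "tempered u \<Longrightarrow> tempered (\<lambda>x. of_real (poly p x) * u x)"
  using tempered_mult_slow[OF _ slow_poly, of u p] by (simp add: mult.commute)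

lemma tempered_collect: "tempered u \<Longrightarrow> tempered (collect a u k)"
  by (induction k) (auto intro: tempered_diff tempered_prim tempered_poly_mult)

lemma integral_collect:
  assumes u: "tempered u" and f: "schwartz f"
  shows "(LINT x|lborel. collect a u k x * Der k f x) =
    (\<Sum>j\<le>k. LINT x|lborel. u x * (of_real (poly (a j) x) * Der j f x))"
proof (induction k)
  case 0
  show ?case by (simp add: mult_ac)
next
  case (Suc k)
  have "(LINT x|lborel. collect a u (Suc k) x * Der (Suc k) f x) =
      (LINT x|lborel. (of_real (poly (a (Suc k)) x) * u x) * Der (Suc k) f x
        - prim (collect a u k) x * deriv_op (Der k f) x)"
    by (simp add: left_diff_distrib)
  also have "\<dots> = (LINT x|lborel. (of_real (poly (a (Suc k)) x) * u x) * Der (Suc k) f x)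
      - (LINT x|lborel. prim (collect a u k) x * deriv_op (Der k f) x)"
    by (intro Bochner_Integration.integral_diff integrable_tempered_schwartz tempered_poly_mult
        tempered_prim tempered_collect u cls_deriv cls_funpow_deriv f)
  also have "(LINT x|lborel. prim (collect a u k) x * deriv_op (Der k f) x) =
      - (LINT x|lborel. collect a u k x * Der k f x)"
    by (intro integral_prim tempered_collect u cls_funpow_deriv f)
  finally show ?case using Suc.IH by (simp add: mult_ac add.commute)
qed

lemma collect_cong_AE:
  assumes "tempered u" "tempered v" "AE x in lborel. u x = v x"
  shows "AE x in lborel. collect a u k x = collect a v k x"
proof (induction k)
  case 0
  from assms(3) show ?case by eventually_elim simp
next
  case (Suc k)
  then have "prim (collect a u k) = prim (collect a v k)"
    using assms by (intro prim_cong_AE tempered_collect)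
  with assms(3) show ?case by (auto elim!: eventually_mono)
qed

lemma reg_collect:
  assumes u: "reg poly_bounded j u"
  shows "reg poly_bounded j (collect a u k)"
proof -
  have pm: "reg poly_bounded j (\<lambda>x. f x * g x)"
    if "reg poly_bounded j f" "reg poly_bounded j g" for f g
    using that by (intro reg_mult[of poly_bounded poly_bounded poly_bounded])
      (auto intro: poly_bounded_add poly_bounded_mult)
  have s: "reg poly_bounded j f" if "slow f" for f using that unfolding cls_def by blast
  show ?thesis
  proof (induction k)
    case 0
    show ?case unfolding collect.simps by (intro pm s slow_poly u)
  next
    case (Suc k)
    have "reg poly_bounded j (\<lambda>x. of_real (poly (a (Suc k)) x) * u x + (- 1) * prim (collect a u k) x)"
      by (intro reg_add pm s slow_poly slow_const u reg_SucD[OF reg_prim] Suc.IH poly_bounded_add)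
    then show ?case by simp
  qed
qed

text \<open>
  By the lemma of du Bois-Reymond \<open>a M * u\<close> equals a function of polynomial growth plus a primitive of
  an expression in \<open>u\<close>. Since \<open>a M\<close> is bounded away from zero, this can be divided by \<open>a M\<close>, and it
  yields one more derivative of \<open>u\<close> on each use.
\<close>

theorem weak_solution_slow:
  assumes u: "tempered u"
    and \<epsilon>: "\<epsilon> > 0" "\<And>x. \<epsilon> \<le> poly p x" and top: "a M = smult s p" "s \<noteq> 0"
    and weak: "\<And>f. schwartz f \<Longrightarrow>
      (LINT x|lborel. u x * (\<Sum>j\<le>M. of_real (poly (a j) x) * Der j f x)) = 0"
  shows "\<exists>v. slow v \<and> (AE x in lborel. u x = v x)"
proof -
  have pos: "poly p x \<noteq> 0" for x using \<epsilon>(1) \<epsilon>(2)[of x] by linarith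
  define r where "r = (\<lambda>x. complex_of_real (1 / s) * of_real (1 / poly p x))"
  have r: "slow r" unfolding r_def by (intro slow_mult slow_const slow_inverse_poly[OF \<epsilon>])
  have rp: "r x * of_real (poly (a M) x) = 1" for x
    unfolding r_def top using top(2) pos by simp
  have "(LINT x|lborel. collect a u M x * Der M f x) = 0" if f: "schwartz f" for f
  proof -
    have "(LINT x|lborel. collect a u M x * Der M f x) =
        (LINT x|lborel. (\<Sum>j\<le>M. u x * (of_real (poly (a j) x) * Der j f x)))"
      unfolding integral_collect[OF u f]
      by (rule Bochner_Integration.integral_sum[symmetric])
        (intro integrable_tempered_schwartz u slow_mult_schwartz slow_poly cls_funpow_deriv f)
    then show ?thesis using weak[OF f] by (simp add: sum_distrib_left)
  qed
  then obtain q where q: "slow q" "AE x in lborel. collect a u M x = q x"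
    using orthogonal_to_derivatives_imp_slow[OF tempered_collect[OF u]] by blast
  show ?thesis
  proof (cases M)
    case 0
    from q(2) have "AE x in lborel. u x = r x * q x"
    proof eventually_elim
      case (elim x)
      then have "r x * q x = (r x * of_real (poly (a M) x)) * u x" using 0 by (simp add: mult.assoc)
      then show ?case unfolding rp by simp
    qed
    then show ?thesis using slow_mult[OF r q(1)] by blast
  next
    case (Suc K)
    define v where "v = (\<lambda>x. r x * (q x + prim (collect a u K) x))"
    from q(2) have uv: "AE x in lborel. u x = v x"
    proof eventually_elim
      case (elim x)
      then have "q x + prim (collect a u K) x = of_real (poly (a M) x) * u x"
        using Suc by (simp add: algebra_simps)
      then have "v x = (r x * of_real (poly (a M) x)) * u x"
        unfolding v_def by (simp add: mult.assoc)
      then show ?case unfolding rp by simp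
    qed
    have tv: "tempered v"
    proof -
      have "tempered (\<lambda>x. (q x + prim (collect a u K) x) * r x)"
        by (intro tempered_mult_slow r tempered_add slow_imp_tempered q tempered_prim tempered_collect u)
      then show ?thesis unfolding v_def by (simp add: mult.commute)
    qed
    \<comment> \<open>the equation expresses v through a primitive of itself, so that each derivative gains another\<close>
    have "prim (collect a u K) = prim (collect a v K)"
      by (intro prim_cong_AE tempered_collect u tv collect_cong_AE uv)
    then have v: "v = (\<lambda>x. r x * (q x + prim (collect a v K) x))" unfolding v_def by simp
    have pm: "reg poly_bounded j (\<lambda>x. r x * (q x + g x))" if "reg poly_bounded j g" for j g
      using r q(1) that unfolding cls_def
      by (intro reg_mult[of poly_bounded poly_bounded poly_bounded] reg_add)
        (auto intro: poly_bounded_add poly_bounded_mult)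
    have "reg poly_bounded j v" for j
    proof (induction j)
      case 0
      show ?case
        by (subst v, rule pm)
          (simp add: continuous_on_prim poly_bounded_prim tempered_collect tv)
    next
      case (Suc j)
      then show ?case
        by (subst v) (intro pm reg_prim reg_collect)
    qed
    then have "slow v" unfolding cls_def by blast
    with uv show ?thesis by blast
  qed
qed

section \<open>Differential operators with polynomial coefficients\<close>

text \<open>
  The expanded form \<open>\<Sum>k\<le>M. a k * Der k\<close> is what the regularity theorem takes as input. Of the
  coefficients only the leading one has to be known.
\<close>

definition expands :: "nat \<Rightarrow> real poly \<Rightarrow> ((real \<Rightarrow> complex) \<Rightarrow> real \<Rightarrow> complex) \<Rightarrow> bool" where
  "expands M c A \<longleftrightarrow> (\<exists>a. a M = c \<and>
     (\<forall>f. slow f \<longrightarrow> A f = (\<lambda>x. \<Sum>k\<le>M. of_real (poly (a k) x) * Der k f x)))"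

lemma slow_sum:
  assumes "finite S" "\<And>i. i \<in> S \<Longrightarrow> slow (f i)"
  shows "slow (\<lambda>x. \<Sum>i\<in>S. f i x)"
  using assms by (induction S rule: finite_induct) (auto intro: slow_add slow_const)

lemma has_vector_derivative_of_real_poly_mult:
  assumes "slow f"
  shows "((\<lambda>x. of_real (poly p x) * f x) has_vector_derivative
    of_real (poly (pderiv p) x) * f x + of_real (poly p x) * deriv_op f x) (at x)"
proof -
  have "((\<lambda>x. of_real (poly p x) * f x) has_vector_derivative
    of_real (poly p x) * deriv_op f x + of_real (poly (pderiv p) x) * f x) (at x)"
    by (intro has_vector_derivative_mult has_vector_derivative_of_real_poly cls_has_deriv[OF assms])
  then show ?thesis by (simp add: add.commute)
qed

lemma expands_id: "expands 0 1 (\<lambda>f. f)"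
  unfolding expands_def by (intro exI[of _ "\<lambda>k. 1"]) simp

lemma expands_mult:
  assumes "expands M c A"
  shows "expands M (p * c) (\<lambda>f x. of_real (poly p x) * A f x)"
proof -
  obtain a where "a M = c"
    "\<And>f. slow f \<Longrightarrow> A f = (\<lambda>x. \<Sum>k\<le>M. of_real (poly (a k) x) * Der k f x)"
    using assms unfolding expands_def by blast
  then show ?thesis unfolding expands_def
    by (intro exI[of _ "\<lambda>k. p * a k"]) (auto simp: sum_distrib_left mult.assoc)
qed

lemma expands_add_lower:
  assumes A: "expands M c A" and B: "expands N d B" and "N < M"
  shows "expands M c (\<lambda>f x. B f x + A f x)"
proof -
  obtain a where a: "a M = c"
    "\<And>f. slow f \<Longrightarrow> A f = (\<lambda>x. \<Sum>k\<le>M. of_real (poly (a k) x) * Der k f x)"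
    using A unfolding expands_def by blast
  obtain b where b: "\<And>f. slow f \<Longrightarrow> B f = (\<lambda>x. \<Sum>k\<le>N. of_real (poly (b k) x) * Der k f x)"
    using B unfolding expands_def by blast
  define e where "e k = (if k \<le> N then b k else 0) + a k" for k
  have "e M = c" unfolding e_def using a(1) \<open>N < M\<close> by simp
  moreover have "(\<lambda>x. B f x + A f x) = (\<lambda>x. \<Sum>k\<le>M. of_real (poly (e k) x) * Der k f x)"
    if f: "slow f" for f
  proof
    fix x
    have "(\<Sum>k\<le>N. of_real (poly (b k) x) * Der k f x) =
        (\<Sum>k\<le>M. of_real (poly (if k \<le> N then b k else 0) x) * Der k f x)"
      using \<open>N < M\<close> by (intro sum.mono_neutral_cong_left) auto
    then show "B f x + A f x = (\<Sum>k\<le>M. of_real (poly (e k) x) * Der k f x)"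
      unfolding a(2)[OF f] b[OF f] e_def by (simp add: distrib_right sum.distrib)
  qed
  ultimately show ?thesis unfolding expands_def by blast
qed

lemma expands_deriv:
  assumes "expands M c A"
  shows "expands (Suc M) c (\<lambda>f. deriv_op (A f))"
proof -
  obtain a where a: "a M = c"
    "\<And>f. slow f \<Longrightarrow> A f = (\<lambda>x. \<Sum>k\<le>M. of_real (poly (a k) x) * Der k f x)"
    using assms unfolding expands_def by blast
  define e where "e k = (if k \<le> M then pderiv (a k) else 0) + (case k of 0 \<Rightarrow> 0 | Suc j \<Rightarrow> a j)" for k
  have "e (Suc M) = c" unfolding e_def using a(1) by simp
  moreover have "deriv_op (A f) = (\<lambda>x. \<Sum>k\<le>Suc M. of_real (poly (e k) x) * Der k f x)"
    if f: "slow f" for f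
  proof (rule deriv_op_eq)
    fix x
    let ?D = "\<lambda>k. Der k f x"
    have "(A f has_vector_derivative
        (\<Sum>k\<le>M. of_real (poly (pderiv (a k)) x) * ?D k + of_real (poly (a k) x) * ?D (Suc k))) (at x)"
      unfolding a(2)[OF f] funpow.simps comp_apply
      by (intro has_vector_derivative_sum has_vector_derivative_of_real_poly_mult cls_funpow_deriv f)
    also have "(\<Sum>k\<le>M. of_real (poly (pderiv (a k)) x) * ?D k + of_real (poly (a k) x) * ?D (Suc k))
       = (\<Sum>k\<le>Suc M. of_real (poly (if k \<le> M then pderiv (a k) else 0) x) * ?D k)
       + (\<Sum>k\<le>Suc M. of_real (poly (case k of 0 \<Rightarrow> 0 | Suc j \<Rightarrow> a j) x) * ?D k)"
    proof -
      have "(\<Sum>k\<le>Suc M. of_real (poly (case k of 0 \<Rightarrow> 0 | Suc j \<Rightarrow> a j) x) * ?D k) =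
          (\<Sum>k\<le>M. of_real (poly (a k) x) * ?D (Suc k))"
        by (subst sum.atMost_Suc_shift) simp
      then show ?thesis by (simp add: sum.distrib del: funpow.simps sum.atMost_Suc)
          (simp del: funpow.simps)
    qed
    also have "\<dots> = (\<Sum>k\<le>Suc M. of_real (poly (e k) x) * ?D k)"
      unfolding e_def by (simp only: sum.distrib[symmetric] poly_add of_real_add distrib_right)
    finally show "(A f has_vector_derivative (\<Sum>k\<le>Suc M. of_real (poly (e k) x) * ?D k)) (at x)" .
  qed
  ultimately show ?thesis unfolding expands_def by blast
qed

lemma expands_funpow_deriv:
  "expands M c A \<Longrightarrow> expands (M + l) c (\<lambda>f. Der l (A f))"
  by (induction l) (auto dest: expands_deriv)

lemma diff_op_0: "diff_op 0 b f = (\<lambda>x. of_real (poly (b 0) x) * f x)"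
  by (simp add: diff_op_def)

lemma diff_op_Suc: "diff_op (Suc m) b f = (\<lambda>x. diff_op m b f x +
   (-1) ^ Suc m * Der (Suc m) (\<lambda>y. of_real (poly (b (Suc m)) y) * Der (Suc m) f y) x)"
  by (simp add: diff_op_def)

lemma expands_diff_op:
  assumes "expands M c A"
  shows "expands (M + 2 * m) (smult ((-1) ^ m) (b m) * c) (\<lambda>f. diff_op m b (A f))"
proof (induction m)
  case 0
  show ?case using expands_mult[OF assms] by (simp add: diff_op_0)
next
  case (Suc m)
  let ?T = "\<lambda>f x. of_real (poly [:(-1) ^ Suc m:] x) *
    Der (Suc m) (\<lambda>y. of_real (poly (b (Suc m)) y) * Der (Suc m) (A f) y) x"
  have "expands (M + Suc m + Suc m) ([:(-1) ^ Suc m:] * (b (Suc m) * c)) ?T"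
    by (intro expands_mult expands_funpow_deriv assms)
  moreover have "M + Suc m + Suc m = M + 2 * Suc m" by simp
  moreover have "[:(-1) ^ Suc m:] * (b (Suc m) * c) = smult ((-1) ^ Suc m) (b (Suc m)) * c" by simp
  ultimately have "expands (M + 2 * Suc m) (smult ((-1) ^ Suc m) (b (Suc m)) * c) ?T" by (simp only:)
  then have "expands (M + 2 * Suc m) (smult ((-1) ^ Suc m) (b (Suc m)) * c)
      (\<lambda>f x. diff_op m b (A f) x + ?T f x)"
    using Suc by (rule expands_add_lower) simp
  then show ?case unfolding diff_op_Suc by simp
qed

lemma expands_diff_op_power:
  "expands (2 * m * n) (smult (((-1) ^ m) ^ n) (b m ^ n)) (diff_op m b ^^ n)"
proof (induction n)
  case 0
  have "(diff_op m b ^^ 0) = (\<lambda>f. f)" by auto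
  then show ?case using expands_id by (simp add: id_def one_pCons)
next
  case (Suc n)
  from expands_diff_op[OF this, of m b] show ?case
    by (simp add: comp_def algebra_simps)
qed

lemma slow_diff_op: "slow f \<Longrightarrow> slow (diff_op m b f)"
proof (induction m)
  case 0
  then show ?case by (auto simp: diff_op_0 intro: slow_mult slow_poly)
next
  case (Suc m)
  then show ?case unfolding diff_op_Suc
    by (intro slow_add slow_mult[OF slow_const] slow_mult[OF slow_poly] cls_funpow_deriv) auto
qed

lemma schwartz_diff_op: "schwartz f \<Longrightarrow> schwartz (diff_op m b f)"
proof (induction m)
  case 0
  then show ?case by (auto simp: diff_op_0 intro: slow_mult_schwartz slow_poly)
next
  case (Suc m)
  then show ?case unfolding diff_op_Suc
    by (intro schwartz_add slow_mult_schwartz[OF slow_const] slow_mult_schwartz[OF slow_poly]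
        cls_funpow_deriv) auto
qed

lemma slow_diff_op_power: "slow f \<Longrightarrow> slow ((diff_op m b ^^ n) f)"
  by (induction n) (auto intro: slow_diff_op)

lemma schwartz_diff_op_power: "schwartz f \<Longrightarrow> schwartz ((diff_op m b ^^ n) f)"
  by (induction n) (auto intro: schwartz_diff_op)

lemma funpow_deriv_cnj:
  assumes "slow f"
  shows "Der k (\<lambda>x. cnj (f x)) = (\<lambda>x. cnj (Der k f x))"
proof (induction k)
  case (Suc k)
  then show ?case
    using cls_differentiable[OF cls_funpow_deriv[OF assms]] by (simp add: deriv_op_cnj)
qed simp

lemma diff_op_cnj:
  assumes "slow f"
  shows "diff_op m b (\<lambda>x. cnj (f x)) = (\<lambda>x. cnj (diff_op m b f x))"
proof -
  have "Der l (\<lambda>y. of_real (poly (b l) y) * cnj (Der l f y)) =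
     (\<lambda>x. cnj (Der l (\<lambda>y. of_real (poly (b l) y) * Der l f y) x))" for l
    using funpow_deriv_cnj[of "\<lambda>y. of_real (poly (b l) y) * Der l f y" l]
    by (simp add: slow_mult slow_poly cls_funpow_deriv assms)
  then show ?thesis
    unfolding diff_op_def funpow_deriv_cnj[OF assms] by simp
qed

lemma diff_op_power_cnj:
  "slow f \<Longrightarrow> (diff_op m b ^^ n) (\<lambda>x. cnj (f x)) = (\<lambda>x. cnj ((diff_op m b ^^ n) f x))"
  by (induction n) (auto simp: diff_op_cnj slow_diff_op_power)

lemma diff_op_add:
  assumes "slow f" "slow g"
  shows "diff_op m b (\<lambda>x. f x + g x) = (\<lambda>x. diff_op m b f x + diff_op m b g x)"
proof -
  have "Der l (\<lambda>y. of_real (poly (b l) y) * Der l f y +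
        of_real (poly (b l) y) * Der l g y) =
     (\<lambda>x. Der l (\<lambda>y. of_real (poly (b l) y) * Der l f y) x +
        Der l (\<lambda>y. of_real (poly (b l) y) * Der l g y) x)" for l
    by (intro cls_funpow_add[of poly_bounded _ poly_bounded] slow_mult slow_poly cls_funpow_deriv assms)
  then show ?thesis
    unfolding diff_op_def cls_funpow_add[OF assms] distrib_left by (simp add: distrib_left sum.distrib)
qed

lemma diff_op_cmult:
  assumes "slow f"
  shows "diff_op m b (\<lambda>x. c * f x) = (\<lambda>x. c * diff_op m b f x)"
proof -
  have "Der l (\<lambda>y. of_real (poly (b l) y) * (c * Der l f y)) =
     (\<lambda>x. c * Der l (\<lambda>y. of_real (poly (b l) y) * Der l f y) x)" for l
    using cls_funpow_cmult[of poly_bounded "\<lambda>y. of_real (poly (b l) y) * Der l f y" l c]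
    by (simp add: slow_mult slow_poly cls_funpow_deriv assms mult.left_commute)
  then show ?thesis
    unfolding diff_op_def cls_funpow_cmult[OF assms] by (simp add: sum_distrib_left mult.left_commute)
qed

lemma diff_op_power_add:
  "slow f \<Longrightarrow> slow g \<Longrightarrow>
   (diff_op m b ^^ n) (\<lambda>x. f x + g x) = (\<lambda>x. (diff_op m b ^^ n) f x + (diff_op m b ^^ n) g x)"
  by (induction n) (auto simp: diff_op_add slow_diff_op_power)

lemma diff_op_power_cmult:
  "slow f \<Longrightarrow> (diff_op m b ^^ n) (\<lambda>x. c * f x) = (\<lambda>x. c * (diff_op m b ^^ n) f x)"
  by (induction n) (auto simp: diff_op_cmult slow_diff_op_power)

text \<open>
  The bilinear form of the operator is symmetric in \<open>f\<close> and \<open>v\<close>.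
\<close>

lemma integral_diff_op_mult:
  assumes f: "schwartz f" and v: "slow v"
  shows "(LINT x|lborel. diff_op m b f x * v x) =
    (\<Sum>l\<le>m. LINT x|lborel. of_real (poly (b l) x) * Der l f x * Der l v x)"
proof -
  let ?t = "\<lambda>l. \<lambda>y. of_real (poly (b l) y) * Der l f y"
  have t: "schwartz (?t l)" for l by (intro slow_mult_schwartz slow_poly cls_funpow_deriv f)
  have "(LINT x|lborel. diff_op m b f x * v x) =
      (LINT x|lborel. (\<Sum>l\<le>m. (-1) ^ l * (Der l (?t l) x * v x)))"
    unfolding diff_op_def by (simp add: sum_distrib_right mult.assoc)
  also have "\<dots> = (\<Sum>l\<le>m. LINT x|lborel. (-1) ^ l * (Der l (?t l) x * v x))"
    by (intro Bochner_Integration.integral_sum integrable_mult_right schwartz_integrable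
        schwartz_mult_slow cls_funpow_deriv t v)
  also have "\<dots> = (\<Sum>l\<le>m. (-1) ^ l * (-1) ^ l * (LINT x|lborel. ?t l x * Der l v x))"
    by (simp only: integral_mult_right_zero integral_by_parts_funpow[OF t v] mult.assoc)
  also have "\<dots> = (\<Sum>l\<le>m. LINT x|lborel. ?t l x * Der l v x)"
    by (simp flip: power_mult_distrib)
  finally show ?thesis by (simp add: mult.assoc)
qed

lemma integral_diff_op_swap:
  assumes f: "schwartz f" and v: "slow v"
  shows "(LINT x|lborel. diff_op m b f x * v x) = (LINT x|lborel. f x * diff_op m b v x)"
proof -
  let ?t = "\<lambda>l. \<lambda>y. of_real (poly (b l) y) * Der l v y"
  have t: "slow (?t l)" for l by (intro slow_mult slow_poly cls_funpow_deriv v)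
  have "(LINT x|lborel. f x * diff_op m b v x) =
      (LINT x|lborel. (\<Sum>l\<le>m. (-1) ^ l * (f x * Der l (?t l) x)))"
    unfolding diff_op_def by (simp add: sum_distrib_left mult.left_commute)
  also have "\<dots> = (\<Sum>l\<le>m. LINT x|lborel. (-1) ^ l * (f x * Der l (?t l) x))"
    by (intro Bochner_Integration.integral_sum integrable_mult_right schwartz_integrable
        schwartz_mult_slow cls_funpow_deriv t f)
  also have "\<dots> = (\<Sum>l\<le>m. LINT x|lborel. Der l f x * ?t l x)"
    by (simp only: integral_mult_right_zero integral_by_parts_funpow[OF f t])
  also have "\<dots> = (LINT x|lborel. diff_op m b f x * v x)"
    unfolding integral_diff_op_mult[OF f v] by (simp add: mult_ac)
  finally show ?thesis by simp
qed

lemma integral_diff_op_power_swap: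
  assumes "schwartz f" "slow v"
  shows "(LINT x|lborel. (diff_op m b ^^ n) f x * v x) = (LINT x|lborel. f x * (diff_op m b ^^ n) v x)"
  using assms
proof (induction n arbitrary: v)
  case (Suc n)
  have "(LINT x|lborel. (diff_op m b ^^ Suc n) f x * v x) =
      (LINT x|lborel. (diff_op m b ^^ n) f x * diff_op m b v x)"
    using Suc.prems by (simp add: integral_diff_op_swap schwartz_diff_op_power)
  then show ?case using Suc by (simp add: slow_diff_op funpow_swap1)
qed simp

section \<open>Weighted energy estimates\<close>

text \<open>
  The quotient of the polynomials has a limit at infinity by the comparison of degrees and is continuous
  in between. The degree condition of the theorem is used through this bound.
\<close>

lemma poly_dominated:
  fixes p q :: "real poly"
  assumes \<epsilon>: "\<epsilon> > 0" "\<And>x. \<epsilon> \<le> poly p x" and deg: "degree q \<le> degree p"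
  shows "\<exists>C\<ge>0. \<forall>x. \<bar>poly q x\<bar> \<le> C * poly p x"
proof -
  have pos: "poly p x > 0" for x using \<epsilon>(1) \<epsilon>(2)[of x] by linarith
  then have "p \<noteq> 0" by force
  have "\<exists>L. ((\<lambda>x. poly q x / poly p x) \<longlongrightarrow> L) at_infinity"
  proof (cases "degree q = degree p")
    case True
    have lim: "((\<lambda>x. (poly q x / x ^ degree q) / (poly p x / x ^ degree p)) \<longlongrightarrow> lead_coeff q / lead_coeff p) at_infinity"
      using \<open>p \<noteq> 0\<close> by (intro tendsto_divide poly_divide_tendsto_aux) auto
    have ev: "\<forall>\<^sub>F x in at_infinity. (poly q x / x ^ degree q) / (poly p x / x ^ degree p) = poly q x / poly p x"
      by (rule eventually_at_infinityI[of 1]) (auto simp: True)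
    show ?thesis using lim unfolding tendsto_cong[OF ev] by (rule exI)
  next
    case False
    then show ?thesis using poly_divide_tendsto_0_at_infinity[of q p] deg by auto
  qed
  then obtain L where "((\<lambda>x. poly q x / poly p x) \<longlongrightarrow> L) at_infinity" by blast
  then have "\<forall>\<^sub>F x in at_infinity. norm (poly q x / poly p x) < norm L + 1"
    by (intro order_tendstoD(2)[OF tendsto_norm]) auto
  then obtain r where r: "\<And>x. r \<le> norm x \<Longrightarrow> norm (poly q x / poly p x) < norm L + 1"
    unfolding eventually_at_infinity by blast
  have "compact ((\<lambda>x. poly q x / poly p x) ` {-\<bar>r\<bar>..\<bar>r\<bar>})"
    using pos by (intro compact_continuous_image continuous_intros) (auto simp: less_imp_neq[symmetric])
  then obtain B where B: "\<And>x. x \<in> {-\<bar>r\<bar>..\<bar>r\<bar>} \<Longrightarrow> norm (poly q x / poly p x) \<le> B"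
    using compact_imp_bounded[of "(\<lambda>x. poly q x / poly p x) ` {-\<bar>r\<bar>..\<bar>r\<bar>}"] unfolding bounded_iff by blast
  define C where "C = max B (norm L + 1)"
  have bound: "norm (poly q x / poly p x) \<le> C" for x
  proof (cases "r \<le> norm x")
    case True
    then show ?thesis using r[OF True] unfolding C_def by simp
  next
    case False
    then have "x \<in> {-\<bar>r\<bar>..\<bar>r\<bar>}" by auto
    then show ?thesis using B[of x] unfolding C_def by simp
  qed
  have "\<bar>poly q x\<bar> \<le> C * poly p x" for x using pos[of x] bound[of x] by (simp add: pos_divide_le_eq)
  moreover have "C \<ge> 0" unfolding C_def by simp
  ultimately show ?thesis by blast
qed

lemma norm_integral_le:
  fixes F :: "real \<Rightarrow> complex"
  assumes "integrable lborel F" "integrable lborel G" "\<And>x. cmod (F x) \<le> G x"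
  shows "cmod (LINT x|lborel. F x) \<le> (LINT x|lborel. G x)"
  using assms by (intro order_trans[OF integral_norm_bound] integral_mono integrable_norm)

definition energy :: "real \<Rightarrow> real poly \<Rightarrow> (real \<Rightarrow> complex) \<Rightarrow> real" where
  "energy \<delta> p g = (LINT x|lborel. poly p x / cosh (\<delta> * x) * (cmod (g x))\<^sup>2)"

lemma sech_weight_1: "sech_weight \<delta> 0 1 x = of_real (1 / cosh (\<delta> * x))"
  by (simp add: sech_weight_def)

lemma schwartz_energy_weight:
  "\<delta> \<noteq> 0 \<Longrightarrow> schwartz (\<lambda>x. of_real (poly p x / cosh (\<delta> * x)))"
  using slow_mult_schwartz[OF slow_poly[of p] schwartz_sech_weight[of \<delta> 0 1]]
  by (simp add: sech_weight_1)

lemma mult_cnj_eq: "z * cnj z = complex_of_real ((cmod z)\<^sup>2)"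
  by (rule complex_norm_square[symmetric])

lemma integrable_energy:
  assumes "\<delta> \<noteq> 0" "slow g"
  shows "integrable lborel (\<lambda>x. poly p x / cosh (\<delta> * x) * (cmod (g x))\<^sup>2)"
proof -
  have "schwartz (\<lambda>x. of_real (poly p x / cosh (\<delta> * x)) * (g x * cnj (g x)))"
    by (intro schwartz_mult_slow schwartz_energy_weight slow_mult slow_cnj assms)
  then have "integrable lborel (\<lambda>x. Re (of_real (poly p x / cosh (\<delta> * x)) * (g x * cnj (g x))))"
    by (intro integrable_Re schwartz_integrable)
  moreover have "Re (of_real (poly p x / cosh (\<delta> * x)) * (g x * cnj (g x))) =
      poly p x / cosh (\<delta> * x) * (cmod (g x))\<^sup>2" for x
    unfolding mult_cnj_eq of_real_mult[symmetric] Re_complex_of_real ..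
  ultimately show ?thesis by (simp only:)
qed

lemma energy_complex:
  "(LINT x|lborel. of_real (poly p x / cosh (\<delta> * x)) * (g x * cnj (g x))) = of_real (energy \<delta> p g)"
  unfolding energy_def mult_cnj_eq of_real_mult[symmetric] by (rule integral_complex_of_real)

lemma energy_nonneg:
  assumes "\<And>x. 0 \<le> poly p x"
  shows "0 \<le> energy \<delta> p g"
  unfolding energy_def using assms by (intro Bochner_Integration.integral_nonneg) auto

lemma energy_mono:
  assumes "\<delta> \<noteq> 0" "slow g" "\<And>x. poly p x \<le> C * poly q x"
  shows "energy \<delta> p g \<le> C * energy \<delta> q g"
proof -
  have "energy \<delta> p g \<le> (LINT x|lborel. C * (poly q x / cosh (\<delta> * x) * (cmod (g x))\<^sup>2))"
    unfolding energy_def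
  proof (intro integral_mono integrable_energy integrable_mult_right assms)
    show "poly p x / cosh (\<delta> * x) * (cmod (g x))\<^sup>2 \<le> C * (poly q x / cosh (\<delta> * x) * (cmod (g x))\<^sup>2)" for x
      using assms(3)[of x] mult_right_mono[OF assms(3)[of x], of "(cmod (g x))\<^sup>2 / cosh (\<delta> * x)"] by simp
  qed
  then show ?thesis unfolding energy_def by (simp only: integral_mult_right_zero)
qed

text \<open>
  Integrate by parts once and distribute the products by Cauchy's inequality. The weight
  \<open>p / cosh (\<delta> * x)\<close> changes slowly, its logarithmic derivative being at most \<open>C + 1\<close>, so the constants
  do not depend on \<open>\<delta>\<close>.
\<close>

lemma energy_interpolation_step:
  assumes \<delta>: "0 < \<delta>" "\<delta> \<le> 1" and p: "\<And>x. 0 \<le> poly p x" "\<And>x. \<bar>poly (pderiv p) x\<bar> \<le> C * poly p x"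
    and g: "slow g" and \<eta>: "\<eta> > 0"
  shows "energy \<delta> p (deriv_op g) \<le>
    \<eta> * energy \<delta> p (deriv_op (deriv_op g)) + ((C + 1)\<^sup>2 + 1 / \<eta>) * energy \<delta> p g"
proof -
  define \<rho> where "\<rho> x = poly p x / cosh (\<delta> * x)" for x
  define R where "R x = complex_of_real (\<rho> x)" for x
  have \<rho>: "0 \<le> \<rho> x" for x unfolding \<rho>_def using p(1)[of x] by simp
  have R: "schwartz R" unfolding R_def[abs_def] \<rho>_def using \<delta>(1) by (intro schwartz_energy_weight) auto
  have R': "cmod (deriv_op R x) \<le> (C + 1) * \<rho> x" for x
  proof -
    have "R = (\<lambda>x. of_real (poly p x) * sech_weight \<delta> 0 1 x)"
      unfolding R_def[abs_def] \<rho>_def sech_weight_1 by simp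
    moreover have "((\<lambda>x. of_real (poly p x) * sech_weight \<delta> 0 1 x) has_vector_derivative
       of_real (poly p x) * (of_real \<delta> * sech_weight \<delta> 0 (sech_step 1) x) +
       of_real (poly (pderiv p) x) * sech_weight \<delta> 0 1 x) (at x)" for x
      by (intro has_vector_derivative_mult has_vector_derivative_of_real_poly has_vector_derivative_sech_weight)
    ultimately have "deriv_op R = (\<lambda>x. of_real (poly p x) * (of_real \<delta> * sech_weight \<delta> 0 (sech_step 1) x) +
       of_real (poly (pderiv p) x) * sech_weight \<delta> 0 1 x)"
      by (intro deriv_op_eq) simp
    then have "deriv_op R x = of_real (poly p x / cosh (\<delta> * x) * (- \<delta> * tanh (\<delta> * x)) + poly (pderiv p) x / cosh (\<delta> * x))"
      by (simp add: sech_weight_def sech_step_def)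
    then have "cmod (deriv_op R x) = \<bar>\<rho> x * (- \<delta> * tanh (\<delta> * x)) + poly (pderiv p) x / cosh (\<delta> * x)\<bar>"
      by (simp only: norm_of_real \<rho>_def)
    also have "\<dots> \<le> \<rho> x * 1 + C * \<rho> x"
    proof (rule order_trans[OF abs_triangle_ineq add_mono])
      have "\<delta> * \<bar>tanh (\<delta> * x)\<bar> \<le> 1 * 1"
        using \<delta> tanh_real_bounds[of "\<delta> * x"] by (intro mult_mono) auto
      then show "\<bar>\<rho> x * (- \<delta> * tanh (\<delta> * x))\<bar> \<le> \<rho> x * 1"
        unfolding abs_mult using \<rho>[of x] \<delta>(1) by (intro mult_mono) (auto simp: abs_mult)
      have "\<bar>poly (pderiv p) x / cosh (\<delta> * x)\<bar> = \<bar>poly (pderiv p) x\<bar> / cosh (\<delta> * x)" by simp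
      also have "\<dots> \<le> C * poly p x / cosh (\<delta> * x)" using p(2)[of x] by (intro divide_right_mono) auto
      finally show "\<bar>poly (pderiv p) x / cosh (\<delta> * x)\<bar> \<le> C * \<rho> x" unfolding \<rho>_def by simp
    qed
    finally show ?thesis by (simp add: algebra_simps)
  qed
  define g1 g2 where "g1 = deriv_op g" and "g2 = deriv_op g1"
  have g12: "slow g1" "slow g2" unfolding g1_def g2_def by (intro cls_deriv g)+
  have en: "integrable lborel (\<lambda>x. \<rho> x * (cmod (f x))\<^sup>2)" if "slow f" for f
    unfolding \<rho>_def using \<delta>(1) that by (intro integrable_energy) auto
  define G where "G = (\<lambda>x. (1/2) * (\<rho> x * (cmod (g1 x))\<^sup>2) +
      ((\<eta>/2) * (\<rho> x * (cmod (g2 x))\<^sup>2) + (((C + 1)\<^sup>2 + 1 / \<eta>) / 2) * (\<rho> x * (cmod (g x))\<^sup>2)))"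
  have "of_real (energy \<delta> p g1) = (LINT x|lborel. (R x * g1 x) * deriv_op (\<lambda>x. cnj (g x)) x)"
    unfolding energy_complex[symmetric] R_def \<rho>_def g1_def
    by (simp add: deriv_op_cnj[OF cls_differentiable[OF g]] mult.assoc)
  also have "\<dots> = - (LINT x|lborel. deriv_op (\<lambda>x. R x * g1 x) x * cnj (g x))"
    using integral_by_parts[OF schwartz_mult_slow[OF R g12(1)] slow_cnj[OF g]] by simp
  finally have "cmod (of_real (energy \<delta> p g1)) = cmod (LINT x|lborel. deriv_op (\<lambda>x. R x * g1 x) x * cnj (g x))"
    by simp
  also have "\<dots> \<le> (LINT x|lborel. G x)"
  proof (rule norm_integral_le)
    show "integrable lborel (\<lambda>x. deriv_op (\<lambda>x. R x * g1 x) x * cnj (g x))"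
      by (intro schwartz_integrable schwartz_mult_slow cls_deriv slow_cnj g g12 R)
    show "integrable lborel G" unfolding G_def
      by (intro Bochner_Integration.integrable_add integrable_mult_right en g g12)
    fix x
    define s0 s1 s2 where "s0 = cmod (g x)" and "s1 = cmod (g1 x)" and "s2 = cmod (g2 x)"
    have "deriv_op (\<lambda>x. R x * g1 x) = (\<lambda>x. R x * g2 x + deriv_op R x * g1 x)"
      unfolding g2_def
      by (rule deriv_op_mult) (rule cls_differentiable[OF R], rule cls_differentiable[OF g12(1)])
    then have "cmod (deriv_op (\<lambda>x. R x * g1 x) x * cnj (g x)) = cmod (R x * g2 x + deriv_op R x * g1 x) * s0"
      by (simp add: norm_mult s0_def)
    also have "\<dots> \<le> (\<rho> x * s2 + (C + 1) * \<rho> x * s1) * s0"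
    proof (intro mult_right_mono norm_triangle_mono)
      show "cmod (R x * g2 x) \<le> \<rho> x * s2" using \<rho>[of x] by (simp add: norm_mult R_def s2_def)
      show "cmod (deriv_op R x * g1 x) \<le> (C + 1) * \<rho> x * s1"
        unfolding norm_mult s1_def by (intro mult_right_mono R') auto
    qed (simp add: s0_def)
    also have "\<dots> = \<rho> x * (s2 * s0 + s1 * ((C + 1) * s0))" by (simp add: algebra_simps)
    also have "\<dots> \<le> \<rho> x * ((\<eta> / 2 * s2\<^sup>2 + 1 / (2 * \<eta>) * s0\<^sup>2) + (s1\<^sup>2 / 2 + ((C + 1) * s0)\<^sup>2 / 2))"
    proof (intro mult_left_mono add_mono \<rho>)
      have "2 * (\<eta> * s2) * s0 \<le> (\<eta> * s2)\<^sup>2 + s0\<^sup>2" by (rule sum_squares_bound)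
      then show "s2 * s0 \<le> \<eta> / 2 * s2\<^sup>2 + 1 / (2 * \<eta>) * s0\<^sup>2"
        using \<eta> by (simp add: field_simps power2_eq_square)
      show "s1 * ((C + 1) * s0) \<le> s1\<^sup>2 / 2 + ((C + 1) * s0)\<^sup>2 / 2"
        using sum_squares_bound[of s1 "(C + 1) * s0"] by simp
    qed
    also have "\<dots> = (1/2) * (\<rho> x * s1\<^sup>2) + ((\<eta>/2) * (\<rho> x * s2\<^sup>2) + (((C + 1)\<^sup>2 + 1 / \<eta>) / 2) * (\<rho> x * s0\<^sup>2))"
      unfolding power_mult_distrib by (simp add: distrib_left distrib_right add_divide_distrib mult_ac)
    finally show "cmod (deriv_op (\<lambda>x. R x * g1 x) x * cnj (g x)) \<le> G x"
      unfolding s0_def s1_def s2_def G_def .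
  qed
  also have "\<dots> = (1/2) * energy \<delta> p g1 + ((\<eta>/2) * energy \<delta> p g2 + (((C + 1)\<^sup>2 + 1 / \<eta>) / 2) * energy \<delta> p g)"
    unfolding energy_def G_def \<rho>_def[symmetric]
    by (simp only: Bochner_Integration.integral_add integrable_mult_right Bochner_Integration.integrable_add
        en g g12 integral_mult_right_zero)
  finally have "energy \<delta> p g1 \<le> (1/2) * energy \<delta> p g1 +
     ((\<eta>/2) * energy \<delta> p g2 + (((C + 1)\<^sup>2 + 1 / \<eta>) / 2) * energy \<delta> p g)"
    using energy_nonneg[OF p(1), of \<delta> g1] by simp
  then show ?thesis unfolding g1_def[symmetric] g2_def[symmetric] by (simp add: field_simps)
qed

text \<open>
  The interpolation inequalities for the energies of successive derivatives, isolated from the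
  integrals so that the constants derived from them depend on \<open>K\<close> and the order only.
\<close>

definition interpolating :: "real \<Rightarrow> (nat \<Rightarrow> real) \<Rightarrow> bool" where
  "interpolating K A \<longleftrightarrow> (\<forall>k. 0 \<le> A k) \<and>
     (\<forall>k. \<forall>\<eta>>0. A (Suc k) \<le> \<eta> * A (Suc (Suc k)) + (K + 1 / \<eta>) * A k)"

text \<open>
  For the induction step choose the weight in the previous inequality so small that \<open>A (Suc l)\<close> can be
  absorbed on the left.
\<close>

lemma interpolating_next:
  assumes "K \<ge> 0" "\<eta> > 0"
  shows "\<exists>C\<ge>0. \<forall>A. interpolating K A \<longrightarrow> A l \<le> \<eta> * A (Suc l) + C * A 0"
  using assms(2)
proof (induction l arbitrary: \<eta>)
  case 0
  then show ?case by (intro exI[of _ 1]) (auto simp: interpolating_def)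
next
  case (Suc l)
  \<comment> \<open>the constant of the interpolation inequality with \<open>\<eta> / 2\<close>; the induction hypothesis is used with \<open>1 / (2 * D)\<close>\<close>
  define D where "D = K + 2 / \<eta>"
  have D: "D > 0" unfolding D_def using \<open>K \<ge> 0\<close> Suc.prems by (simp add: add_nonneg_pos)
  obtain C where C: "C \<ge> 0" "\<And>A. interpolating K A \<Longrightarrow> A l \<le> 1 / (2 * D) * A (Suc l) + C * A 0"
    using Suc.IH[of "1 / (2 * D)"] D by auto
  have "A (Suc l) \<le> \<eta> * A (Suc (Suc l)) + (2 * D * C) * A 0" if A: "interpolating K A" for A
  proof -
    have "A (Suc l) \<le> \<eta> / 2 * A (Suc (Suc l)) + (K + 1 / (\<eta> / 2)) * A l"
      using A Suc.prems unfolding interpolating_def by (metis half_gt_zero)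
    moreover have "(K + 1 / (\<eta> / 2)) * A l \<le> D * (1 / (2 * D) * A (Suc l) + C * A 0)"
      using mult_left_mono[OF C(2)[OF A], of D] D unfolding D_def by simp
    moreover have "D * (1 / (2 * D) * A (Suc l) + C * A 0) = A (Suc l) / 2 + D * C * A 0"
      using D by (simp add: field_simps)
    ultimately show ?thesis by linarith
  qed
  moreover have "2 * D * C \<ge> 0" using C(1) D by simp
  ultimately show ?case by blast
qed

lemma interpolating_le:
  assumes "K \<ge> 0"
  shows "\<exists>C\<ge>0. \<forall>A. interpolating K A \<longrightarrow> (\<forall>k\<le>l. A k \<le> A l + C * A 0)"
proof (induction l)
  case 0
  show ?case by (intro exI[of _ 0]) auto
next
  case (Suc l)
  then obtain C where C: "C \<ge> 0" "\<And>A k. interpolating K A \<Longrightarrow> k \<le> l \<Longrightarrow> A k \<le> A l + C * A 0" by blast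
  obtain D where D: "D \<ge> 0" "\<And>A. interpolating K A \<Longrightarrow> A l \<le> 1 * A (Suc l) + D * A 0"
    using interpolating_next[OF assms, of 1 l] by auto
  have "A k \<le> A (Suc l) + (C + D) * A 0" if A: "interpolating K A" and k: "k \<le> Suc l" for A k
  proof (cases "k = Suc l")
    case True
    have "0 \<le> A 0" using A unfolding interpolating_def by blast
    then show ?thesis using True C(1) D(1) by simp
  next
    case False
    then show ?thesis using C(2)[OF A, of k] D(2)[OF A] k by (simp add: algebra_simps)
  qed
  moreover have "C + D \<ge> 0" using C(1) D(1) by simp
  ultimately show ?case by blast
qed

lemma deriv_sech_weight_mult:
  assumes "slow g"
  shows "deriv_op (\<lambda>x. sech_weight \<delta> 0 P x * g x) =
    (\<lambda>x. of_real \<delta> * (sech_weight \<delta> 0 (sech_step P) x * g x) + sech_weight \<delta> 0 P x * deriv_op g x)"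
proof (rule deriv_op_eq)
  fix x
  have "((\<lambda>x. sech_weight \<delta> 0 P x * g x) has_vector_derivative
    sech_weight \<delta> 0 P x * deriv_op g x + (of_real \<delta> * sech_weight \<delta> 0 (sech_step P) x) * g x) (at x)"
    by (intro has_vector_derivative_mult has_vector_derivative_sech_weight cls_has_deriv[OF assms])
  then show "((\<lambda>x. sech_weight \<delta> 0 P x * g x) has_vector_derivative
    of_real \<delta> * (sech_weight \<delta> 0 (sech_step P) x * g x) + sech_weight \<delta> 0 P x * deriv_op g x) (at x)"
    by (simp add: algebra_simps)
qed

lemma funpow_deriv_sech_weight_mult:
  assumes g: "slow g" and \<delta>: "\<delta> \<noteq> 0"
  shows "Der (Suc l) (\<lambda>x. sech_weight \<delta> 0 P x * g x) x =
    of_real \<delta> * Der l (\<lambda>x. sech_weight \<delta> 0 (sech_step P) x * g x) x +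
    Der l (\<lambda>x. sech_weight \<delta> 0 P x * deriv_op g x) x"
proof -
  have s: "schwartz (\<lambda>x. sech_weight \<delta> 0 P x * f x)" if "slow f" for P f
    by (intro schwartz_mult_slow schwartz_sech_weight \<delta> that)
  have "schwartz (\<lambda>x. of_real \<delta> * (sech_weight \<delta> 0 (sech_step P) x * g x))"
    by (intro slow_mult_schwartz slow_const s g)
  from cls_funpow_add[OF this s[OF cls_deriv[OF g]], of l P] show ?thesis
    unfolding funpow_Suc_right comp_apply deriv_sech_weight_mult[OF g]
    by (simp add: cls_funpow_cmult[OF s[OF g]])
qed

lemma funpow_deriv_sech_weight_mult_le:
  "\<exists>C\<ge>0. \<forall>\<delta> g x. 0 < \<delta> \<longrightarrow> \<delta> \<le> 1 \<longrightarrow> slow g \<longrightarrow>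
     cmod (Der l (\<lambda>x. sech_weight \<delta> 0 P x * g x) x) \<le>
     C / cosh (\<delta> * x) * (\<Sum>k\<le>l. cmod (Der k g x))"
proof (induction l arbitrary: P)
  case 0
  obtain C where C: "C \<ge> 0" "\<And>z. \<bar>poly P (tanh z)\<bar> \<le> C" using poly_tanh_bounded by blast
  have "cmod (sech_weight \<delta> 0 P x * g x) \<le> C / cosh (\<delta> * x) * cmod (g x)" for \<delta> g x
    unfolding norm_mult sech_weight_def norm_of_real
    using C by (intro mult_right_mono) (auto intro: divide_right_mono)
  with C(1) show ?case by auto
next
  case (Suc l)
  obtain C where C: "C \<ge> 0" "\<And>\<delta> g x. 0 < \<delta> \<Longrightarrow> \<delta> \<le> 1 \<Longrightarrow> slow g \<Longrightarrow>
     cmod (Der l (\<lambda>x. sech_weight \<delta> 0 (sech_step P) x * g x) x) \<le>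
     C / cosh (\<delta> * x) * (\<Sum>k\<le>l. cmod (Der k g x))" using Suc[of "sech_step P"] by blast
  obtain D where D: "D \<ge> 0" "\<And>\<delta> g x. 0 < \<delta> \<Longrightarrow> \<delta> \<le> 1 \<Longrightarrow> slow g \<Longrightarrow>
     cmod (Der l (\<lambda>x. sech_weight \<delta> 0 P x * g x) x) \<le>
     D / cosh (\<delta> * x) * (\<Sum>k\<le>l. cmod (Der k g x))" using Suc[of P] by blast
  have "cmod (Der (Suc l) (\<lambda>x. sech_weight \<delta> 0 P x * g x) x) \<le>
     (C + D) / cosh (\<delta> * x) * (\<Sum>k\<le>Suc l. cmod (Der k g x))"
    if \<delta>: "0 < \<delta>" "\<delta> \<le> 1" and g: "slow g" for \<delta> g x
  proof -
    let ?S = "\<Sum>k\<le>Suc l. cmod (Der k g x)"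
    have "cmod (Der (Suc l) (\<lambda>x. sech_weight \<delta> 0 P x * g x) x) \<le>
        \<delta> * cmod (Der l (\<lambda>x. sech_weight \<delta> 0 (sech_step P) x * g x) x) +
        cmod (Der l (\<lambda>x. sech_weight \<delta> 0 P x * deriv_op g x) x)"
      using \<delta>(1) g unfolding funpow_deriv_sech_weight_mult[OF g less_imp_neq[OF \<delta>(1), symmetric]]
      by (intro order_trans[OF norm_triangle_ineq]) (simp add: norm_mult)
    also have "\<dots> \<le> 1 * (C / cosh (\<delta> * x) * ?S) + D / cosh (\<delta> * x) * ?S"
    proof (intro add_mono mult_mono)
      have "(\<Sum>k\<le>l. cmod (Der k g x)) \<le> ?S" by simp
      then show "cmod (Der l (\<lambda>x. sech_weight \<delta> 0 (sech_step P) x * g x) x) \<le> C / cosh (\<delta> * x) * ?S"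
        using C(1) by (intro order_trans[OF C(2)[OF \<delta> g]] mult_left_mono) auto
      have "(\<Sum>k\<le>l. cmod (Der k (deriv_op g) x)) \<le> ?S"
        unfolding sum.atMost_Suc_shift by (simp add: funpow_swap1)
      then show "cmod (Der l (\<lambda>x. sech_weight \<delta> 0 P x * deriv_op g x) x) \<le> D / cosh (\<delta> * x) * ?S"
        using D(1) by (intro order_trans[OF D(2)[OF \<delta> cls_deriv[OF g]]] mult_left_mono) auto
    qed (use \<delta> in auto)
    finally show ?thesis by (simp add: algebra_simps add_divide_distrib)
  qed
  then show ?case using C(1) D(1) by (intro exI[of _ "C + D"]) auto
qed

text \<open>
  Every term of the Leibniz formula except the main one contains a derivative of the weight and hence a
  factor \<open>\<delta>\<close>.
\<close>

lemma funpow_deriv_sech_weight_mult_error: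
  "\<exists>C\<ge>0. \<forall>\<delta> g x. 0 < \<delta> \<longrightarrow> \<delta> \<le> 1 \<longrightarrow> slow g \<longrightarrow>
     cmod (Der l (\<lambda>x. sech_weight \<delta> 0 1 x * g x) x - sech_weight \<delta> 0 1 x * Der l g x) \<le>
     \<delta> * C / cosh (\<delta> * x) * (\<Sum>k<l. cmod (Der k g x))"
proof (induction l)
  case 0
  show ?case by (intro exI[of _ 0]) auto
next
  case (Suc l)
  obtain C where C: "C \<ge> 0" "\<And>\<delta> g x. 0 < \<delta> \<Longrightarrow> \<delta> \<le> 1 \<Longrightarrow> slow g \<Longrightarrow>
     cmod (Der l (\<lambda>x. sech_weight \<delta> 0 (sech_step 1) x * g x) x) \<le>
     C / cosh (\<delta> * x) * (\<Sum>k\<le>l. cmod (Der k g x))"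
    using funpow_deriv_sech_weight_mult_le[of l "sech_step 1"] by blast
  obtain D where D: "D \<ge> 0" "\<And>\<delta> g x. 0 < \<delta> \<Longrightarrow> \<delta> \<le> 1 \<Longrightarrow> slow g \<Longrightarrow>
     cmod (Der l (\<lambda>x. sech_weight \<delta> 0 1 x * g x) x - sech_weight \<delta> 0 1 x * Der l g x) \<le>
     \<delta> * D / cosh (\<delta> * x) * (\<Sum>k<l. cmod (Der k g x))" using Suc by blast
  have "cmod (Der (Suc l) (\<lambda>x. sech_weight \<delta> 0 1 x * g x) x - sech_weight \<delta> 0 1 x * Der (Suc l) g x) \<le>
     \<delta> * (C + D) / cosh (\<delta> * x) * (\<Sum>k<Suc l. cmod (Der k g x))"
    if \<delta>: "0 < \<delta>" "\<delta> \<le> 1" and g: "slow g" for \<delta> g x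
  proof -
    let ?S = "\<Sum>k<Suc l. cmod (Der k g x)"
    have "cmod (Der (Suc l) (\<lambda>x. sech_weight \<delta> 0 1 x * g x) x - sech_weight \<delta> 0 1 x * Der (Suc l) g x) =
       cmod (of_real \<delta> * Der l (\<lambda>x. sech_weight \<delta> 0 (sech_step 1) x * g x) x +
        (Der l (\<lambda>x. sech_weight \<delta> 0 1 x * deriv_op g x) x - sech_weight \<delta> 0 1 x * Der l (deriv_op g) x))"
      unfolding funpow_deriv_sech_weight_mult[OF g less_imp_neq[OF \<delta>(1), symmetric]]
      by (simp add: funpow_swap1 add_diff_eq)
    also have "\<dots> \<le> \<delta> * cmod (Der l (\<lambda>x. sech_weight \<delta> 0 (sech_step 1) x * g x) x) +
        cmod (Der l (\<lambda>x. sech_weight \<delta> 0 1 x * deriv_op g x) x - sech_weight \<delta> 0 1 x * Der l (deriv_op g) x)"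
      using \<delta>(1) by (intro order_trans[OF norm_triangle_ineq]) (simp add: norm_mult)
    also have "\<dots> \<le> \<delta> * (C / cosh (\<delta> * x) * ?S) + \<delta> * D / cosh (\<delta> * x) * ?S"
    proof (intro add_mono mult_left_mono)
      show "cmod (Der l (\<lambda>x. sech_weight \<delta> 0 (sech_step 1) x * g x) x) \<le> C / cosh (\<delta> * x) * ?S"
        using C(2)[OF \<delta> g, of x] by (simp add: lessThan_Suc_atMost)
      have "(\<Sum>k<l. cmod (Der k (deriv_op g) x)) \<le> ?S"
        unfolding sum.lessThan_Suc_shift by (simp add: funpow_swap1)
      then show "cmod (Der l (\<lambda>x. sech_weight \<delta> 0 1 x * deriv_op g x) x -
          sech_weight \<delta> 0 1 x * Der l (deriv_op g) x) \<le> \<delta> * D / cosh (\<delta> * x) * ?S"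
        using D(1) \<delta> by (intro order_trans[OF D(2)[OF \<delta> cls_deriv[OF g]]] mult_left_mono) auto
    qed (use \<delta> in auto)
    finally show ?thesis by (simp add: algebra_simps add_divide_distrib)
  qed
  then show ?case using C(1) D(1) by (intro exI[of _ "C + D"]) auto
qed

text \<open>
  The commutator with the weight only involves derivatives of \<open>v\<close> of order less than \<open>l\<close>. Interpolation
  bounds their energies for the coefficient \<open>p\<close> by the energy of order \<open>l\<close> and the one of order \<open>0\<close>, and
  the latter is compared with the energy for \<open>q\<close>, since \<open>p\<close> is at most a multiple of \<open>q\<close>.
\<close>

lemma energy_term_estimate:
  assumes p: "p = 0 \<or> (\<exists>\<epsilon>>0. \<forall>x. \<epsilon> \<le> poly p x)"
    and q: "\<epsilon> > 0" "\<And>x. \<epsilon> \<le> poly q x" and deg: "degree p \<le> degree q"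
  shows "\<exists>C\<ge>0. \<forall>\<delta> v. 0 < \<delta> \<longrightarrow> \<delta> \<le> 1 \<longrightarrow> slow v \<longrightarrow>
    cmod ((LINT x|lborel. of_real (poly p x) *
        Der l (\<lambda>x. sech_weight \<delta> 0 1 x * cnj (v x)) x * Der l v x)
      - of_real (energy \<delta> p (Der l v)))
    \<le> \<delta> * C * (energy \<delta> p (Der l v) + energy \<delta> q v)"
proof (cases "p = 0")
  case True
  then show ?thesis by (intro exI[of _ 0]) (auto simp: energy_def)
next
  case False
  then obtain e where e: "e > 0" "\<And>x. e \<le> poly p x" using p by blast
  then have p0: "0 \<le> poly p x" for x using order_trans[OF less_imp_le[OF e(1)]] by blast
  obtain C1 where C1: "C1 \<ge> 0" "\<And>x. \<bar>poly (pderiv p) x\<bar> \<le> C1 * poly p x"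
    using poly_dominated[OF e, of "pderiv p"] by (auto simp: degree_pderiv)
  obtain C2 where C2: "C2 \<ge> 0" "\<And>x. \<bar>poly p x\<bar> \<le> C2 * poly q x"
    using poly_dominated[OF q deg] by blast
  obtain C3 where C3: "C3 \<ge> 0" "\<And>A k. interpolating ((C1 + 1)\<^sup>2) A \<Longrightarrow> k \<le> l \<Longrightarrow> A k \<le> A l + C3 * A 0"
    using interpolating_le[of "(C1 + 1)\<^sup>2" l] by auto
  obtain C4 where C4: "C4 \<ge> 0" "\<And>\<delta> g x. 0 < \<delta> \<Longrightarrow> \<delta> \<le> 1 \<Longrightarrow> slow g \<Longrightarrow>
     cmod (Der l (\<lambda>x. sech_weight \<delta> 0 1 x * g x) x - sech_weight \<delta> 0 1 x * Der l g x) \<le>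
     \<delta> * C4 / cosh (\<delta> * x) * (\<Sum>k<l. cmod (Der k g x))"
    using funpow_deriv_sech_weight_mult_error[of l] by blast
  define C where "C = C4 * real l * (2 + C3 * C2)"
  have "cmod ((LINT x|lborel. of_real (poly p x) *
        Der l (\<lambda>x. sech_weight \<delta> 0 1 x * cnj (v x)) x * Der l v x)
      - of_real (energy \<delta> p (Der l v)))
    \<le> \<delta> * C * (energy \<delta> p (Der l v) + energy \<delta> q v)"
    if \<delta>: "0 < \<delta>" "\<delta> \<le> 1" and v: "slow v" for \<delta> v
  proof -
    define A where "A k = energy \<delta> p (Der k v)" for k
    have d0: "\<delta> \<noteq> 0" using \<delta> by simp
    have sv: "slow (Der k v)" for k by (rule cls_funpow_deriv[OF v])
    have A: "interpolating ((C1 + 1)\<^sup>2) A"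
      unfolding interpolating_def A_def
      using energy_nonneg[OF p0] energy_interpolation_step[OF \<delta> p0 C1(2) sv] by auto
    have A0: "0 \<le> A k" for k unfolding A_def by (rule energy_nonneg[OF p0])
    have Aq: "A 0 \<le> C2 * energy \<delta> q v"
      unfolding A_def using C2(2) by (simp add: energy_mono[OF d0 v] abs_le_iff)
    define \<phi> where "\<phi> x = Der l (\<lambda>x. sech_weight \<delta> 0 1 x * cnj (v x)) x" for x
    have \<phi>: "schwartz \<phi>" unfolding \<phi>_def
      by (intro cls_funpow_deriv schwartz_mult_slow schwartz_sech_weight d0 slow_cnj v)
    define vl where "vl = Der l v"
    define E where "E x = of_real (poly p x) * (\<phi> x - sech_weight \<delta> 0 1 x * cnj (vl x)) * vl x" for x
    have i1: "integrable lborel (\<lambda>x. of_real (poly p x) * \<phi> x * vl x)"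
      unfolding vl_def by (intro schwartz_integrable schwartz_mult_slow slow_mult_schwartz slow_poly \<phi> sv)
    have i2: "integrable lborel (\<lambda>x. of_real (poly p x / cosh (\<delta> * x)) * (vl x * cnj (vl x)))"
      unfolding vl_def
      by (intro schwartz_integrable schwartz_mult_slow schwartz_energy_weight slow_mult slow_cnj sv d0)
    have E_eq: "E = (\<lambda>x. of_real (poly p x) * \<phi> x * vl x - of_real (poly p x / cosh (\<delta> * x)) * (vl x * cnj (vl x)))"
      unfolding E_def sech_weight_1 by (simp add: fun_eq_iff algebra_simps)
    define G where "G = (\<lambda>x. \<delta> * C4 * (\<Sum>k<l. poly p x / cosh (\<delta> * x) * (cmod (Der k v x))\<^sup>2
         + poly p x / cosh (\<delta> * x) * (cmod (vl x))\<^sup>2))"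
    have iE: "integrable lborel E" unfolding E_eq by (intro Bochner_Integration.integrable_diff i1 i2)
    have "(LINT x|lborel. of_real (poly p x) * \<phi> x * vl x) - of_real (A l) = (LINT x|lborel. E x)"
      unfolding E_eq A_def vl_def[symmetric] energy_complex[symmetric]
      by (rule Bochner_Integration.integral_diff[symmetric, OF i1 i2])
    also have "cmod \<dots> \<le> (LINT x|lborel. G x)"
    proof (rule norm_integral_le[OF iE])
      show "integrable lborel G"
        unfolding G_def vl_def
        by (intro integrable_mult_right Bochner_Integration.integrable_sum
            Bochner_Integration.integrable_add integrable_energy d0 sv)
      fix x
      have "cmod (E x) = poly p x * cmod (\<phi> x - sech_weight \<delta> 0 1 x * cnj (vl x)) * cmod (vl x)"
        unfolding E_def norm_mult norm_of_real using p0[of x] by simp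
      also have "\<dots> \<le> poly p x * (\<delta> * C4 / cosh (\<delta> * x) * (\<Sum>k<l. cmod (Der k v x))) * cmod (vl x)"
        using C4(2)[OF \<delta> slow_cnj[OF v], of x] p0[of x]
        unfolding \<phi>_def vl_def funpow_deriv_cnj[OF v]
        by (intro mult_right_mono mult_left_mono) auto
      also have "\<dots> = \<delta> * C4 * (\<Sum>k<l. poly p x / cosh (\<delta> * x) * (cmod (Der k v x) * cmod (vl x)))"
        by (simp add: sum_distrib_left sum_distrib_right mult_ac)
      also have "\<dots> \<le> \<delta> * C4 * (\<Sum>k<l. poly p x / cosh (\<delta> * x) * (cmod (Der k v x))\<^sup>2
         + poly p x / cosh (\<delta> * x) * (cmod (vl x))\<^sup>2)"
      proof (intro mult_left_mono sum_mono)
        fix k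
        have "a * c \<le> a\<^sup>2 + c\<^sup>2" if "0 \<le> a" "0 \<le> c" for a c :: real
          using sum_squares_bound[of a c] mult_nonneg_nonneg[OF that] by linarith
        then have "poly p x / cosh (\<delta> * x) * (cmod (Der k v x) * cmod (vl x)) \<le>
          poly p x / cosh (\<delta> * x) * ((cmod (Der k v x))\<^sup>2 + (cmod (vl x))\<^sup>2)"
          using p0[of x] by (intro mult_left_mono) auto
        then show "poly p x / cosh (\<delta> * x) * (cmod (Der k v x) * cmod (vl x)) \<le>
          poly p x / cosh (\<delta> * x) * (cmod (Der k v x))\<^sup>2 + poly p x / cosh (\<delta> * x) * (cmod (vl x))\<^sup>2"
          by (simp only: distrib_left)
      qed (use \<delta> C4(1) in auto)
      finally show "cmod (E x) \<le> G x" unfolding G_def .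
    qed
    also have "\<dots> = \<delta> * C4 * (\<Sum>k<l. A k + A l)"
    proof -
      have "(LINT x|lborel. (\<Sum>k<l. poly p x / cosh (\<delta> * x) * (cmod (Der k v x))\<^sup>2
         + poly p x / cosh (\<delta> * x) * (cmod (vl x))\<^sup>2)) = (\<Sum>k<l. A k + A l)"
        unfolding A_def energy_def vl_def
      proof (rule trans[OF Bochner_Integration.integral_sum])
        show "integrable lborel (\<lambda>x. poly p x / cosh (\<delta> * x) * (cmod (Der k v x))\<^sup>2 +
            poly p x / cosh (\<delta> * x) * (cmod (Der l v x))\<^sup>2)" for k
          by (intro Bochner_Integration.integrable_add integrable_energy d0 sv)
      qed (simp only: Bochner_Integration.integral_add[OF integrable_energy[OF d0 sv] integrable_energy[OF d0 sv]])
      then show ?thesis unfolding G_def by (simp only: integral_mult_right_zero)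
    qed
    also have "\<dots> \<le> \<delta> * C4 * (\<Sum>k<l. (A l + C3 * (C2 * energy \<delta> q v)) + A l)"
    proof (intro mult_left_mono sum_mono add_mono order_refl)
      fix k assume "k \<in> {..<l}"
      then have "A k \<le> A l + C3 * A 0" using C3(2)[OF A, of k] by simp
      also have "\<dots> \<le> A l + C3 * (C2 * energy \<delta> q v)"
        using Aq C3(1) by (intro add_mono mult_left_mono order_refl)
      finally show "A k \<le> A l + C3 * (C2 * energy \<delta> q v)" .
    qed (use \<delta> C4(1) in auto)
    also have "\<dots> = \<delta> * (C4 * real l) * (2 * A l + (C3 * C2) * energy \<delta> q v)"
      by (simp add: algebra_simps)
    also have "\<dots> \<le> \<delta> * (C4 * real l) * ((2 + C3 * C2) * A l + (2 + C3 * C2) * energy \<delta> q v)"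
    proof (intro mult_left_mono add_mono mult_right_mono)
      show "0 \<le> energy \<delta> q v"
        using q by (intro energy_nonneg) (meson less_imp_le order_trans)
    qed (use \<delta> C2(1) C3(1) C4(1) A0 in auto)
    also have "\<dots> = \<delta> * C * (A l + energy \<delta> q v)" unfolding C_def by (simp add: algebra_simps)
    finally show ?thesis unfolding A_def \<phi>_def vl_def .
  qed
  moreover have "C \<ge> 0" unfolding C_def using C2(1) C3(1) C4(1) by simp
  ultimately show ?thesis by (intro exI[of _ C] conjI allI impI)
qed

text \<open>
  The case \<open>b 0 \<noteq> 0\<close> of the theorem, to which the case of constant coefficients is reduced.
\<close>

definition admissible :: "nat \<Rightarrow> (nat \<Rightarrow> real poly) \<Rightarrow> bool" where
  "admissible m b \<longleftrightarrow> b m \<noteq> 0 \<and> b 0 \<noteq> 0 \<and>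
     (\<forall>l\<le>m. b l = 0 \<or> (\<exists>\<epsilon>>0. \<forall>x. \<epsilon> \<le> poly (b l) x)) \<and>
     (\<forall>l\<le>m. degree (b l) \<le> degree (b 0))"

text \<open>
  With a small \<open>\<delta>\<close> the errors in the tested equation absorb at most half of the total energy \<open>Q\<close>, so \<open>Q\<close> and
  in particular the energy of order \<open>0\<close> vanish.
\<close>

theorem slow_weak_solution_zero:
  assumes b: "admissible m b" and v: "slow v"
    and weak: "\<And>f. schwartz f \<Longrightarrow> (LINT x|lborel. diff_op m b f x * v x) = 0"
  shows "AE x in lborel. v x = 0"
proof -
  have coeff: "b l = 0 \<or> (\<exists>\<epsilon>>0. \<forall>x. \<epsilon> \<le> poly (b l) x)" "degree (b l) \<le> degree (b 0)" if "l \<le> m" for l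
    using b that unfolding admissible_def by blast+
  have "b 0 \<noteq> 0" using b unfolding admissible_def by blast
  then obtain \<epsilon> where \<epsilon>: "\<epsilon> > 0" "\<And>x. \<epsilon> \<le> poly (b 0) x"
    using coeff(1)[OF le0] by blast
  have nonneg: "0 \<le> poly (b l) x" if "l \<le> m" for l x
    using coeff(1)[OF that]
  proof
    assume "\<exists>\<epsilon>>0. \<forall>x. \<epsilon> \<le> poly (b l) x"
    then obtain e where "e > 0" "e \<le> poly (b l) x" by blast
    then show ?thesis by linarith
  qed simp
  define A where "A \<delta> l = energy \<delta> (b l) (Der l v)" for \<delta> l
  define T where "T \<delta> l = (LINT x|lborel. of_real (poly (b l) x) *
        Der l (\<lambda>x. sech_weight \<delta> 0 1 x * cnj (v x)) x * Der l v x)" for \<delta> l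
  have "\<exists>c\<ge>0. \<forall>\<delta>. 0 < \<delta> \<longrightarrow> \<delta> \<le> 1 \<longrightarrow>
      cmod (T \<delta> l - of_real (A \<delta> l)) \<le> \<delta> * c * (A \<delta> l + A \<delta> 0)" if l: "l \<le> m" for l
  proof -
    obtain c where "c \<ge> 0" "\<And>\<delta> v. 0 < \<delta> \<Longrightarrow> \<delta> \<le> 1 \<Longrightarrow> slow v \<Longrightarrow>
        cmod ((LINT x|lborel. of_real (poly (b l) x) *
          Der l (\<lambda>x. sech_weight \<delta> 0 1 x * cnj (v x)) x * Der l v x)
        - of_real (energy \<delta> (b l) (Der l v)))
        \<le> \<delta> * c * (energy \<delta> (b l) (Der l v) + energy \<delta> (b 0) v)"
      using energy_term_estimate[OF coeff(1)[OF l] \<epsilon> coeff(2)[OF l], of l] by blast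
    then show ?thesis using v unfolding T_def A_def by (intro exI[of _ c]) simp
  qed
  then obtain C where C: "\<And>l. l \<le> m \<Longrightarrow> C l \<ge> 0"
    "\<And>l \<delta>. l \<le> m \<Longrightarrow> 0 < \<delta> \<Longrightarrow> \<delta> \<le> 1 \<Longrightarrow>
      cmod (T \<delta> l - of_real (A \<delta> l)) \<le> \<delta> * C l * (A \<delta> l + A \<delta> 0)"
    by metis
  define K where "K = (\<Sum>l\<le>m. C l)"
  have K: "0 \<le> K" unfolding K_def using C(1) by (intro sum_nonneg) auto
  have CK: "C l \<le> K" if "l \<le> m" for l unfolding K_def using C(1) that by (intro member_le_sum) auto
  \<comment> \<open>chosen so that the sum of the errors is at most half of the total energy\<close>
  define \<delta> where "\<delta> = 1 / (2 * K * (real m + 2) + 1)"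
  have den: "2 * K * (real m + 2) \<ge> 0" using K by simp
  have \<delta>: "0 < \<delta>" "\<delta> \<le> 1" unfolding \<delta>_def using den by auto
  have d0: "\<delta> \<noteq> 0" using \<delta> by simp
  have A: "0 \<le> A \<delta> l" if "l \<le> m" for l unfolding A_def using nonneg[OF that] by (rule energy_nonneg)
  define Q where "Q = (\<Sum>l\<le>m. A \<delta> l)"
  have AQ: "A \<delta> l \<le> Q" if "l \<le> m" for l unfolding Q_def using A that by (intro member_le_sum) auto
  have Q: "0 \<le> Q" unfolding Q_def using A by (intro sum_nonneg) auto
  have "(\<Sum>l\<le>m. T \<delta> l) = (LINT x|lborel. diff_op m b (\<lambda>x. sech_weight \<delta> 0 1 x * cnj (v x)) x * v x)"
    unfolding T_def
    by (intro integral_diff_op_mult[symmetric] schwartz_mult_slow schwartz_sech_weight d0 slow_cnj v)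
  also have "\<dots> = 0" by (intro weak schwartz_mult_slow schwartz_sech_weight d0 slow_cnj v)
  finally have T0: "(\<Sum>l\<le>m. T \<delta> l) = 0" .
  have "Q = cmod (of_real Q)" using Q by simp
  also have "of_real Q = - (\<Sum>l\<le>m. T \<delta> l - of_real (A \<delta> l))"
    unfolding sum_subtractf T0 Q_def by simp
  also have "cmod \<dots> \<le> (\<Sum>l\<le>m. cmod (T \<delta> l - of_real (A \<delta> l)))" unfolding norm_minus_cancel by (rule norm_sum)
  also have "\<dots> \<le> (\<Sum>l\<le>m. \<delta> * K * (A \<delta> l + Q))"
  proof (rule sum_mono)
    fix l assume "l \<in> {..m}"
    then have l: "l \<le> m" by simp
    have "cmod (T \<delta> l - of_real (A \<delta> l)) \<le> \<delta> * C l * (A \<delta> l + A \<delta> 0)"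
      by (rule C(2)[OF l \<delta>])
    also have "\<dots> \<le> \<delta> * K * (A \<delta> l + Q)"
      using \<delta> CK[OF l] C(1)[OF l] K A[OF l] A[of 0] AQ[of 0] by (intro mult_mono add_mono) auto
    finally show "cmod (T \<delta> l - of_real (A \<delta> l)) \<le> \<delta> * K * (A \<delta> l + Q)" .
  qed
  also have "\<dots> = \<delta> * (K * (real m + 2)) * Q"
    unfolding sum_distrib_left[symmetric] sum.distrib Q_def[symmetric] by (simp add: algebra_simps)
  also have "\<dots> \<le> 1 / 2 * Q"
  proof (rule mult_right_mono[OF _ Q])
    show "\<delta> * (K * (real m + 2)) \<le> 1 / 2" unfolding \<delta>_def using den by (simp add: field_simps)
  qed
  finally have "Q = 0" using Q by simp
  then have "A \<delta> 0 = 0" using A[of 0] AQ[of 0] by simp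
  then have "(LINT x|lborel. poly (b 0) x / cosh (\<delta> * x) * (cmod (v x))\<^sup>2) = 0"
    unfolding A_def energy_def by simp
  then have "AE x in lborel. poly (b 0) x / cosh (\<delta> * x) * (cmod (v x))\<^sup>2 = 0"
    using nonneg[of 0] integral_nonneg_eq_0_iff_AE[OF integrable_energy[OF d0 v, of "b 0"]] by simp
  then show ?thesis
  proof eventually_elim
    case (elim x)
    moreover have "poly (b 0) x \<noteq> 0" using \<epsilon>(1) \<epsilon>(2)[of x] by linarith
    ultimately show ?case using cosh_real_neq_0 by simp
  qed
qed

section \<open>Powers of the operator\<close>

text \<open>
  Moving all but one factor onto \<open>v\<close> shows that the operator annihilates \<open>(diff_op m b ^^ n) v\<close> weakly;
  this function therefore vanishes and the number of factors decreases.
\<close>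

lemma slow_weak_solution_power_zero:
  assumes b: "admissible m b" and v: "slow v"
    and weak: "\<And>f. schwartz f \<Longrightarrow> (LINT x|lborel. (diff_op m b ^^ n) f x * v x) = 0"
  shows "AE x in lborel. v x = 0"
  using weak
proof (induction n)
  case 0
  then show ?case
    by (intro tempered_AE_zero slow_imp_tempered v) (simp add: mult.commute)
next
  case (Suc n)
  let ?w = "(diff_op m b ^^ n) v"
  have w: "slow ?w" by (rule slow_diff_op_power[OF v])
  have "(LINT x|lborel. diff_op m b f x * ?w x) = 0" if f: "schwartz f" for f
    using integral_diff_op_power_swap[OF schwartz_diff_op[OF f, of m b] v, where m = m and b = b and n = n] Suc.prems[OF f]
    by (simp add: funpow_swap1)
  then have w0: "AE x in lborel. ?w x = 0"
    by (intro slow_weak_solution_zero[OF b w])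
  have "(LINT x|lborel. (diff_op m b ^^ n) f x * v x) = 0" if f: "schwartz f" for f
  proof -
    have "(LINT x|lborel. (diff_op m b ^^ n) f x * v x) = (LINT x|lborel. f x * ?w x)"
      by (rule integral_diff_op_power_swap[OF f v])
    also have "\<dots> = 0"
      using w0 by (intro integral_eq_zero_AE) (auto elim: eventually_mono)
    finally show ?thesis .
  qed
  then show ?case by (rule Suc.IH)
qed

lemma admissible_lower_bound:
  assumes "admissible m b" "l \<le> m" "b l \<noteq> 0"
  shows "\<exists>\<epsilon>>0. \<forall>x. \<epsilon> \<le> poly (b l) x"
  using assms unfolding admissible_def by blast

theorem square_integrable_weak_solution_power_zero:
  assumes b: "admissible m b" and u: "tempered u"
    and weak: "\<And>f. schwartz f \<Longrightarrow> (LINT x|lborel. (diff_op m b ^^ n) f x * u x) = 0"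
  shows "AE x in lborel. u x = 0"
proof -
  have "b m \<noteq> 0" using b unfolding admissible_def by blast
  then obtain \<epsilon> where \<epsilon>: "\<epsilon> > 0" "\<And>x. \<epsilon> \<le> poly (b m) x"
    using admissible_lower_bound[OF b order_refl] by blast
  obtain a where a: "a (2 * m * n) = smult (((-1) ^ m) ^ n) (b m ^ n)"
    "\<And>f. slow f \<Longrightarrow> (diff_op m b ^^ n) f =
      (\<lambda>x. \<Sum>k\<le>2 * m * n. of_real (poly (a k) x) * Der k f x)"
    using expands_diff_op_power[of m n b] unfolding expands_def by blast
  have "\<exists>v. slow v \<and> (AE x in lborel. u x = v x)"
  proof (rule weak_solution_slow[OF u, where a = a and M = "2 * m * n" and p = "b m ^ n"])
    show "a (2 * m * n) = smult (((-1) ^ m) ^ n) (b m ^ n)" by (rule a(1))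
    show "0 < \<epsilon> ^ n" using \<epsilon>(1) by simp
    show "\<epsilon> ^ n \<le> poly (b m ^ n) x" for x
      using \<epsilon> unfolding poly_power by (intro power_mono) auto
    show "((-1) ^ m) ^ n \<noteq> (0::real)" by simp
    show "(LINT x|lborel. u x * (\<Sum>j\<le>2 * m * n. of_real (poly (a j) x) * Der j f x)) = 0"
      if f: "schwartz f" for f
      using weak[OF f] unfolding a(2)[OF schwartz_slow[OF f]] by (simp add: mult.commute)
  qed
  then obtain v where v: "slow v" "AE x in lborel. u x = v x" by blast
  have "(LINT x|lborel. (diff_op m b ^^ n) f x * v x) = 0" if f: "schwartz f" for f
  proof -
    have [measurable]: "u \<in> borel_measurable lborel" using u unfolding tempered_def by auto
    have [measurable]: "v \<in> borel_measurable lborel" "(diff_op m b ^^ n) f \<in> borel_measurable lborel"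
      by (rule cls_measurable[OF v(1)], rule cls_measurable[OF schwartz_diff_op_power[OF f]])
    have "(LINT x|lborel. (diff_op m b ^^ n) f x * v x) = (LINT x|lborel. (diff_op m b ^^ n) f x * u x)"
      using v(2) by (intro integral_cong_AE) (auto elim: eventually_mono)
    then show ?thesis using weak[OF f] by simp
  qed
  then have "AE x in lborel. v x = 0" by (rule slow_weak_solution_power_zero[OF b v(1)])
  with v(2) show ?thesis by eventually_elim simp
qed

text \<open>
  All terms of the quadratic form are nonnegative, and the one of order \<open>0\<close> is at least \<open>\<epsilon>\<close> times the
  square of the norm of \<open>f\<close>.
\<close>

lemma diff_op_lower_bound:
  assumes b: "admissible m b" and \<epsilon>: "\<epsilon> > 0" "\<And>x. \<epsilon> \<le> poly (b 0) x" and f: "schwartz f"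
  shows "\<epsilon> * norm (abs_L2 f) \<le> norm (abs_L2 (diff_op m b f))"
proof -
  have sf: "square_integrable f" "square_integrable (diff_op m b f)"
    by (intro schwartz_square_integrable schwartz_diff_op f)+
  have nonneg: "0 \<le> poly (b l) x" if l: "l \<le> m" for l x
  proof (cases "b l = 0")
    case False
    then obtain e where "e > 0" "e \<le> poly (b l) x" using admissible_lower_bound[OF b l] by blast
    then show ?thesis by linarith
  qed simp
  have re: "Re (LINT x|lborel. of_real (poly (b l) x) * Der l f x * Der l (\<lambda>x. cnj (f x)) x)
      = (LINT x|lborel. poly (b l) x * (cmod (Der l f x))\<^sup>2)" for l
  proof -
    have "of_real (poly (b l) x) * Der l f x * Der l (\<lambda>x. cnj (f x)) x
       = complex_of_real (poly (b l) x * (cmod (Der l f x))\<^sup>2)" for x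
      unfolding funpow_deriv_cnj[OF schwartz_slow[OF f]] mult.assoc mult_cnj_eq by simp
    then show ?thesis by (simp only: integral_complex_of_real Re_complex_of_real)
  qed
  have "\<epsilon> * (norm (abs_L2 f))\<^sup>2 = (LINT x|lborel. \<epsilon> * (cmod (f x))\<^sup>2)"
    unfolding norm_abs_L2[OF sf(1)] by (simp only: integral_mult_right_zero)
  also have "\<dots> \<le> (LINT x|lborel. poly (b 0) x * (cmod (Der 0 f x))\<^sup>2)"
  proof (rule integral_mono)
    show "integrable lborel (\<lambda>x. \<epsilon> * (cmod (f x))\<^sup>2)"
      using sf(1) unfolding square_integrable_def by (intro integrable_mult_right) blast
    have "integrable lborel (\<lambda>x. Re (of_real (poly (b 0) x) * f x * cnj (f x)))"
      by (intro integrable_Re schwartz_integrable schwartz_mult_slow slow_mult_schwartz slow_poly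
          slow_cnj schwartz_slow f)
    moreover have "Re (of_real (poly (b 0) x) * f x * cnj (f x)) = poly (b 0) x * (cmod (f x))\<^sup>2" for x
      unfolding mult.assoc mult_cnj_eq of_real_mult[symmetric] Re_complex_of_real ..
    ultimately show "integrable lborel (\<lambda>x. poly (b 0) x * (cmod (Der 0 f x))\<^sup>2)"
      by (simp only: funpow_0)
    show "\<epsilon> * (cmod (f x))\<^sup>2 \<le> poly (b 0) x * (cmod (Der 0 f x))\<^sup>2" for x
      using \<epsilon>(2)[of x] by (simp add: mult_right_mono)
  qed
  also have "\<dots> \<le> (\<Sum>l\<le>m. LINT x|lborel. poly (b l) x * (cmod (Der l f x))\<^sup>2)"
    using nonneg by (intro member_le_sum[of 0 "{..m}" "\<lambda>l. LINT x|lborel. poly (b l) x * (cmod (Der l f x))\<^sup>2"]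
        Bochner_Integration.integral_nonneg) auto
  also have "\<dots> = Re (LINT x|lborel. diff_op m b f x * cnj (f x))"
    unfolding integral_diff_op_mult[OF f slow_cnj[OF schwartz_slow[OF f]]] Re_sum re ..
  also have "\<dots> = inner (abs_L2 (diff_op m b f)) (abs_L2 f)"
    using sf by (simp add: inner_L2_def cinner_abs_L2)
  also have "\<dots> \<le> norm (abs_L2 (diff_op m b f)) * norm (abs_L2 f)"
    by (rule norm_cauchy_schwarz)
  finally show ?thesis
    by (cases "norm (abs_L2 f) = 0") (auto simp: power2_eq_square mult.assoc[symmetric])
qed

lemma diff_op_power_lower_bound:
  assumes "admissible m b" "\<epsilon> > 0" "\<And>x. \<epsilon> \<le> poly (b 0) x" "schwartz f"
  shows "\<epsilon> ^ n * norm (abs_L2 f) \<le> norm (abs_L2 ((diff_op m b ^^ n) f))"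
proof (induction n)
  case (Suc n)
  have "\<epsilon> ^ Suc n * norm (abs_L2 f) \<le> \<epsilon> * norm (abs_L2 ((diff_op m b ^^ n) f))"
    using mult_left_mono[OF Suc, of \<epsilon>] assms(2) by (simp add: mult.assoc)
  also have "\<dots> \<le> norm (abs_L2 (diff_op m b ((diff_op m b ^^ n) f)))"
    by (intro diff_op_lower_bound assms schwartz_diff_op_power)
  finally show ?case by simp
qed simp

text \<open>
  A multiple of the identity is allowed for because the operator itself need not be bounded below when
  \<open>b 0 = 0\<close>.
\<close>

theorem essentially_self_adjoint_if_shift_is_power:
  assumes b': "admissible m' b'"
    and shift: "\<And>f. schwartz f \<Longrightarrow>
      (diff_op m' b' ^^ n') f = (\<lambda>x. (diff_op m b ^^ n) f x + of_real c * f x)"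
  shows "essentially_self_adjoint (schwartz_operator (diff_op m b ^^ n))"
proof -
  let ?A = "diff_op m b ^^ n" and ?B = "diff_op m' b' ^^ n'"
  define T where "T = schwartz_operator ?A"
  note T_def = T_def schwartz_operator_def schwartz_space_eq
  have TI: "schwartz f \<Longrightarrow> (abs_L2 f, abs_L2 (?A f)) \<in> T" for f unfolding T_def by blast
  have TE: "\<exists>f. schwartz f \<and> p = (abs_L2 f, abs_L2 (?A f))" if "p \<in> T" for p
    using that unfolding T_def by blast
  have sq: "square_integrable f" "square_integrable (?A f)" if "schwartz f" for f
    using that by (intro schwartz_square_integrable schwartz_diff_op_power; simp)+
  have B: "abs_L2 (?A f) + c *\<^sub>R abs_L2 f = abs_L2 (?B f)" if f: "schwartz f" for f
    unfolding shift[OF f]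
    using sq[OF f] square_integrable_scaleR[OF sq(1)[OF f], of c]
    by (simp add: abs_L2_scaleR abs_L2_plus scaleR_conv_of_real)
  have sub: "subspace T"
  proof (rule subspaceI)
    have "schwartz (\<lambda>x. 0 * sech_weight 1 0 1 x)"
      by (intro slow_mult_schwartz slow_const schwartz_sech_weight) simp
    then have z: "schwartz (\<lambda>x. 0)" by simp
    have "?A (\<lambda>x. 0 * 0) = (\<lambda>x. 0 * ?A (\<lambda>x. 0) x)"
      by (rule diff_op_power_cmult[OF schwartz_slow[OF z]])
    then have "(abs_L2 (\<lambda>x. 0), abs_L2 (?A (\<lambda>x. 0))) = 0"
      by (simp add: zero_prod_def zero_L2_def)
    then show "0 \<in> T" using TI[OF z] by simp
  next
    fix p q assume "p \<in> T" "q \<in> T"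
    then obtain f g where fg: "schwartz f" "schwartz g"
      "p = (abs_L2 f, abs_L2 (?A f))" "q = (abs_L2 g, abs_L2 (?A g))" using TE by blast
    have "p + q = (abs_L2 (\<lambda>x. f x + g x), abs_L2 (?A (\<lambda>x. f x + g x)))"
      unfolding fg(3,4) diff_op_power_add[OF schwartz_slow[OF fg(1)] schwartz_slow[OF fg(2)]]
      using sq fg by (simp add: abs_L2_plus)
    then show "p + q \<in> T" using TI[OF schwartz_add[OF fg(1,2)]] by simp
  next
    fix r p assume "p \<in> T"
    then obtain f where f: "schwartz f" "p = (abs_L2 f, abs_L2 (?A f))" using TE by blast
    have "r *\<^sub>R p = (abs_L2 (\<lambda>x. of_real r * f x), abs_L2 (?A (\<lambda>x. of_real r * f x)))"
      unfolding f(2) diff_op_power_cmult[OF schwartz_slow[OF f(1)]]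
      using sq f by (simp add: abs_L2_scaleR scaleR_conv_of_real)
    then show "r *\<^sub>R p \<in> T" using TI[OF slow_mult_schwartz[OF slow_const f(1)]] by simp
  qed
  have tu: "tempered (\<lambda>x. cnj (rep_L2 u x))" for u
  proof -
    have "square_integrable (\<lambda>x. cnj (rep_L2 u x))"
    proof -
      have [measurable]: "cnj \<in> borel_measurable borel"
        by (intro borel_measurable_continuous_onI continuous_intros)
      show ?thesis using square_integrable_rep_L2[of u] unfolding square_integrable_def by auto
    qed
    then show ?thesis by (rule square_integrable_imp_tempered)
  qed
  have zero: "u = 0" if "AE x in lborel. cnj (rep_L2 u x) = 0" for u
  proof -
    have "abs_L2 (rep_L2 u) = abs_L2 (\<lambda>x. 0)"
      using that by (intro abs_L2_eqI square_integrable_rep_L2 square_integrable_0) simp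
    then show ?thesis by (simp add: zero_L2_def)
  qed
  \<comment> \<open>orthogonality for the real inner product yields the complex one, since the range is a complex subspace\<close>
  have orth: "(LINT x|lborel. g x * cnj (rep_L2 u x)) = 0"
    if g: "square_integrable g" and re: "\<And>k. inner (abs_L2 (\<lambda>x. k * g x)) u = 0" for g u
  proof -
    have "(LINT x|lborel. k * (g x * cnj (rep_L2 u x))) = cinner_L2 (abs_L2 (\<lambda>x. k * g x)) u" for k
    proof -
      have "square_integrable (\<lambda>x. k * g x)"
        using g by (auto simp: square_integrable_def norm_mult power_mult_distrib)
      from cinner_abs_L2[OF this square_integrable_rep_L2[of u]] show ?thesis by (simp add: mult.assoc)
    qed
    then have "Re (k * (LINT x|lborel. g x * cnj (rep_L2 u x))) = 0" for k
      using re[of k] unfolding inner_L2_def by simp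
    from this[of 1] this[of "- \<i>"] show ?thesis by (simp add: complex_eq_iff)
  qed
  have dense: "densely_defined T"
    unfolding densely_defined_def
  proof (rule subspace_dense_if_trivial_complement)
    have "Domain T = fst ` T" by (simp add: fst_eq_Domain)
    then show "subspace (Domain T)" using linear_subspace_image[OF linear_fst sub] by simp
    fix u assume u: "\<And>s. s \<in> Domain T \<Longrightarrow> inner s u = 0"
    show "u = 0"
    proof (rule zero, rule tempered_AE_zero[OF tu])
      fix f assume f: "schwartz f"
      have "inner (abs_L2 (\<lambda>x. k * f x)) u = 0" for k
        using TI[OF slow_mult_schwartz[OF slow_const f]] by (intro u) blast
      then show "(LINT x|lborel. cnj (rep_L2 u x) * f x) = 0"
        using orth[OF sq(1)[OF f], of u] by (simp add: mult.commute)
    qed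
  qed
  have sym: "T \<subseteq> adjoint_op T"
  proof
    fix q assume "q \<in> T"
    then obtain g where g: "schwartz g" "q = (abs_L2 g, abs_L2 (?A g))" using TE by blast
    have "cinner_L2 (abs_L2 (?A f)) (abs_L2 g) = cinner_L2 (abs_L2 f) (abs_L2 (?A g))"
      if f: "schwartz f" for f
      using sq[OF f] sq[OF g(1)] integral_diff_op_power_swap[OF f slow_cnj[OF schwartz_slow[OF g(1)]]]
      by (simp add: cinner_abs_L2 diff_op_power_cnj[OF schwartz_slow[OF g(1)]])
    then show "q \<in> adjoint_op T" unfolding adjoint_op_def g(2) using TE by fastforce
  qed
  obtain \<epsilon> where \<epsilon>: "\<epsilon> > 0" "\<And>x. \<epsilon> \<le> poly (b' 0) x"
    using admissible_lower_bound[OF b', of 0] b' unfolding admissible_def by blast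
  show ?thesis
    unfolding T_def(1)[symmetric]
  proof (rule essentially_self_adjoint_if_shift_bounded_below[OF sub dense sym])
    show "0 < \<epsilon> ^ n'" using \<epsilon>(1) by simp
    fix f g assume "(f, g) \<in> T"
    then obtain h where h: "schwartz h" "f = abs_L2 h" "g = abs_L2 (?A h)" using TE by blast
    show "\<epsilon> ^ n' * norm f \<le> norm (g + c *\<^sub>R f)"
      unfolding h(2,3) B[OF h(1)] by (rule diff_op_power_lower_bound[OF b' \<epsilon> h(1)])
  next
    fix u assume u: "\<And>f g. (f, g) \<in> T \<Longrightarrow> inner (g + c *\<^sub>R f) u = 0"
    show "u = 0"
    proof (rule zero, rule square_integrable_weak_solution_power_zero[OF b' tu])
      fix f assume f: "schwartz f"
      have "inner (abs_L2 (\<lambda>x. k * ?B f x)) u = 0" for k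
      proof -
        have kf: "schwartz (\<lambda>x. k * f x)" by (intro slow_mult_schwartz slow_const f)
        have "inner (abs_L2 (?B (\<lambda>x. k * f x))) u = 0"
          using u[OF TI[OF kf]] unfolding B[OF kf] .
        then show ?thesis unfolding diff_op_power_cmult[OF schwartz_slow[OF f]] .
      qed
      then show "(LINT x|lborel. ?B f x * cnj (rep_L2 u x)) = 0"
        by (intro orth schwartz_square_integrable schwartz_diff_op_power f)
    qed
  qed
qed

section \<open>Constant coefficients\<close>

text \<open>
  Polynomials with nonnegative coefficients in the negative second derivative. Nonnegativity is what
  makes such an operator admissible after the identity has been added.
\<close>

definition const_form :: "((real \<Rightarrow> complex) \<Rightarrow> real \<Rightarrow> complex) \<Rightarrow> bool" where
  "const_form A \<longleftrightarrow> (\<exists>N c. (\<forall>k. 0 \<le> c k) \<and> (\<forall>k>N. c k = 0) \<and> (\<forall>f. slow f \<longrightarrow>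
     A f = (\<lambda>x. \<Sum>k\<le>N. of_real (c k) * ((-1) ^ k * Der (2 * k) f x))))"

lemma const_form_id: "const_form (\<lambda>f. f)"
  unfolding const_form_def
  by (intro exI[of _ 0] exI[of _ "\<lambda>k. if k = 0 then 1 else 0"]) auto

lemma const_form_cmult:
  assumes "const_form A" "0 \<le> d"
  shows "const_form (\<lambda>f x. of_real d * A f x)"
proof -
  obtain N c where "\<forall>k. 0 \<le> c k" "\<forall>k>N. c k = 0" "\<And>f. slow f \<Longrightarrow>
     A f = (\<lambda>x. \<Sum>k\<le>N. of_real (c k) * ((-1) ^ k * Der (2 * k) f x))"
    using assms(1) unfolding const_form_def by blast
  then show ?thesis unfolding const_form_def using \<open>0 \<le> d\<close>
    by (intro exI[of _ N] exI[of _ "\<lambda>k. d * c k"]) (auto simp: sum_distrib_left mult.assoc)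
qed

lemma const_form_add:
  assumes "const_form A" "const_form B"
  shows "const_form (\<lambda>f x. A f x + B f x)"
proof -
  obtain M c where c: "\<And>k. 0 \<le> c k" "\<And>k. k > M \<Longrightarrow> c k = 0" "\<And>f. slow f \<Longrightarrow>
     A f = (\<lambda>x. \<Sum>k\<le>M. of_real (c k) * ((-1) ^ k * Der (2 * k) f x))"
    using assms(1) unfolding const_form_def by blast
  obtain N d where d: "\<And>k. 0 \<le> d k" "\<And>k. k > N \<Longrightarrow> d k = 0" "\<And>f. slow f \<Longrightarrow>
     B f = (\<lambda>x. \<Sum>k\<le>N. of_real (d k) * ((-1) ^ k * Der (2 * k) f x))"
    using assms(2) unfolding const_form_def by blast
  have "(\<lambda>x. A f x + B f x) = (\<lambda>x. \<Sum>k\<le>max M N. of_real (c k + d k) * ((-1) ^ k * Der (2 * k) f x))"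
    if f: "slow f" for f
  proof
    fix x
    have "(\<Sum>k\<le>M. of_real (c k) * ((-1) ^ k * Der (2 * k) f x)) =
        (\<Sum>k\<le>max M N. of_real (c k) * ((-1) ^ k * Der (2 * k) f x))"
      using c(2) by (intro sum.mono_neutral_left) auto
    moreover have "(\<Sum>k\<le>N. of_real (d k) * ((-1) ^ k * Der (2 * k) f x)) =
        (\<Sum>k\<le>max M N. of_real (d k) * ((-1) ^ k * Der (2 * k) f x))"
      using d(2) by (intro sum.mono_neutral_left) auto
    ultimately show "A f x + B f x = (\<Sum>k\<le>max M N. of_real (c k + d k) * ((-1) ^ k * Der (2 * k) f x))"
      unfolding c(3)[OF f] d(3)[OF f] by (simp add: distrib_right sum.distrib)
  qed
  then show ?thesis unfolding const_form_def using c d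
    by (intro exI[of _ "max M N"] exI[of _ "\<lambda>k. c k + d k"]) (auto intro: add_nonneg_nonneg)
qed

lemma const_form_deriv2:
  assumes "const_form A" and slow: "\<And>f. slow f \<Longrightarrow> slow (A f)"
  shows "const_form (\<lambda>f x. - Der 2 (A f) x)"
proof -
  obtain N c where c: "\<And>k. 0 \<le> c k" "\<And>k. k > N \<Longrightarrow> c k = 0" "\<And>f. slow f \<Longrightarrow>
     A f = (\<lambda>x. \<Sum>k\<le>N. of_real (c k) * ((-1) ^ k * Der (2 * k) f x))"
    using assms(1) unfolding const_form_def by blast
  define d where "d k = (case k of 0 \<Rightarrow> 0 | Suc j \<Rightarrow> c j)" for k
  have d2: "Der 2 (\<lambda>x. \<Sum>k\<le>M. of_real (c k) * ((-1) ^ k * Der (2 * k) f x)) =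
      (\<lambda>x. \<Sum>k\<le>M. of_real (c k) * ((-1) ^ k * Der (2 * Suc k) f x))" if f: "slow f" for f M
  proof (induction M)
    case 0
    show ?case
      using cls_funpow_cmult[OF f, of 2 "of_real (c 0)"] by simp
  next
    case (Suc M)
    have s: "slow (\<lambda>x. of_real (c k) * ((-1) ^ k * Der (2 * k) f x))" for k
      by (intro slow_mult[OF slow_const] cls_funpow_deriv f)
    have t: "Der 2 (\<lambda>x. of_real (c k) * ((-1) ^ k * Der (2 * k) f x)) =
        (\<lambda>x. of_real (c k) * ((-1) ^ k * Der (2 * Suc k) f x))" for k
      using cls_funpow_cmult[OF cls_funpow_deriv[OF f, of "2 * k"], of 2 "of_real (c k) * (-1) ^ k"]
      by (simp add: mult.assoc numeral_2_eq_2)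
    have "slow (\<lambda>x. \<Sum>k\<le>M. of_real (c k) * ((-1) ^ k * Der (2 * k) f x))"
      by (intro slow_sum s) simp
    from cls_funpow_add[OF this s[of "Suc M"], of 2] show ?case
      unfolding sum.atMost_Suc Suc t .
  qed
  have "(\<lambda>x. - Der 2 (A f) x) = (\<lambda>x. \<Sum>k\<le>Suc N. of_real (d k) * ((-1) ^ k * Der (2 * k) f x))"
    if f: "slow f" for f
    unfolding c(3)[OF f] d2[OF f] d_def sum.atMost_Suc_shift by (simp add: sum_negf)
  moreover have "0 \<le> d k" for k unfolding d_def using c(1) by (simp split: nat.split)
  moreover have "d k = 0" if "k > Suc N" for k unfolding d_def using c(2) that by (simp split: nat.split)
  ultimately show ?thesis unfolding const_form_def by blast
qed

lemma const_form_deriv_power: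
  assumes A: "const_form A" and slow: "\<And>f. slow f \<Longrightarrow> slow (A f)"
  shows "const_form (\<lambda>f x. (-1) ^ l * Der (2 * l) (A f) x)"
proof (induction l)
  case 0
  then show ?case using A by simp
next
  case (Suc l)
  have "slow (\<lambda>x. (-1) ^ l * Der (2 * l) (A f) x)" if "slow f" for f
    by (intro slow_mult slow_const cls_funpow_deriv slow that)
  from const_form_deriv2[OF Suc this]
  have cf: "const_form (\<lambda>f x. - Der 2 (\<lambda>x. (-1) ^ l * Der (2 * l) (A f) x) x)" .
  have "(-1) ^ Suc l * Der (2 * Suc l) (A f) x =
      - Der 2 (\<lambda>x. (-1) ^ l * Der (2 * l) (A f) x) x" if f: "slow f" for f x
    using cls_funpow_cmult[OF cls_funpow_deriv[OF slow[OF f], of "2 * l"], of 2 "(-1) ^ l"]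
    by (simp add: numeral_2_eq_2)
  then have "(\<lambda>x. (-1) ^ Suc l * Der (2 * Suc l) (A f) x) =
      (\<lambda>x. - Der 2 (\<lambda>x. (-1) ^ l * Der (2 * l) (A f) x) x)" if f: "slow f" for f
    using f by blast
  with cf show ?case unfolding const_form_def by simp
qed

lemma diff_op_const_coeff:
  assumes f: "slow f"
  shows "diff_op m (\<lambda>l. [:c l:]) f = (\<lambda>x. \<Sum>l\<le>m. of_real (c l) * ((-1) ^ l * Der (2 * l) f x))"
proof
  fix x
  have "Der l (\<lambda>y. of_real (c l) * Der l f y) x = of_real (c l) * Der (2 * l) f x" for l
    using cls_funpow_cmult[OF cls_funpow_deriv[OF f, of l], of l "of_real (c l)"]
    by (simp add: funpow_add mult_2)
  then show "diff_op m (\<lambda>l. [:c l:]) f x = (\<Sum>l\<le>m. of_real (c l) * ((-1) ^ l * Der (2 * l) f x))"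
    unfolding diff_op_def by (simp add: mult.left_commute)
qed

lemma const_form_sum:
  assumes "\<And>l. const_form (A l)"
  shows "const_form (\<lambda>f x. \<Sum>l\<le>(m::nat). A l f x)"
proof (induction m)
  case 0
  show ?case using assms by simp
next
  case (Suc m)
  then show ?case using const_form_add[OF Suc assms] by simp
qed

lemma const_form_diff_op_power:
  assumes "\<And>l. 0 \<le> c l"
  shows "const_form (diff_op m (\<lambda>l. [:c l:]) ^^ n)"
proof (induction n)
  case 0
  have "(diff_op m (\<lambda>l. [:c l:]) ^^ 0) = (\<lambda>f. f)" by auto
  then show ?case using const_form_id by (simp add: id_def)
next
  case (Suc n)
  let ?A = "diff_op m (\<lambda>l. [:c l:]) ^^ n"
  have "const_form (\<lambda>f x. \<Sum>l\<le>m. of_real (c l) * ((-1) ^ l * Der (2 * l) (?A f) x))"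
    by (intro const_form_sum const_form_cmult const_form_deriv_power Suc slow_diff_op_power assms)
  then show ?case
    unfolding const_form_def
    by (simp add: diff_op_const_coeff slow_diff_op_power del: sum.atMost_Suc)
qed

text \<open>
  Adding the identity makes the coefficient of order \<open>0\<close> positive; zero coefficients at the top are cut
  off, so that the leading one is not zero.
\<close>

lemma shifted_const_form:
  assumes "const_form A"
  shows "\<exists>m b. admissible m b \<and> (\<forall>f. slow f \<longrightarrow> diff_op m b f = (\<lambda>x. A f x + f x))"
proof -
  obtain N c where c: "\<And>k. 0 \<le> c k" "\<And>k. k > N \<Longrightarrow> c k = 0" "\<And>f. slow f \<Longrightarrow>
     A f = (\<lambda>x. \<Sum>k\<le>N. of_real (c k) * ((-1) ^ k * Der (2 * k) f x))"
    using assms unfolding const_form_def by blast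
  define d where "d k = c k + (if k = 0 then 1 else 0)" for k
  have d0: "d 0 > 0" unfolding d_def using c(1)[of 0] by simp
  have d: "0 \<le> d k" for k unfolding d_def using c(1)[of k] by simp
  define S where "S = {k. k \<le> N \<and> d k \<noteq> 0}"
  have S: "finite S" "0 \<in> S" unfolding S_def using d0 by auto
  define m where "m = Max S"
  have "m \<in> S" unfolding m_def using S by (intro Max_in) auto
  then have m: "m \<le> N" "d m \<noteq> 0" unfolding S_def by auto
  have above: "d k = 0" if "m < k" "k \<le> N" for k
  proof (rule ccontr)
    assume "d k \<noteq> 0"
    then have "k \<in> S" unfolding S_def using that by simp
    then show False using Max_ge[OF S(1), of k] that unfolding m_def by simp
  qed
  have "[:d l:] = 0 \<or> (\<exists>\<epsilon>>0. \<forall>x. \<epsilon> \<le> poly [:d l:] x)" for l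
    using d[of l] by (cases "d l = 0") (auto intro!: exI[of _ "d l"])
  then have "admissible m (\<lambda>l. [:d l:])"
    unfolding admissible_def using m(2) d0 by auto
  moreover have "diff_op m (\<lambda>l. [:d l:]) f = (\<lambda>x. A f x + f x)" if f: "slow f" for f
  proof
    fix x
    let ?t = "\<lambda>k. (-1) ^ k * Der (2 * k) f x"
    have "diff_op m (\<lambda>l. [:d l:]) f x = (\<Sum>k\<le>m. of_real (d k) * ?t k)"
      unfolding diff_op_const_coeff[OF f] ..
    also have "\<dots> = (\<Sum>k\<le>N. of_real (d k) * ?t k)"
      using m(1) above by (intro sum.mono_neutral_left) auto
    also have "\<dots> = (\<Sum>k\<le>N. of_real (c k) * ?t k) + (\<Sum>k\<le>N. of_real (if k = 0 then 1 else 0) * ?t k)"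
      unfolding d_def of_real_add distrib_right sum.distrib ..
    also have "(\<Sum>k\<le>N. of_real (if k = 0 then 1 else 0) * ?t k) = (\<Sum>k\<in>{0}. of_real (if k = 0 then 1 else 0) * ?t k)"
      by (intro sum.mono_neutral_right) auto
    finally show "diff_op m (\<lambda>l. [:d l:]) f x = A f x + f x" unfolding c(3)[OF f] by simp
  qed
  ultimately show ?thesis by blast
qed

section \<open>Essential self-adjointness\<close>

lemma INF_poly_pos_imp_bounded_below:
  assumes "(INF x. ereal (poly p x)) > 0"
  shows "\<exists>\<epsilon>>0. \<forall>x. \<epsilon> \<le> poly p x"
proof -
  obtain e where e: "0 < ereal e" "ereal e < (INF x. ereal (poly p x))"
    using ereal_dense2[OF assms] by (metis)
  have "ereal e \<le> ereal (poly p x)" for x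
    using e(2) by (meson INF_lower UNIV_I less_imp_le order_trans)
  then show ?thesis using e(1) by auto
qed

lemma ext_degree_le_imp_degree_le:
  assumes "q \<noteq> 0" "ext_degree p \<le> max (ext_degree q) 0"
  shows "degree p \<le> degree q"
  using assms by (cases "p = 0") (auto simp: ext_degree_def max_def split: if_splits)

theorem theorem1p10:
  fixes m :: nat and b :: "nat \<Rightarrow> real poly"
  assumes "b m \<noteq> 0"
    and "\<And>l. l \<le> m \<Longrightarrow> (INF x. ereal (poly (b l) x)) > 0 \<or> b l = 0"
    and "\<And>l. 1 \<le> l \<Longrightarrow> l \<le> m \<Longrightarrow> ext_degree (b l) \<le> max (ext_degree (b 0)) 0"
  shows "\<forall>n::nat. essentially_self_adjoint (schwartz_operator (diff_op m b ^^ n))"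
proof
  fix n
  have low: "b l = 0 \<or> (\<exists>\<epsilon>>0. \<forall>x. \<epsilon> \<le> poly (b l) x)" if "l \<le> m" for l
    using assms(2)[OF that] INF_poly_pos_imp_bounded_below by blast
  show "essentially_self_adjoint (schwartz_operator (diff_op m b ^^ n))"
  proof (cases "b 0 = 0")
    case False
    have "degree (b l) \<le> degree (b 0)" if "l \<le> m" for l
      using ext_degree_le_imp_degree_le[OF False assms(3)] that by (cases "l = 0") auto
    then have "admissible m b"
      unfolding admissible_def using assms(1) False low by blast
    then show ?thesis
      by (rule essentially_self_adjoint_if_shift_is_power[where n' = n and c = 0]) simp
  next
    case True
    define c where "c l = (if l \<le> m then coeff (b l) 0 else 0)" for l
    have bc: "b l = [:c l:]" if "l \<le> m" for l
    proof -
      have "degree (b l) = 0"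
      proof (cases "l = 0")
        case False
        then have "ext_degree (b l) \<le> 0" using assms(3)[of l] that True by (simp add: ext_degree_def)
        then show ?thesis by (auto simp: ext_degree_def split: if_splits)
      qed (simp add: True)
      then show ?thesis using that unfolding c_def by (metis degree_0_id)
    qed
    have c: "0 \<le> c l" for l
    proof (cases "l \<le> m")
      case l: True
      have "poly (b l) 0 = c l" using bc[OF l] by simp
      then show ?thesis using low[OF l] by (metis less_imp_le order_refl order_trans poly_0)
    qed (simp add: c_def)
    have L: "diff_op m b = diff_op m (\<lambda>l. [:c l:])"
      unfolding diff_op_def using bc by (intro ext sum.cong) auto
    obtain m' b' where b': "admissible m' b'"
      "\<And>f. slow f \<Longrightarrow> diff_op m' b' f = (\<lambda>x. (diff_op m b ^^ n) f x + f x)"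
      using shifted_const_form[OF const_form_diff_op_power[where c = c, OF c, where m = m and n = n]] unfolding L by blast
    show ?thesis
      by (rule essentially_self_adjoint_if_shift_is_power[OF b'(1), where n' = 1 and c = 1])
        (simp add: b'(2) schwartz_slow)
  qed
qed

end
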